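(* Let $T>0$, let $a\in L^\infty([0,T])$ with $a\ge0$ a.e. and $a\not\equiv0$, and let $k\in\mathbb{N}$, $k\ge1$. The maps $$\Psi_k:\mathfrak{H}^{-1}(0)\to\mathfrak{F}^{-1}(0)\cap\mathcal{O}_k,\qquad (\lambda,x_1,x_2)\mapsto(\lambda,L(x_1,x_2)+\psi(\lambda,L(x_1,x_2))),$$ $$\Psi_k^{-1}:\mathfrak{F}^{-1}(0)\cap\mathcal{O}_k\to\mathfrak{H}^{-1}(0),\qquad (\lambda,u)\mapsto(\lambda,L^{-1}P_k[u]),$$ are inverse one of the other. Therefore $\Psi_k:\mathfrak{H}^{-1}(0)\to\mathfrak{F}^{-1}(0)\cap\mathcal{O}_k$ is a homeomorphism. Moreover, for every $(\lambda,x_1,x_2)\in\mathfrak{H}^{-1}(0)$, one has $\partial_{(x_1,x_2)}\mathfrak{H}(\lambda,x_1,x_2)\in GL(\mathbb{R}^2)$ if and only if $\partial_u\mathfrak{F}(\Psi_k(\lambda,x_1,x_2))\in GL(H^2(\mathbb{T}),L^2(\mathbb{T}))$.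
   Context: $\mathbb{T}=\mathbb{R}/(T\mathbb{Z})$; $H^s(\mathbb{T})$ is the space of real $u\in H^s([0,T])$ with $D^\alpha u(0)=D^\alpha u(T)$ for integers $0\le\alpha<s$, with inner product $(u,v)_{H^s}=\sum_{0\le\alpha\le s}\int_0^TD^\alpha u\,D^\alpha v\,dt$; $L^2(\mathbb{T})=H^0(\mathbb{T})$. $\mathfrak{F}:\mathbb{R}\times H^2(\mathbb{T})\to L^2(\mathbb{T})$, $\mathfrak{F}(\lambda,u)=u''+\lambda u+a(t)u^3$. $\sigma_k=(2\pi k/T)^2$. $GL(U,V)$ denotes the bounded linear isomorphisms from $U$ to $V$. Lyapunov–Schmidt setup for fixed $k\ge1$. Let $\varphi_k(t)=\sqrt{2/T}\cos(2\pi kt/T)$, $\phi_k(t)=\sqrt{2/T}\sin(2\pi kt/T)$, $N=\mathrm{span}\{\varphi_k,\phi_k\}$ (the kernel of $\mathfrak{L}(\sigma_k):v\mapsto v''+\sigma_kv$ on $H^2(\mathbb{T})$), $N^\perp$ its orthogonal complement in $H^2(\mathbb{T})$, $R=\{v\in L^2(\mathbb{T}):(v,\varphi_k)_{L^2}=(v,\phi_k)_{L^2}=0\}$ (the range of $\mathfrak{L}(\sigma_k)$), $P_k:H^2(\mathbb{T})\to N$ the $H^2$-orthogonal projection, and $Q_k[v]=(v,\varphi_k)_{L^2}\varphi_k+(v,\phi_k)_{L^2}\phi_k$. Let $\mathscr{G}_k:\mathbb{R}\times N\times N^\perp\to R$, $\mathscr{G}_k(\lambda,x,y)=(I-Q_k)\mathfrak{F}(\lambda,x+y)$.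 By the implicit function theorem at $(\sigma_k,0,0)$ one fixes (small enough) open neighborhoods $I_k\subset\mathbb{R}$ of $\sigma_k$, $\mathcal{N}_k\subset N$ of $0$, $\mathcal{O}_k\subset\mathbb{R}\times H^2(\mathbb{T})$ of $(\sigma_k,0)$, and a $\mathcal{C}^\infty$ map $\psi:I_k\times\mathcal{N}_k\to N^\perp$ with $\psi(\sigma_k,0)=0$, such that for $x\in N$, $y\in N^\perp$: $(\lambda,x+y)\in\mathcal{O}_k$ and $\mathscr{G}_k(\lambda,x,y)=0$ if and only if $(\lambda,x)\in I_k\times\mathcal{N}_k$ and $y=\psi(\lambda,x)$; moreover $\partial_y\mathscr{G}_k(\lambda,x,\psi(\lambda,x)):N^\perp\to R$ is an isomorphism for all $(\lambda,x)\in I_k\times\mathcal{N}_k$. Put $L:\mathbb{R}^2\to N$, $L(x_1,x_2)=x_1\varphi_k+x_2\phi_k$, $\Omega_k=L^{-1}(\mathcal{N}_k)\subset\mathbb{R}^2$, and define $\mathfrak{H}=(h_1,h_2):I_k\times\Omega_k\to\mathbb{R}^2$ by $$h_1=(Q_k\mathfrak{F}(\lambda,L(x_1,x_2)+\psi(\lambda,L(x_1,x_2))),\varphi_k)_{L^2},\quad h_2=(Q_k\mathfrak{F}(\lambda,L(x_1,x_2)+\psi(\lambda,L(x_1,x_2))),\phi_k)_{L^2}.$$ *)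

theory Defs
  imports "HOL-Analysis.Analysis"
begin

section \<open>Measurable functions modulo almost everywhere equality\<close>

text \<open>
  Every Lebesgue measurable function agrees almost everywhere with a Borel measurable one, so
  Borel measurable representatives suffice. Products are pointwise, hence powers such as
  \<open>u ^ 3\<close> are the pointwise ones.
\<close>

definition ae_rel :: "(real \<Rightarrow> real) \<Rightarrow> (real \<Rightarrow> real) \<Rightarrow> bool" where
  "ae_rel f g \<longleftrightarrow> f \<in> borel_measurable lborel \<and> g \<in> borel_measurable lborel \<and> (AE t in lborel. f t = g t)"

lemma part_equivp_ae_rel: "part_equivp ae_rel"
proof (rule part_equivpI)
  show "\<exists>f. ae_rel f f"
    by (rule exI[of _ "\<lambda>_. 0"]) (simp add: ae_rel_def)
  show "symp ae_rel"
    by (auto simp: ae_rel_def symp_def elim: eventually_mono)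
  show "transp ae_rel"
    unfolding ae_rel_def transp_def by (auto elim: eventually_elim2)
qed

quotient_type mfun = "real \<Rightarrow> real" / partial: ae_rel
  by (rule part_equivp_ae_rel)

instantiation mfun :: "{comm_ring_1, real_algebra_1}"
begin

lift_definition zero_mfun :: mfun is "\<lambda>_. 0"
  by (simp add: ae_rel_def)

lift_definition one_mfun :: mfun is "\<lambda>_. 1"
  by (simp add: ae_rel_def)

lift_definition plus_mfun :: "mfun \<Rightarrow> mfun \<Rightarrow> mfun" is "\<lambda>f g t. f t + g t"
  unfolding ae_rel_def by (auto elim: eventually_elim2)

lift_definition minus_mfun :: "mfun \<Rightarrow> mfun \<Rightarrow> mfun" is "\<lambda>f g t. f t - g t"
  unfolding ae_rel_def by (auto elim: eventually_elim2)

lift_definition uminus_mfun :: "mfun \<Rightarrow> mfun" is "\<lambda>f t. - f t"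
  unfolding ae_rel_def by (auto elim: eventually_mono)

lift_definition times_mfun :: "mfun \<Rightarrow> mfun \<Rightarrow> mfun" is "\<lambda>f g t. f t * g t"
  unfolding ae_rel_def by (auto elim: eventually_elim2)

lift_definition scaleR_mfun :: "real \<Rightarrow> mfun \<Rightarrow> mfun" is "\<lambda>c f t. c * f t"
  unfolding ae_rel_def by (auto elim: eventually_mono)

instance
proof
  fix f g h :: mfun and c d :: real
  show "f + g + h = f + (g + h)" by transfer (simp add: ae_rel_def algebra_simps)
  show "f + g = g + f" by transfer (simp add: ae_rel_def algebra_simps)
  show "0 + f = f" by transfer (simp add: ae_rel_def)
  show "- f + f = 0" by transfer (simp add: ae_rel_def)
  show "f - g = f + - g" by transfer (simp add: ae_rel_def)
  show "f * g * h = f * (g * h)" by transfer (simp add: ae_rel_def algebra_simps)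
  show "f * g = g * f" by transfer (simp add: ae_rel_def algebra_simps)
  show "f * (g + h) = f * g + f * h" by transfer (simp add: ae_rel_def algebra_simps)
  show "f * 1 = f" by transfer (simp add: ae_rel_def)
  show "1 * f = f" by transfer (simp add: ae_rel_def)
  show "(f + g) * h = f * h + g * h" by transfer (simp add: ae_rel_def algebra_simps)
  show "(0::mfun) \<noteq> 1"
    by transfer (simp add: ae_rel_def eventually_False trivial_limit_def[symmetric] ae_filter_eq_bot_iff)
  show "c *\<^sub>R (f + g) = c *\<^sub>R f + c *\<^sub>R g" by transfer (simp add: ae_rel_def algebra_simps)
  show "(c + d) *\<^sub>R f = c *\<^sub>R f + d *\<^sub>R f" by transfer (simp add: ae_rel_def algebra_simps)
  show "c *\<^sub>R d *\<^sub>R f = (c * d) *\<^sub>R f" by transfer (simp add: ae_rel_def algebra_simps)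
  show "1 *\<^sub>R f = f" by transfer (simp add: ae_rel_def)
  show "c *\<^sub>R f * g = c *\<^sub>R (f * g)" by transfer (simp add: ae_rel_def algebra_simps)
  show "f * c *\<^sub>R g = c *\<^sub>R (f * g)" by transfer (simp add: ae_rel_def algebra_simps)
qed

end

section \<open>Function spaces on the interval from 0 to T\<close>

text \<open>
  A function on \<open>[0,T]\<close> is represented by the class of its extension by zero to the real line.
  \<open>rep_mfun f\<close> is some representative of the class \<open>f\<close>; everything below is independent of the choice.
\<close>

definition mcls :: "real \<Rightarrow> (real \<Rightarrow> real) \<Rightarrow> mfun" where
  "mcls T f = abs_mfun (\<lambda>t. indicator {0..T} t * f t)"

definition supp_in :: "real \<Rightarrow> mfun \<Rightarrow> bool" where
  "supp_in T f \<longleftrightarrow> (AE t in lborel. t \<notin> {0..T} \<longrightarrow> rep_mfun f t = 0)"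

definition L1 :: "real \<Rightarrow> mfun set" where
  "L1 T = {f. supp_in T f \<and> set_integrable lborel {0..T} (rep_mfun f)}"

definition L2 :: "real \<Rightarrow> mfun set" where
  "L2 T = {f. supp_in T f \<and> set_integrable lborel {0..T} (\<lambda>t. (rep_mfun f t)\<^sup>2)}"

definition Linf :: "real \<Rightarrow> mfun set" where
  "Linf T = {f. supp_in T f \<and> (\<exists>C. AE t in lborel. t \<in> {0..T} \<longrightarrow> \<bar>rep_mfun f t\<bar> \<le> C)}"

definition ip2 :: "real \<Rightarrow> mfun \<Rightarrow> mfun \<Rightarrow> real" where
  "ip2 T f g = (LINT t:{0..T}|lborel. rep_mfun f t * rep_mfun g t)"

text \<open>
  On an interval \<open>u\<close> has the weak derivative \<open>v\<close> if \<open>u\<close> has an absolutely continuous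
  representative with almost everywhere derivative \<open>v\<close>, that is, one which is an indefinite
  integral of \<open>v\<close>.
\<close>

definition has_weak_deriv :: "real \<Rightarrow> mfun \<Rightarrow> mfun \<Rightarrow> bool" where
  "has_weak_deriv T u v \<longleftrightarrow>
     v \<in> L1 T \<and> (\<exists>c. u = mcls T (\<lambda>t. c + (LINT s:{0..t}|lborel. rep_mfun v s)))"

definition wderiv :: "real \<Rightarrow> mfun \<Rightarrow> mfun" where
  "wderiv T u = (THE v. has_weak_deriv T u v)"

text \<open>The value at \<open>t \<in> [0,T]\<close> of the continuous representative.\<close>

definition pt :: "real \<Rightarrow> mfun \<Rightarrow> real \<Rightarrow> real" where
  "pt T u t = (SOME f. continuous_on {0..T} f \<and> u = mcls T f) t"

definition Hper :: "nat \<Rightarrow> real \<Rightarrow> mfun set" where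
  "Hper s T = {u. (\<forall>\<alpha>\<le>s. (wderiv T ^^ \<alpha>) u \<in> L2 T) \<and>
     (\<forall>\<alpha><s. has_weak_deriv T ((wderiv T ^^ \<alpha>) u) ((wderiv T ^^ Suc \<alpha>) u) \<and>
            pt T ((wderiv T ^^ \<alpha>) u) 0 = pt T ((wderiv T ^^ \<alpha>) u) T)}"

definition ipH :: "nat \<Rightarrow> real \<Rightarrow> mfun \<Rightarrow> mfun \<Rightarrow> real" where
  "ipH s T u v = (\<Sum>\<alpha>\<le>s. ip2 T ((wderiv T ^^ \<alpha>) u) ((wderiv T ^^ \<alpha>) v))"

section \<open>Normed spaces with explicit carrier\<close>

text \<open>
  The spaces depend on the real number \<open>T\<close>, so they cannot be types; a normed space is a linear
  subspace of a real vector space type together with a norm on it.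
\<close>

record 'a nspace =
  carr :: "'a set"
  nrm :: "'a \<Rightarrow> real"

definition euclid :: "'a::real_normed_vector nspace" where
  "euclid = \<lparr>carr = UNIV, nrm = norm\<rparr>"

definition nsub :: "'a nspace \<Rightarrow> 'a set \<Rightarrow> 'a nspace" where
  "nsub X S = \<lparr>carr = S, nrm = nrm X\<rparr>"

definition nprod :: "'a nspace \<Rightarrow> 'b nspace \<Rightarrow> ('a \<times> 'b) nspace" where
  "nprod X Y = \<lparr>carr = carr X \<times> carr Y, nrm = (\<lambda>(x, y). sqrt ((nrm X x)\<^sup>2 + (nrm Y y)\<^sup>2))\<rparr>"

definition ntop :: "'a::real_vector nspace \<Rightarrow> 'a topology" where
  "ntop X = Metric_space.mtopology (carr X) (\<lambda>x y. nrm X (x - y))"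

definition blin :: "'a::real_vector nspace \<Rightarrow> 'b::real_vector nspace \<Rightarrow> ('a \<Rightarrow> 'b) \<Rightarrow> bool" where
  "blin X Y A \<longleftrightarrow>
     (\<forall>x\<in>carr X. A x \<in> carr Y) \<and>
     (\<forall>x\<in>carr X. \<forall>y\<in>carr X. A (x + y) = A x + A y) \<and>
     (\<forall>c. \<forall>x\<in>carr X. A (c *\<^sub>R x) = c *\<^sub>R A x) \<and>
     (\<exists>K. \<forall>x\<in>carr X. nrm Y (A x) \<le> K * nrm X x)"

definition GL :: "'a::real_vector nspace \<Rightarrow> 'b::real_vector nspace \<Rightarrow> ('a \<Rightarrow> 'b) set" where
  "GL X Y = {A. blin X Y A \<and> bij_betw A (carr X) (carr Y) \<and> blin Y X (inv_into (carr X) A)}"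

definition has_fderiv ::
  "'a::real_vector nspace \<Rightarrow> 'b::real_vector nspace \<Rightarrow> ('a \<Rightarrow> 'b) \<Rightarrow> ('a \<Rightarrow> 'b) \<Rightarrow> 'a \<Rightarrow> bool" where
  "has_fderiv X Y f A x \<longleftrightarrow> blin X Y A \<and>
     (\<forall>e>0. \<exists>d>0. \<forall>y\<in>carr X. nrm X (y - x) < d \<longrightarrow>
        f y \<in> carr Y \<and> nrm Y (f y - f x - A (y - x)) \<le> e * nrm X (y - x))"

text \<open>The derivative is unique on the carrier, and its values elsewhere are never used.\<close>

definition fderiv ::
  "'a::real_vector nspace \<Rightarrow> 'b::real_vector nspace \<Rightarrow> ('a \<Rightarrow> 'b) \<Rightarrow> 'a \<Rightarrow> 'a \<Rightarrow> 'b" where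
  "fderiv X Y f x = (SOME A. has_fderiv X Y f A x)"

text \<open>
  Smoothness on an open set \<open>U\<close> of a finite-dimensional space \<open>X\<close>, where all iterated
  directional derivatives being Frechet differentiable amounts to the map being of class C-infinity.
\<close>

primrec ck_on ::
  "nat \<Rightarrow> 'a::real_vector nspace \<Rightarrow> 'b::real_vector nspace \<Rightarrow> 'a set \<Rightarrow> ('a \<Rightarrow> 'b) \<Rightarrow> bool" where
  "ck_on 0 X Y U f \<longleftrightarrow> continuous_map (subtopology (ntop X) U) (ntop Y) f"
| "ck_on (Suc n) X Y U f \<longleftrightarrow>
     (\<forall>x\<in>U. \<exists>A. has_fderiv X Y f A x) \<and> (\<forall>v\<in>carr X. ck_on n X Y U (\<lambda>x. fderiv X Y f x v))"

definition smooth_on :: "'a::real_vector nspace \<Rightarrow> 'b::real_vector nspace \<Rightarrow> 'a set \<Rightarrow> ('a \<Rightarrow> 'b) \<Rightarrow> bool" where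
  "smooth_on X Y U f \<longleftrightarrow> (\<forall>n. ck_on n X Y U f)"

definition Hsp :: "nat \<Rightarrow> real \<Rightarrow> mfun nspace" where
  "Hsp s T = \<lparr>carr = Hper s T, nrm = (\<lambda>u. sqrt (ipH s T u u))\<rparr>"

section \<open>The equation and its Lyapunov--Schmidt reduction\<close>

definition FF :: "real \<Rightarrow> mfun \<Rightarrow> real \<Rightarrow> mfun \<Rightarrow> mfun" where
  "FF T a lam u = (wderiv T ^^ 2) u + lam *\<^sub>R u + a * u ^ 3"

definition sig :: "real \<Rightarrow> nat \<Rightarrow> real" where
  "sig T k = (2 * pi * real k / T)\<^sup>2"

definition phi_cos :: "real \<Rightarrow> nat \<Rightarrow> mfun" where
  "phi_cos T k = mcls T (\<lambda>t. sqrt (2 / T) * cos (2 * pi * real k * t / T))"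

definition phi_sin :: "real \<Rightarrow> nat \<Rightarrow> mfun" where
  "phi_sin T k = mcls T (\<lambda>t. sqrt (2 / T) * sin (2 * pi * real k * t / T))"

definition NN :: "real \<Rightarrow> nat \<Rightarrow> mfun set" where
  "NN T k = span {phi_cos T k, phi_sin T k}"

definition NNperp :: "real \<Rightarrow> nat \<Rightarrow> mfun set" where
  "NNperp T k = {y \<in> Hper 2 T. \<forall>x\<in>NN T k. ipH 2 T x y = 0}"

definition RR :: "real \<Rightarrow> nat \<Rightarrow> mfun set" where
  "RR T k = {v \<in> Hper 0 T. ip2 T v (phi_cos T k) = 0 \<and> ip2 T v (phi_sin T k) = 0}"

text \<open>The orthogonal projection onto \<open>N\<close> for the inner product of the Sobolev space of order two.\<close>

definition PP :: "real \<Rightarrow> nat \<Rightarrow> mfun \<Rightarrow> mfun" where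
  "PP T k u = (THE x. x \<in> NN T k \<and> u - x \<in> NNperp T k)"

definition QQ :: "real \<Rightarrow> nat \<Rightarrow> mfun \<Rightarrow> mfun" where
  "QQ T k v = ip2 T v (phi_cos T k) *\<^sub>R phi_cos T k + ip2 T v (phi_sin T k) *\<^sub>R phi_sin T k"

definition GG :: "real \<Rightarrow> mfun \<Rightarrow> nat \<Rightarrow> real \<Rightarrow> mfun \<Rightarrow> mfun \<Rightarrow> mfun" where
  "GG T a k lam x y = FF T a lam (x + y) - QQ T k (FF T a lam (x + y))"

definition LL :: "real \<Rightarrow> nat \<Rightarrow> real \<times> real \<Rightarrow> mfun" where
  "LL T k = (\<lambda>(x1, x2). x1 *\<^sub>R phi_cos T k + x2 *\<^sub>R phi_sin T k)"

definition HH :: "real \<Rightarrow> mfun \<Rightarrow> nat \<Rightarrow> (real \<times> mfun \<Rightarrow> mfun) \<Rightarrow> real \<Rightarrow> real \<times> real \<Rightarrow> real \<times> real" where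
  "HH T a k \<psi> lam p =
     (ip2 T (QQ T k (FF T a lam (LL T k p + \<psi> (lam, LL T k p)))) (phi_cos T k),
      ip2 T (QQ T k (FF T a lam (LL T k p + \<psi> (lam, LL T k p)))) (phi_sin T k))"

text \<open>The set of parameters \<open>LL T k -` Nk\<close> is the domain \<open>\<Omega>\<^sub>k\<close>.\<close>

definition HH_zeros ::
  "real \<Rightarrow> mfun \<Rightarrow> nat \<Rightarrow> (real \<times> mfun \<Rightarrow> mfun) \<Rightarrow> real set \<Rightarrow> mfun set \<Rightarrow> (real \<times> real \<times> real) set" where
  "HH_zeros T a k \<psi> I Nk = {(lam, p). lam \<in> I \<and> p \<in> LL T k -` Nk \<and> HH T a k \<psi> lam p = 0}"

definition FF_zeros :: "real \<Rightarrow> mfun \<Rightarrow> (real \<times> mfun) set" where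
  "FF_zeros T a = {(lam, u). u \<in> Hper 2 T \<and> FF T a lam u = 0}"

definition Psi :: "real \<Rightarrow> nat \<Rightarrow> (real \<times> mfun \<Rightarrow> mfun) \<Rightarrow> real \<times> real \<times> real \<Rightarrow> real \<times> mfun" where
  "Psi T k \<psi> = (\<lambda>(lam, p). (lam, LL T k p + \<psi> (lam, LL T k p)))"

definition Psi_inv :: "real \<Rightarrow> nat \<Rightarrow> real \<times> mfun \<Rightarrow> real \<times> real \<times> real" where
  "Psi_inv T k = (\<lambda>(lam, u). (lam, inv (LL T k) (PP T k u)))"

end

theory Submission
  imports Defs
begin

text \<open>
  The defining property of \<open>\<psi>\<close> says that the zeros of \<open>(I - Q) F\<close> in \<open>O\<close> form the graph of \<open>\<psi>\<close>, so a
  point \<open>(\<lambda>, L x + \<psi> (\<lambda>, L x))\<close> of this graph is a zero of \<open>F\<close> exactly when the remaining part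
  \<open>Q F\<close>, whose coordinates are \<open>H\<close>, vanishes. The parameter \<open>x\<close> is recovered continuously through the
  \<open>H\<^sup>2\<close>-orthogonal projection onto \<open>N\<close>, which is a bounded map given by two inner products.

  For the derivatives let \<open>A = \<partial>\<^sub>u F\<close> at the point. Differentiating \<open>G(\<lambda>, x, \<psi>(\<lambda>, x)) = 0\<close> in \<open>x\<close> gives
  \<open>A (L h + S h) = L (D h)\<close> with \<open>S\<close> the derivative of \<open>\<psi>\<close> and \<open>D = \<partial>H\<close>. Since
  \<open>(I - Q) A\<close> is an isomorphism from \<open>N\<^sup>\<bottom>\<close> onto \<open>R\<close>, the map \<open>D\<close> is the Schur complement of this
  block, and an inverse of \<open>D\<close> yields an explicit bounded inverse of \<open>A\<close>. The operator \<open>F\<close> is differentiable because \<open>H\<^sup>2\<close> embeds into \<open>L\<^sup>\<infinity>\<close>.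
\<close>

section \<open>Normed spaces\<close>

text \<open>The complement of \<open>N\<close> is taken for the \<open>H\<^sup>2\<close> product in
  the domain but for the \<open>L\<^sup>2\<close> product in the target, so two different
  projections are in play. What ties them together is a common section: weak differentiation acts on
  \<open>N\<close> as a quarter turn scaled by \<open>freq\<close>, so the trigonometric basis is
  orthogonal for every Sobolev product and only its length changes. The operator-theoretic step is
  therefore stated for two independent coordinate maps, each a left inverse of a parametrisation by
  the plane. Splitting \<open>H\<^sup>2\<close> along the tangent vectors \<open>L h + S h\<close>
  instead of along \<open>N\<close> makes \<open>A\<close> block triangular, with \<open>D\<close>
  and the given isomorphism on the diagonal. A second obstacle shapes the form of many statements:
  weak derivatives, projections and Frechet derivatives are picked by description or choice
  operators and are meaningful only on a carrier. Uniqueness has to come before any computation, and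
  invertibility has to be insensitive to values off the carrier.\<close>

text \<open>
  \<^locale>\<open>Metric_space\<close> wants a distance that is nonnegative and symmetric on the whole type, which is
  why two of the assumptions are not restricted to the carrier.
\<close>

locale nvs =
  fixes X :: "'a::real_vector nspace"
  assumes subspace_carr: "subspace (carr X)"
    and nrm_nonneg: "\<And>x. 0 \<le> nrm X x"
    and nrm_minus: "\<And>x. nrm X (- x) = nrm X x"
    and nrm_eq_0_iff: "\<And>x. x \<in> carr X \<Longrightarrow> nrm X x = 0 \<longleftrightarrow> x = 0"
    and nrm_scaleR: "\<And>c x. x \<in> carr X \<Longrightarrow> nrm X (c *\<^sub>R x) = \<bar>c\<bar> * nrm X x"
    and nrm_triangle: "\<And>x y. x \<in> carr X \<Longrightarrow> y \<in> carr X \<Longrightarrow> nrm X (x + y) \<le> nrm X x + nrm X y"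
begin

lemma carr_simps:
  "0 \<in> carr X"
  "x \<in> carr X \<Longrightarrow> y \<in> carr X \<Longrightarrow> x + y \<in> carr X"
  "x \<in> carr X \<Longrightarrow> y \<in> carr X \<Longrightarrow> x - y \<in> carr X"
  "x \<in> carr X \<Longrightarrow> c *\<^sub>R x \<in> carr X"
  using subspace_carr by (auto simp: subspace_0 subspace_add subspace_diff subspace_scale)

lemma nrm_0: "nrm X 0 = 0"
  using nrm_eq_0_iff carr_simps(1) by blast

lemma nrm_diff_commute: "nrm X (x - y) = nrm X (y - x)"
  using nrm_minus[of "x - y"] by simp

lemma Metric_space: "Metric_space (carr X) (\<lambda>x y. nrm X (x - y))"
proof
  show "nrm X (x - z) \<le> nrm X (x - y) + nrm X (y - z)"
    if "x \<in> carr X" "y \<in> carr X" "z \<in> carr X" for x y z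
    using nrm_triangle[of "x - y" "y - z"] that carr_simps by simp
qed (auto simp: nrm_nonneg nrm_diff_commute nrm_eq_0_iff carr_simps)

lemma nvs_nsub: "subspace S \<Longrightarrow> S \<subseteq> carr X \<Longrightarrow> nvs (nsub X S)"
  by unfold_locales
    (auto simp: nsub_def nrm_nonneg nrm_minus nrm_eq_0_iff nrm_scaleR nrm_triangle subset_iff)

end

lemma nvs_euclid: "nvs euclid"
  by unfold_locales (auto simp: euclid_def norm_triangle_ineq)

text \<open>The triangle inequality is monotonicity of the square root followed by the triangle
  inequality of the Euclidean plane.\<close>

lemma nvs_nprod:
  assumes "nvs X" "nvs Y" shows "nvs (nprod X Y)"
proof -
  interpret X: nvs X by fact
  interpret Y: nvs Y by fact
  have tri: "sqrt ((nrm X (x + x'))\<^sup>2 + (nrm Y (y + y'))\<^sup>2)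
      \<le> sqrt ((nrm X x)\<^sup>2 + (nrm Y y)\<^sup>2) + sqrt ((nrm X x')\<^sup>2 + (nrm Y y')\<^sup>2)"
    if "x \<in> carr X" "x' \<in> carr X" "y \<in> carr Y" "y' \<in> carr Y" for x x' y y'
  proof -
    have "sqrt ((nrm X (x + x'))\<^sup>2 + (nrm Y (y + y'))\<^sup>2)
        \<le> sqrt ((nrm X x + nrm X x')\<^sup>2 + (nrm Y y + nrm Y y')\<^sup>2)"
      using that by (intro real_sqrt_le_mono add_mono power_mono X.nrm_triangle Y.nrm_triangle
          X.nrm_nonneg Y.nrm_nonneg)
    then show ?thesis using real_sqrt_sum_squares_triangle_ineq order_trans by blast
  qed
  show ?thesis
  proof
    show "subspace (carr (nprod X Y))"
      using X.carr_simps Y.carr_simps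
      by (auto simp: nprod_def subspace_def zero_prod_def)
    show "nrm (nprod X Y) (c *\<^sub>R x) = \<bar>c\<bar> * nrm (nprod X Y) x" if "x \<in> carr (nprod X Y)" for c x
    proof -
      have "sqrt ((\<bar>c\<bar> * r)\<^sup>2 + (\<bar>c\<bar> * s)\<^sup>2) = \<bar>c\<bar> * sqrt (r\<^sup>2 + s\<^sup>2)" for r s
        by (simp add: power_mult_distrib flip: distrib_left) (simp add: real_sqrt_mult)
      then show ?thesis using that
        by (auto simp: nprod_def X.nrm_scaleR Y.nrm_scaleR)
    qed
  qed (auto simp: nprod_def X.nrm_nonneg Y.nrm_nonneg X.nrm_minus Y.nrm_minus X.nrm_eq_0_iff
      Y.nrm_eq_0_iff zero_prod_def tri split: prod.splits)
qed

section \<open>Bounded linear maps\<close>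

lemma blinD:
  assumes "blin X Y A"
  shows "x \<in> carr X \<Longrightarrow> A x \<in> carr Y"
    and "x \<in> carr X \<Longrightarrow> y \<in> carr X \<Longrightarrow> A (x + y) = A x + A y"
    and "x \<in> carr X \<Longrightarrow> A (c *\<^sub>R x) = c *\<^sub>R A x"
  using assms by (auto simp: blin_def)

lemma blin_0: "blin X Y A \<Longrightarrow> nvs X \<Longrightarrow> A 0 = 0"
  using blinD(3)[of X Y A 0 0] by (simp add: nvs.carr_simps)

lemma blin_diff:
  assumes "blin X Y A" "nvs X" "x \<in> carr X" "y \<in> carr X"
  shows "A (x - y) = A x - A y"
  using blinD(2)[OF assms(1) nvs.carr_simps(3)[OF assms(2,3,4)] assms(4)] by simp

text \<open>The constant is enlarged to be positive because later choices of radii divide by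
  it.\<close>

lemma blin_bound:
  assumes "blin X Y A" "nvs X"
  obtains K where "K > 0" "\<And>x. x \<in> carr X \<Longrightarrow> nrm Y (A x) \<le> K * nrm X x"
proof -
  obtain K where K: "\<And>x. x \<in> carr X \<Longrightarrow> nrm Y (A x) \<le> K * nrm X x"
    using assms(1) unfolding blin_def by blast
  have "nrm Y (A x) \<le> (\<bar>K\<bar> + 1) * nrm X x" if "x \<in> carr X" for x
    using K[OF that] mult_right_mono[of K "\<bar>K\<bar> + 1" "nrm X x"] nvs.nrm_nonneg[OF assms(2), of x]
    by linarith
  then show ?thesis using that[of "\<bar>K\<bar> + 1"] by auto
qed

lemma blinI:
  assumes "\<And>x. x \<in> carr X \<Longrightarrow> A x \<in> carr Y"
    and "\<And>x y. x \<in> carr X \<Longrightarrow> y \<in> carr X \<Longrightarrow> A (x + y) = A x + A y"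
    and "\<And>c x. x \<in> carr X \<Longrightarrow> A (c *\<^sub>R x) = c *\<^sub>R A x"
    and "\<And>x. x \<in> carr X \<Longrightarrow> nrm Y (A x) \<le> K * nrm X x"
  shows "blin X Y A"
  using assms unfolding blin_def by blast

lemma blin_cong:
  assumes "nvs X" "\<And>x. x \<in> carr X \<Longrightarrow> A x = B x" shows "blin X Y A \<longleftrightarrow> blin X Y B"
  using assms(2) nvs.carr_simps[OF assms(1)] unfolding blin_def by auto

lemma blin_compose:
  assumes "blin X Y A" "blin Y Z B" "nvs X" "nvs Y" shows "blin X Z (\<lambda>x. B (A x))"
proof -
  obtain K where K: "K > 0" "\<And>x. x \<in> carr X \<Longrightarrow> nrm Y (A x) \<le> K * nrm X x"
    using blin_bound assms(1,3) by blast
  obtain K' where K': "K' > 0" "\<And>x. x \<in> carr Y \<Longrightarrow> nrm Z (B x) \<le> K' * nrm Y x"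
    using blin_bound assms(2,4) by blast
  show ?thesis
  proof (rule blinI[where K = "K' * K"])
    show "nrm Z (B (A x)) \<le> K' * K * nrm X x" if "x \<in> carr X" for x
      using order_trans[OF K'(2)[OF blinD(1)[OF assms(1) that]] mult_left_mono[OF K(2)[OF that]]] K'(1)
      by (simp add: mult.assoc)
  qed (use assms(1,2) in \<open>simp_all add: blinD\<close>)
qed

lemma blin_add:
  assumes "blin X Y A" "blin X Y B" "nvs X" "nvs Y" shows "blin X Y (\<lambda>x. A x + B x)"
proof -
  obtain K where K: "K > 0" "\<And>x. x \<in> carr X \<Longrightarrow> nrm Y (A x) \<le> K * nrm X x"
    using blin_bound assms(1,3) by blast
  obtain K' where K': "K' > 0" "\<And>x. x \<in> carr X \<Longrightarrow> nrm Y (B x) \<le> K' * nrm X x"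
    using blin_bound assms(2,3) by blast
  show ?thesis
  proof (rule blinI[where K = "K + K'"])
    show "nrm Y (A x + B x) \<le> (K + K') * nrm X x" if "x \<in> carr X" for x
      using nvs.nrm_triangle[OF assms(4), of "A x" "B x"] K(2)[OF that] K'(2)[OF that]
        blinD(1)[OF assms(1) that] blinD(1)[OF assms(2) that]
      by (simp add: distrib_right)
  qed (use assms in \<open>simp_all add: blinD nvs.carr_simps scaleR_add_right\<close>)
qed

lemma blin_scaleR:
  assumes "blin X Y A" "nvs X" "nvs Y" shows "blin X Y (\<lambda>x. c *\<^sub>R A x)"
proof -
  obtain K where K: "K > 0" "\<And>x. x \<in> carr X \<Longrightarrow> nrm Y (A x) \<le> K * nrm X x"
    using blin_bound assms(1,2) by blast
  show ?thesis
  proof (rule blinI[where K = "\<bar>c\<bar> * K"])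
    show "nrm Y (c *\<^sub>R A x) \<le> \<bar>c\<bar> * K * nrm X x" if "x \<in> carr X" for x
      using mult_left_mono[OF K(2)[OF that], of "\<bar>c\<bar>"] blinD(1)[OF assms(1) that]
      by (simp add: mult.assoc nvs.nrm_scaleR[OF assms(3)])
  qed (use assms in \<open>simp_all add: blinD nvs.carr_simps scaleR_add_right\<close>)
qed

lemma blin_minus:
  assumes "blin X Y A" "blin X Y B" "nvs X" "nvs Y" shows "blin X Y (\<lambda>x. A x - B x)"
  using blin_add[OF assms(1) blin_scaleR[OF assms(2-4), of "-1"] assms(3,4)] by simp

lemma blin_id: "nvs X \<Longrightarrow> S \<subseteq> carr X \<Longrightarrow> blin (nsub X S) X (\<lambda>x. x)"
  by (rule blinI[where K = 1]) (auto simp: nsub_def)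

lemma blin_into_nsub:
  assumes "blin X Y A" "\<And>x. x \<in> carr X \<Longrightarrow> A x \<in> S" shows "blin X (nsub Y S) A"
  using assms unfolding blin_def by (auto simp: nsub_def)

lemma blin_euclid_iff: "blin euclid euclid A \<longleftrightarrow> bounded_linear A"
  unfolding blin_def euclid_def bounded_linear_def bounded_linear_axioms_def linear_iff
  by (simp add: mult.commute conj_assoc)

text \<open>\<open>inv_into\<close> is awkward to compute with; any bounded two-sided inverse on the
  carriers agrees with it there and is easier to exhibit.\<close>

lemma GL_iff:
  assumes "nvs X" "nvs Y"
  shows "A \<in> GL X Y \<longleftrightarrow> blin X Y A \<and>
    (\<exists>g. blin Y X g \<and> (\<forall>x\<in>carr X. g (A x) = x) \<and> (\<forall>y\<in>carr Y. A (g y) = y))"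
proof
  assume A: "A \<in> GL X Y"
  then have b: "bij_betw A (carr X) (carr Y)" by (simp add: GL_def)
  show "blin X Y A \<and> (\<exists>g. blin Y X g \<and> (\<forall>x\<in>carr X. g (A x) = x) \<and> (\<forall>y\<in>carr Y. A (g y) = y))"
    using A bij_betw_inv_into_left[OF b] bij_betw_inv_into_right[OF b] by (auto simp: GL_def)
next
  assume "blin X Y A \<and>
    (\<exists>g. blin Y X g \<and> (\<forall>x\<in>carr X. g (A x) = x) \<and> (\<forall>y\<in>carr Y. A (g y) = y))"
  then obtain g where A: "blin X Y A" and g: "blin Y X g"
    and gA: "\<And>x. x \<in> carr X \<Longrightarrow> g (A x) = x" and Ag: "\<And>y. y \<in> carr Y \<Longrightarrow> A (g y) = y" by blast
  have b: "bij_betw A (carr X) (carr Y)"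
    by (rule bij_betwI[where g = g]) (use A g gA Ag in \<open>auto simp: blinD\<close>)
  have "inv_into (carr X) A y = g y" if "y \<in> carr Y" for y
    by (rule inv_into_f_eq) (use b that g Ag in \<open>auto simp: blinD bij_betw_def\<close>)
  then have "blin Y X (inv_into (carr X) A)"
    using blin_cong[OF assms(2)] g by metis
  with A b show "A \<in> GL X Y" by (simp add: GL_def)
qed

text \<open>Values off the carrier do not enter \<open>GL\<close>, so a derivative chosen by
  \<open>SOME\<close> may be exchanged for an explicit one.\<close>

lemma GL_cong:
  assumes "nvs X" "nvs Y" "\<And>x. x \<in> carr X \<Longrightarrow> A x = B x"
  shows "A \<in> GL X Y \<longleftrightarrow> B \<in> GL X Y"
proof -
  have 1: "blin Y X g \<Longrightarrow> (\<forall>y\<in>carr Y. A (g y) = y) \<longleftrightarrow> (\<forall>y\<in>carr Y. B (g y) = y)" for g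
    using assms(3) by (auto simp: blinD)
  have 2: "(\<forall>x\<in>carr X. g (A x) = x) \<longleftrightarrow> (\<forall>x\<in>carr X. g (B x) = x)" for g
    using assms(3) by auto
  have 3: "blin X Y A \<longleftrightarrow> blin X Y B"
    using blin_cong assms(1,3) by blast
  show ?thesis
    unfolding GL_iff[OF assms(1,2)] 2 3 using 1 by (intro conj_cong refl ex_cong1) auto
qed

section \<open>Frechet derivatives\<close>

lemma has_fderiv_blin: "has_fderiv X Y f A x \<Longrightarrow> blin X Y A"
  by (simp add: has_fderiv_def)

lemma has_fderiv_eps:
  assumes "has_fderiv X Y f A x" "e > 0"
  obtains d where "d > 0" "\<And>y. y \<in> carr X \<Longrightarrow> nrm X (y - x) < d \<Longrightarrow> f y \<in> carr Y"
    "\<And>y. y \<in> carr X \<Longrightarrow> nrm X (y - x) < d \<Longrightarrow> nrm Y (f y - f x - A (y - x)) \<le> e * nrm X (y - x)"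
  using assms unfolding has_fderiv_def by metis

lemma has_fderiv_value:
  assumes "has_fderiv X Y f A x" "nvs X" "x \<in> carr X" shows "f x \<in> carr Y"
proof -
  obtain d where "d > 0" "\<forall>y\<in>carr X. nrm X (y - x) < d \<longrightarrow> f y \<in> carr Y"
    using assms(1) zero_less_one unfolding has_fderiv_def by meson
  then show ?thesis using nvs.nrm_0[OF assms(2)] assms(3) by simp
qed

text \<open>Taking the tolerance 1 in the definition costs one more than a bound of the
  derivative.\<close>

lemma has_fderiv_lipschitz:
  assumes "has_fderiv X Y f A x" "nvs X" "nvs Y" "x \<in> carr X"
  obtains d K where "d > 0" "K > 0"
    "\<And>y. y \<in> carr X \<Longrightarrow> nrm X (y - x) < d \<Longrightarrow> nrm Y (f y - f x) \<le> K * nrm X (y - x)"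
proof -
  interpret X: nvs X by fact
  interpret Y: nvs Y by fact
  note A = has_fderiv_blin[OF assms(1)]
  obtain K where K: "K > 0" "\<And>x. x \<in> carr X \<Longrightarrow> nrm Y (A x) \<le> K * nrm X x"
    using blin_bound A assms(2) by blast
  obtain d where d: "d > 0" "\<And>y. y \<in> carr X \<Longrightarrow> nrm X (y - x) < d \<Longrightarrow> f y \<in> carr Y"
    "\<And>y. y \<in> carr X \<Longrightarrow> nrm X (y - x) < d \<Longrightarrow> nrm Y (f y - f x - A (y - x)) \<le> 1 * nrm X (y - x)"
    using has_fderiv_eps[OF assms(1) zero_less_one] by blast
  have "nrm Y (f y - f x) \<le> (K + 1) * nrm X (y - x)" if y: "y \<in> carr X" "nrm X (y - x) < d" for y
  proof -
    have "f y \<in> carr Y" "f x \<in> carr Y" "A (y - x) \<in> carr Y" "y - x \<in> carr X"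
      using d y A assms(4) has_fderiv_value[OF assms(1,2,4)] by (auto simp: blinD X.carr_simps)
    then show ?thesis
      using Y.nrm_triangle[of "f y - f x - A (y - x)" "A (y - x)"] d(3)[OF y] K(2)[of "y - x"]
      by (simp add: Y.carr_simps distrib_right)
  qed
  then show ?thesis using that d(1) K(1) by (metis add_pos_pos zero_less_one)
qed

lemma has_fderiv_compose:
  assumes f: "has_fderiv X Y f A x" and g: "has_fderiv Y Z g B (f x)"
    and "nvs X" "nvs Y" "nvs Z" and x: "x \<in> carr X"
  shows "has_fderiv X Z (\<lambda>x. g (f x)) (\<lambda>h. B (A h)) x"
proof -
  interpret X: nvs X by fact
  interpret Y: nvs Y by fact
  interpret Z: nvs Z by fact
  note A = has_fderiv_blin[OF f] and B = has_fderiv_blin[OF g]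
  have fx: "f x \<in> carr Y" using has_fderiv_value[OF f \<open>nvs X\<close> x] .
  have gfx: "g (f x) \<in> carr Z" using has_fderiv_value[OF g \<open>nvs Y\<close> fx] .
  obtain M where M: "M > 0" "\<And>x. x \<in> carr Y \<Longrightarrow> nrm Z (B x) \<le> M * nrm Y x"
    using blin_bound B \<open>nvs Y\<close> by blast
  obtain d1 K where d1: "d1 > 0" and K: "K > 0"
    and lip: "\<And>y. y \<in> carr X \<Longrightarrow> nrm X (y - x) < d1 \<Longrightarrow> nrm Y (f y - f x) \<le> K * nrm X (y - x)"
    using has_fderiv_lipschitz[OF f \<open>nvs X\<close> \<open>nvs Y\<close> x] by blast
  show ?thesis unfolding has_fderiv_def
  proof (intro conjI allI impI)
    show "blin X Z (\<lambda>h. B (A h))" using blin_compose A B assms by blast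
    fix e :: real assume "e > 0"
    \<comment> \<open>The error is the remainder of \<open>g\<close> plus \<open>B\<close> applied
      to the remainder \<open>r\<close> of \<open>f\<close>. The Lipschitz constant \<open>K\<close>
      of \<open>f\<close> scales the first and the bound \<open>M\<close> of \<open>B\<close> the
      second, so each gets half of \<open>e\<close>.\<close>
    then have e1: "e / (2 * M) > 0" and e2: "e / (2 * K) > 0" using M K by auto
    obtain d2 where d2: "d2 > 0" "\<And>y. y \<in> carr X \<Longrightarrow> nrm X (y - x) < d2 \<Longrightarrow> f y \<in> carr Y"
      "\<And>y. y \<in> carr X \<Longrightarrow> nrm X (y - x) < d2 \<Longrightarrow>
        nrm Y (f y - f x - A (y - x)) \<le> e / (2 * M) * nrm X (y - x)"
      using has_fderiv_eps[OF f e1] by blast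
    obtain d3 where d3: "d3 > 0" "\<And>y. y \<in> carr Y \<Longrightarrow> nrm Y (y - f x) < d3 \<Longrightarrow> g y \<in> carr Z"
      "\<And>y. y \<in> carr Y \<Longrightarrow> nrm Y (y - f x) < d3 \<Longrightarrow>
        nrm Z (g y - g (f x) - B (y - f x)) \<le> e / (2 * K) * nrm Y (y - f x)"
      using has_fderiv_eps[OF g e2] by blast
    show "\<exists>d>0. \<forall>y\<in>carr X. nrm X (y - x) < d \<longrightarrow> g (f y) \<in> carr Z \<and>
        nrm Z (g (f y) - g (f x) - B (A (y - x))) \<le> e * nrm X (y - x)"
    proof (intro exI[of _ "min (min d1 d2) (d3 / K)"] conjI ballI impI)
      show "0 < min (min d1 d2) (d3 / K)" using d1 d2 d3 K by simp
      fix y assume y: "y \<in> carr X" and yd: "nrm X (y - x) < min (min d1 d2) (d3 / K)"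
      have fy: "f y \<in> carr Y" using d2 y yd by simp
      have l: "nrm Y (f y - f x) \<le> K * nrm X (y - x)" using lip y yd by simp
      moreover have "K * nrm X (y - x) < d3" using yd K by (simp add: field_simps)
      ultimately have l3: "nrm Y (f y - f x) < d3" by simp
      show gfy: "g (f y) \<in> carr Z" using d3 fy l3 by simp
      have Ay: "A (y - x) \<in> carr Y" using A y x by (simp add: blinD X.carr_simps)
      define r where "r = f y - f x - A (y - x)"
      have r: "r \<in> carr Y" using fy fx Ay by (simp add: r_def Y.carr_simps)
      have Br: "B (f y - f x) - B (A (y - x)) = B r"
        using blin_diff[OF B \<open>nvs Y\<close>] fy fx Ay by (simp add: r_def Y.carr_simps)
      have "nrm Z (B r) \<le> M * (e / (2 * M) * nrm X (y - x))"
        using order_trans[OF M(2)[OF r] mult_left_mono[OF d2(3)[OF y], folded r_def]] yd M by simp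
      then have 1: "nrm Z (B r) \<le> e / 2 * nrm X (y - x)" using M by simp
      have "nrm Z (g (f y) - g (f x) - B (f y - f x)) \<le> e / (2 * K) * (K * nrm X (y - x))"
        using order_trans[OF d3(3)[OF fy l3] mult_left_mono[OF l]] e2 by simp
      then have 2: "nrm Z (g (f y) - g (f x) - B (f y - f x)) \<le> e / 2 * nrm X (y - x)" using K by simp
      have "nrm Z (g (f y) - g (f x) - B (A (y - x))) =
          nrm Z ((g (f y) - g (f x) - B (f y - f x)) + B r)"
        by (simp flip: Br)
      also have "\<dots> \<le> nrm Z (g (f y) - g (f x) - B (f y - f x)) + nrm Z (B r)"
        using gfy gfx B fy fx r by (intro Z.nrm_triangle) (simp_all add: blinD Y.carr_simps Z.carr_simps)
      also have "\<dots> \<le> e * nrm X (y - x)" using 1 2 by simp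
      finally show "nrm Z (g (f y) - g (f x) - B (A (y - x))) \<le> e * nrm X (y - x)" .
    qed
  qed
qed

lemma has_fderiv_affine:
  assumes "blin X Y A" "nvs X" "nvs Y" "c \<in> carr Y" "x \<in> carr X"
  shows "has_fderiv X Y (\<lambda>x. c + A x) A x"
  unfolding has_fderiv_def
proof (intro conjI allI impI)
  fix e :: real assume "e > 0"
  have "c + A y - (c + A x) - A (y - x) = 0" if "y \<in> carr X" for y
    using blin_diff[OF assms(1,2) that assms(5)] by simp
  then show "\<exists>d>0. \<forall>y\<in>carr X. nrm X (y - x) < d \<longrightarrow> c + A y \<in> carr Y \<and>
      nrm Y (c + A y - (c + A x) - A (y - x)) \<le> e * nrm X (y - x)"
    using assms nvs.nrm_0[OF assms(3)] nvs.nrm_nonneg[OF assms(2)] \<open>e > 0\<close>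
    by (intro exI[of _ 1]) (auto simp: blinD nvs.carr_simps)
qed fact

lemma has_fderiv_linear:
  assumes "blin X Y A" "nvs X" "nvs Y" "x \<in> carr X" shows "has_fderiv X Y A A x"
  using has_fderiv_affine[OF assms(1-3) nvs.carr_simps(1)[OF assms(3)] assms(4)] by simp

lemma has_fderiv_add:
  assumes "has_fderiv X Y f A x" "has_fderiv X Y g B x" "nvs X" "nvs Y" "x \<in> carr X"
  shows "has_fderiv X Y (\<lambda>x. f x + g x) (\<lambda>h. A h + B h) x"
proof -
  interpret X: nvs X by fact
  interpret Y: nvs Y by fact
  note A = has_fderiv_blin[OF assms(1)] and B = has_fderiv_blin[OF assms(2)]
  note v = has_fderiv_value[OF assms(1,3,5)] has_fderiv_value[OF assms(2,3,5)]
  show ?thesis unfolding has_fderiv_def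
  proof (intro conjI allI impI)
    show "blin X Y (\<lambda>h. A h + B h)" using blin_add A B assms by blast
    fix e :: real assume "e > 0"
    then have e: "e / 2 > 0" by simp
    obtain d where d: "d > 0" "\<And>y. y \<in> carr X \<Longrightarrow> nrm X (y - x) < d \<Longrightarrow> f y \<in> carr Y"
      "\<And>y. y \<in> carr X \<Longrightarrow> nrm X (y - x) < d \<Longrightarrow> nrm Y (f y - f x - A (y - x)) \<le> e / 2 * nrm X (y - x)"
      using has_fderiv_eps[OF assms(1) e] by blast
    obtain d' where d': "d' > 0" "\<And>y. y \<in> carr X \<Longrightarrow> nrm X (y - x) < d' \<Longrightarrow> g y \<in> carr Y"
      "\<And>y. y \<in> carr X \<Longrightarrow> nrm X (y - x) < d' \<Longrightarrow> nrm Y (g y - g x - B (y - x)) \<le> e / 2 * nrm X (y - x)"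
      using has_fderiv_eps[OF assms(2) e] by blast
    show "\<exists>d>0. \<forall>y\<in>carr X. nrm X (y - x) < d \<longrightarrow> f y + g y \<in> carr Y \<and>
        nrm Y (f y + g y - (f x + g x) - (A (y - x) + B (y - x))) \<le> e * nrm X (y - x)"
    proof (intro exI[of _ "min d d'"] conjI ballI impI)
      fix y assume y: "y \<in> carr X" "nrm X (y - x) < min d d'"
      have m: "f y \<in> carr Y" "g y \<in> carr Y" "A (y - x) \<in> carr Y" "B (y - x) \<in> carr Y"
        using d d' y A B assms(5) by (auto simp: blinD X.carr_simps)
      then show "f y + g y \<in> carr Y" by (simp add: Y.carr_simps)
      have "nrm Y (f y + g y - (f x + g x) - (A (y - x) + B (y - x)))
          = nrm Y ((f y - f x - A (y - x)) + (g y - g x - B (y - x)))"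
        by (simp add: algebra_simps)
      also have "\<dots> \<le> nrm Y (f y - f x - A (y - x)) + nrm Y (g y - g x - B (y - x))"
        using m v by (intro Y.nrm_triangle) (simp_all add: Y.carr_simps)
      also have "\<dots> \<le> e * nrm X (y - x)" using d(3)[of y] d'(3)[of y] y by simp
      finally show "nrm Y (f y + g y - (f x + g x) - (A (y - x) + B (y - x))) \<le> e * nrm X (y - x)" .
    qed (use d d' in simp)
  qed
qed

text \<open>Along the ray \<open>x + t *\<^sub>R h\<close> the vector
  \<open>t *\<^sub>R (A h - B h)\<close> is a difference of two remainders; dividing by
  \<open>t\<close> leaves an arbitrarily small bound.\<close>

lemma has_fderiv_unique:
  assumes "has_fderiv X Y f A x" "has_fderiv X Y f B x" "nvs X" "nvs Y" "x \<in> carr X" "h \<in> carr X"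
  shows "A h = B h"
proof -
  interpret X: nvs X by fact
  interpret Y: nvs Y by fact
  note A = has_fderiv_blin[OF assms(1)] and B = has_fderiv_blin[OF assms(2)]
  note fx = has_fderiv_value[OF assms(1,3,5)]
  have ABh: "A h \<in> carr Y" "B h \<in> carr Y" using A B assms(6) by (auto simp: blinD)
  have bound: "nrm Y (A h - B h) \<le> 2 * e * nrm X h" if e: "e > 0" for e
  proof -
    obtain d where d: "d > 0" "\<And>y. y \<in> carr X \<Longrightarrow> nrm X (y - x) < d \<Longrightarrow> f y \<in> carr Y"
      "\<And>y. y \<in> carr X \<Longrightarrow> nrm X (y - x) < d \<Longrightarrow> nrm Y (f y - f x - A (y - x)) \<le> e * nrm X (y - x)"
      using has_fderiv_eps[OF assms(1) e] by blast
    obtain d' where d': "d' > 0" "\<And>y. y \<in> carr X \<Longrightarrow> nrm X (y - x) < d' \<Longrightarrow> f y \<in> carr Y"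
      "\<And>y. y \<in> carr X \<Longrightarrow> nrm X (y - x) < d' \<Longrightarrow> nrm Y (f y - f x - B (y - x)) \<le> e * nrm X (y - x)"
      using has_fderiv_eps[OF assms(2) e] by blast
    \<comment> \<open>The step keeps \<open>x + t *\<^sub>R h\<close> inside both balls; the summand
      1 keeps the quotient meaningful when \<open>h\<close> is zero.\<close>
    define t where "t = min d d' / (2 * (nrm X h + 1))"
    have t: "t > 0" using d d' X.nrm_nonneg[of h] by (simp add: t_def add_nonneg_pos)
    have "t * nrm X h \<le> min d d' / 2"
    proof -
      have "t * nrm X h \<le> t * (nrm X h + 1)" using t by simp
      also have "\<dots> = min d d' / 2"
      proof -
        have "nrm X h + 1 \<noteq> 0" using X.nrm_nonneg[of h] by linarith
        moreover have "m / (2 * n) * n = m / 2" if "n \<noteq> 0" for m n :: real using that by simp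
        ultimately show ?thesis unfolding t_def by blast
      qed
      finally show ?thesis .
    qed
    then have th: "t * nrm X h < min d d'" using d(1) d'(1) by linarith
    define y where "y = x + t *\<^sub>R h"
    have y: "y \<in> carr X" using assms by (simp add: y_def X.carr_simps)
    have yx: "y - x = t *\<^sub>R h" by (simp add: y_def)
    have n: "nrm X (y - x) = t * nrm X h" using t assms(6) by (simp add: yx X.nrm_scaleR)
    have Ay: "A (y - x) = t *\<^sub>R A h" "B (y - x) = t *\<^sub>R B h"
      unfolding yx using A B assms(6) by (auto simp: blinD)
    have fy: "f y \<in> carr Y" using d y n th by simp
    have "t * nrm Y (A h - B h) = nrm Y (t *\<^sub>R (A h - B h))"
      using t ABh by (simp add: Y.nrm_scaleR Y.carr_simps)
    also have "t *\<^sub>R (A h - B h) = (f y - f x - B (y - x)) + (- (f y - f x - A (y - x)))"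
      by (simp add: Ay algebra_simps)
    also have "nrm Y \<dots> \<le> nrm Y (f y - f x - B (y - x)) + nrm Y (- (f y - f x - A (y - x)))"
    proof (rule Y.nrm_triangle)
      show "- (f y - f x - A (y - x)) \<in> carr Y"
        using fy fx ABh Y.carr_simps(4)[of _ "-1"] unfolding Ay by (simp add: Y.carr_simps del: minus_diff_eq)
    qed (use fy fx ABh in \<open>simp add: Ay Y.carr_simps\<close>)
    also have "\<dots> \<le> e * (t * nrm X h) + e * (t * nrm X h)"
      using d(3)[OF y] d'(3)[OF y] n th unfolding Y.nrm_minus by simp
    finally have "t * nrm Y (A h - B h) \<le> t * (2 * e * nrm X h)" by (simp add: algebra_simps)
    then show ?thesis using t by simp
  qed
  have "nrm Y (A h - B h) \<le> 0"
  proof (rule field_le_epsilon)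
    fix e :: real assume e: "e > 0"
    have "nrm Y (A h - B h) \<le> 2 * (e / (2 * (nrm X h + 1))) * nrm X h"
      using e X.nrm_nonneg[of h] by (intro bound) (simp add: add_nonneg_pos)
    also have "2 * (e / (2 * (nrm X h + 1))) * nrm X h = e * (nrm X h / (nrm X h + 1))"
    proof -
      have "2 * (e / (2 * m)) * n = e * (n / m)" for m n by simp
      then show ?thesis .
    qed
    also have "\<dots> \<le> e * 1"
      using e X.nrm_nonneg[of h] by (intro mult_left_mono) (simp_all add: divide_le_eq)
    finally show "nrm Y (A h - B h) \<le> 0 + e" by simp
  qed
  then have "nrm Y (A h - B h) = 0" using Y.nrm_nonneg by (simp add: order_antisym)
  then show ?thesis using Y.nrm_eq_0_iff ABh by (simp add: Y.carr_simps)
qed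

lemma fderiv_eq:
  assumes "has_fderiv X Y f A x" "nvs X" "nvs Y" "x \<in> carr X" "h \<in> carr X"
  shows "fderiv X Y f x h = A h"
proof -
  have "has_fderiv X Y f (fderiv X Y f x) x"
    unfolding fderiv_def by (rule someI[of "\<lambda>A. has_fderiv X Y f A x", OF assms(1)])
  then show ?thesis using has_fderiv_unique assms by blast
qed

text \<open>Differentiability is local. This is what allows the projected equation, which is known
  to vanish only near a parameter, to be differentiated as the zero map.\<close>

lemma has_fderiv_transform:
  assumes "has_fderiv X Y f A x" "nvs X" "x \<in> carr X" "d > 0"
    and "\<And>y. y \<in> carr X \<Longrightarrow> nrm X (y - x) < d \<Longrightarrow> f y = g y"
  shows "has_fderiv X Y g A x"
  unfolding has_fderiv_def
proof (intro conjI allI impI)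
  show "blin X Y A" using assms by (simp add: has_fderiv_def)
  fix e :: real assume "e > 0"
  then obtain d' where d': "d' > 0" "\<And>y. y \<in> carr X \<Longrightarrow> nrm X (y - x) < d' \<Longrightarrow> f y \<in> carr Y"
    "\<And>y. y \<in> carr X \<Longrightarrow> nrm X (y - x) < d' \<Longrightarrow> nrm Y (f y - f x - A (y - x)) \<le> e * nrm X (y - x)"
    using has_fderiv_eps[OF assms(1)] by blast
  have "f x = g x" using assms nvs.nrm_0[OF assms(2)] by simp
  then have "g y \<in> carr Y \<and> nrm Y (g y - g x - A (y - x)) \<le> e * nrm X (y - x)"
    if "y \<in> carr X" "nrm X (y - x) < min d d'" for y
    using d'(2,3)[of y] assms(5)[of y] that by simp
  then show "\<exists>d>0. \<forall>y\<in>carr X. nrm X (y - x) < d \<longrightarrow> g y \<in> carr Y \<and>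
      nrm Y (g y - g x - A (y - x)) \<le> e * nrm X (y - x)"
    using d'(1) assms(4) by (intro exI[of _ "min d d'"]) simp
qed

text \<open>The derivative of \<open>HH\<close> is stated with \<open>frechet_derivative\<close>,
  while the chain rule at hand is the one for carriers.\<close>

lemma has_fderiv_euclid_imp:
  assumes "has_fderiv euclid euclid f A x" shows "(f has_derivative A) (at x)"
  unfolding has_derivative_at_alt
proof (intro conjI allI impI)
  show "bounded_linear A" using has_fderiv_blin[OF assms] by (simp only: blin_euclid_iff)
  fix e :: real assume "e > 0"
  then have "\<exists>d>0. \<forall>y\<in>carr euclid. nrm euclid (y - x) < d \<longrightarrow>
      f y \<in> carr euclid \<and> nrm euclid (f y - f x - A (y - x)) \<le> e * nrm euclid (y - x)"
    using assms unfolding has_fderiv_def by meson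
  then show "\<exists>d>0. \<forall>y. norm (y - x) < d \<longrightarrow> norm (f y - f x - A (y - x)) \<le> e * norm (y - x)"
    by (simp add: euclid_def)
qed

section \<open>Continuity\<close>

lemma topspace_ntop: "nvs X \<Longrightarrow> topspace (ntop X) = carr X"
  unfolding ntop_def using Metric_space.topspace_mtopology nvs.Metric_space by blast

lemma continuous_map_into_ntop:
  assumes "nvs X" "f \<in> S \<rightarrow> carr X"
    and "\<And>x e. x \<in> S \<Longrightarrow> e > 0 \<Longrightarrow> \<exists>d>0. \<forall>y\<in>S. dist y x < d \<longrightarrow> nrm X (f y - f x) < e"
  shows "continuous_map (top_of_set S) (ntop X) f"
proof -
  interpret nvs X by fact
  interpret M: Metric_space "carr X" "\<lambda>x y. nrm X (x - y)" by (rule Metric_space)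
  show ?thesis unfolding ntop_def M.continuous_map_to_metric
  proof (intro ballI allI impI)
    fix x and e :: real assume x: "x \<in> topspace (top_of_set S)" and e: "0 < e"
    then obtain d where d: "d > 0" "\<forall>y\<in>S. dist y x < d \<longrightarrow> nrm X (f y - f x) < e"
      using assms(3)[of x e] by auto
    show "\<exists>U. openin (top_of_set S) U \<and> x \<in> U \<and> (\<forall>y\<in>U. f y \<in> M.mball (f x) e)"
      using x d assms(2)
      by (intro exI[of _ "S \<inter> ball x d"]) (auto simp: dist_commute nrm_diff_commute[of "f x"])
  qed
qed

lemma continuous_map_blin:
  fixes A :: "'a::real_vector \<Rightarrow> 'b::real_normed_vector"
  assumes "nvs X" "blin X euclid A"
  shows "continuous_map (ntop X) euclidean A"
proof -
  interpret nvs X by fact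
  interpret M: Metric_space "carr X" "\<lambda>x y. nrm X (x - y)" by (rule Metric_space)
  obtain K where K: "K > 0" "\<And>x. x \<in> carr X \<Longrightarrow> nrm euclid (A x) \<le> K * nrm X x"
    using blin_bound[OF assms(2,1)] by blast
  show ?thesis
    unfolding mtopology_is_euclidean[symmetric] Met_TC.continuous_map_to_metric
  proof (intro ballI allI impI)
    fix x and e :: real assume x: "x \<in> topspace (ntop X)" and e: "0 < e"
    have "dist (A x) (A y) < e" if y: "y \<in> M.mball x (e / K)" for y
    proof -
      have "dist (A x) (A y) = norm (A (x - y))"
        using y blin_diff[OF assms(2,1)] by (simp add: dist_norm)
      also have "\<dots> \<le> K * nrm X (x - y)"
        using K(2)[of "x - y"] y by (simp add: euclid_def carr_simps)
      also have "\<dots> < e" using y K(1) by (simp add: field_simps)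
      finally show ?thesis .
    qed
    then show "\<exists>U. openin (ntop X) U \<and> x \<in> U \<and> (\<forall>y\<in>U. A y \<in> Met_TC.mball (A x) e)"
      using x e K(1) M.openin_mball unfolding topspace_ntop[OF assms(1)] ntop_def
      by (intro exI[of _ "M.mball x (e / K)"]) (auto simp: nrm_0)
  qed
qed

lemma openin_ntopD:
  assumes "nvs X" "openin (ntop X) U" "x \<in> U"
  obtains r where "r > 0" "\<And>y. y \<in> carr X \<Longrightarrow> nrm X (y - x) < r \<Longrightarrow> y \<in> U"
proof -
  interpret nvs X by fact
  interpret M: Metric_space "carr X" "\<lambda>x y. nrm X (x - y)" by (rule Metric_space)
  obtain r where "r > 0" "M.mball x r \<subseteq> U" "U \<subseteq> carr X"
    using assms(2,3) unfolding ntop_def M.openin_mtopology by blast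
  moreover have "y \<in> M.mball x r" if "y \<in> carr X" "nrm X (y - x) < r" for y
    using that assms(3) \<open>U \<subseteq> carr X\<close> nrm_diff_commute[of x y] by auto
  ultimately show ?thesis using that by blast
qed

section \<open>Lyapunov--Schmidt reduction of an isomorphism\<close>

lemma blin_euclid_linear:
  fixes D :: "'e::euclidean_space \<Rightarrow> 'f::real_normed_vector"
  shows "blin euclid euclid D \<longleftrightarrow> linear D"
  by (auto simp: blin_euclid_iff linear_conv_bounded_linear)

text \<open>In finite dimension injectivity already gives a linear inverse, and linearity gives its
  boundedness.\<close>

lemma linear_GL_iff:
  fixes D :: "'e::euclidean_space \<Rightarrow> 'e"
  assumes "linear D" shows "D \<in> GL euclid euclid \<longleftrightarrow> (\<forall>p. D p = 0 \<longrightarrow> p = 0)"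
proof
  assume "D \<in> GL euclid euclid"
  then have "inj D" by (simp add: GL_def euclid_def bij_betw_def)
  then show "\<forall>p. D p = 0 \<longrightarrow> p = 0" using assms linear_injective_0 by blast
next
  assume "\<forall>p. D p = 0 \<longrightarrow> p = 0"
  then have "inj D" using assms linear_injective_0 by blast
  then obtain D' where "linear D'" "\<forall>x. D' (D x) = x" "\<forall>x. D (D' x) = x"
    using linear_injective_isomorphism[OF assms] by blast
  then show "D \<in> GL euclid euclid"
    unfolding GL_iff[OF nvs_euclid nvs_euclid] using assms by (auto simp: blin_euclid_linear)
qed

text \<open>Split \<open>X\<close> into the tangent vectors \<open>L p + S p\<close> and the kernel
  of \<open>\<pi>\<close>, and \<open>Y\<close> into the range of \<open>J\<close> and the kernel of
  \<open>c\<close>. By \<open>AD\<close> the operator sends tangent vectors into the range of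
  \<open>J\<close> through \<open>D\<close>, so it is block triangular with diagonal blocks
  \<open>D\<close> and the isomorphism in \<open>B\<close>.\<close>

lemma schur_GL_iff:
  fixes X :: "'a::real_vector nspace" and Y :: "'b::real_vector nspace"
    and D :: "'e::euclidean_space \<Rightarrow> 'e"
  assumes "nvs X" "nvs Y" and A: "blin X Y A"
    and L: "blin euclid X L" and \<pi>: "blin X euclid \<pi>" and \<pi>L: "\<And>p. \<pi> (L p) = p"
    and S: "blin euclid X S" and \<pi>S: "\<And>p. \<pi> (S p) = 0"
    and J: "blin euclid Y J" and c: "blin Y euclid c" and cJ: "\<And>p. c (J p) = p"
    and D: "linear D" and AD: "\<And>p. A (L p + S p) = J (D p)"
    and B: "(\<lambda>y. A y - J (c (A y))) \<in>
      GL (nsub X {u \<in> carr X. \<pi> u = 0}) (nsub Y {v \<in> carr Y. c v = 0})"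
  shows "D \<in> GL euclid euclid \<longleftrightarrow> A \<in> GL X Y"
proof -
  interpret X: nvs X by fact
  interpret Y: nvs Y by fact
  note E = nvs_euclid
  let ?Xp = "{u \<in> carr X. \<pi> u = 0}" and ?Yp = "{v \<in> carr Y. c v = 0}"
  have sX: "nvs (nsub X ?Xp)"
    by (rule X.nvs_nsub)
      (use \<pi> X.carr_simps blin_0[OF \<pi> \<open>nvs X\<close>] in \<open>auto simp: subspace_def blinD(2,3)\<close>)
  have sY: "nvs (nsub Y ?Yp)"
    by (rule Y.nvs_nsub)
      (use c Y.carr_simps blin_0[OF c \<open>nvs Y\<close>] in \<open>auto simp: subspace_def blinD(2,3)\<close>)
  have LX: "L p \<in> carr X" and SX: "S p \<in> carr X" and JY: "J p \<in> carr Y" for p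
    using L S J by (auto simp: blinD euclid_def)
  have \<pi>W: "\<pi> (L p + S p) = p" for p using \<pi> LX SX \<pi>L \<pi>S by (simp add: blinD(2))
  have J0: "J 0 = 0" using blin_0[OF J E] .
  have S0: "S 0 = 0" "L 0 = 0" using blin_0[OF S E] blin_0[OF L E] by auto
  show ?thesis
  proof
    assume "D \<in> GL euclid euclid"
    then obtain D' where D': "blin euclid euclid D'" "\<And>p. D (D' p) = p" "\<And>p. D' (D p) = p"
      unfolding GL_iff[OF E E] by (auto simp: euclid_def)
    obtain b where b: "blin (nsub Y ?Yp) (nsub X ?Xp) b"
      and bB: "\<And>y. y \<in> ?Xp \<Longrightarrow> b (A y - J (c (A y))) = y"
      and Bb: "\<And>v. v \<in> ?Yp \<Longrightarrow> A (b v) - J (c (A (b v))) = v"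
      using B unfolding GL_iff[OF sX sY] by (auto simp: nsub_def)
    have Jc: "blin Y Y (\<lambda>f. J (c f))" using blin_compose[OF c J \<open>nvs Y\<close> E] .
    have R: "blin Y Y (\<lambda>f. f - J (c f))"
      using blin_minus[OF _ Jc \<open>nvs Y\<close> \<open>nvs Y\<close>, of "\<lambda>f. f"] by (simp add: blin_def) (metis mult_1 order_refl)
    have cJc: "c (f - J (c f)) = 0" if "f \<in> carr Y" for f
      using blin_diff[OF c \<open>nvs Y\<close> that JY] cJ by simp
    have "blin Y (nsub Y ?Yp) (\<lambda>f. f - J (c f))"
      by (rule blin_into_nsub[OF R]) (use cJc blinD(1)[OF R] in auto)
    then have "blin Y (nsub X ?Xp) (\<lambda>f. b (f - J (c f)))"
      using blin_compose b \<open>nvs Y\<close> sY by blast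
    then have b': "blin Y X (\<lambda>f. b (f - J (c f)))" (is "blin Y X ?b")
      by (rule blin_compose[OF _ blin_id \<open>nvs Y\<close> sX]) (auto simp: \<open>nvs X\<close>)
    have W: "blin euclid X (\<lambda>p. L p + S p)" using blin_add[OF L S E \<open>nvs X\<close>] .
    have cA: "blin X euclid (\<lambda>u. c (A u))" using blin_compose[OF A c \<open>nvs X\<close> \<open>nvs Y\<close>] .
    \<comment> \<open>\<open>?b f\<close> solves the equation only in the kernel of
      \<open>c\<close>; \<open>?q f\<close> is the defect left in the range of \<open>J\<close>. The
      tangent vector with parameter \<open>D' (?q f)\<close> removes it and contributes nothing to
      the other component.\<close>
    have q: "blin Y euclid (\<lambda>f. c f - c (A (?b f)))" (is "blin Y euclid ?q")
      using blin_minus[OF c blin_compose[OF b' cA \<open>nvs Y\<close> \<open>nvs X\<close>] \<open>nvs Y\<close> E] .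
    have W': "blin Y X (\<lambda>f. L (D' (?q f)) + S (D' (?q f)))" (is "blin Y X ?w")
      using blin_compose[OF blin_compose[OF q D'(1) \<open>nvs Y\<close> E] W \<open>nvs Y\<close> E] .
    let ?g = "\<lambda>f. ?b f + ?w f"
    have g: "blin Y X ?g" using blin_add[OF b' W' \<open>nvs Y\<close> \<open>nvs X\<close>] .
    have Ag: "A (?g f) = f" if f: "f \<in> carr Y" for f
    proof -
      have "f - J (c f) \<in> ?Yp" using f cJc blinD(1)[OF R] by auto
      note B' = Bb[OF this]
      have "A (?g f) = A (?b f) + J (?q f)"
        unfolding blinD(2)[OF A blinD(1)[OF b' f] blinD(1)[OF W' f]] AD D'(2) ..
      also have "J (?q f) = J (c f) - J (c (A (?b f)))"
        by (rule blin_diff[OF J E]) (auto simp: euclid_def)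
      finally show ?thesis using B' by (simp add: algebra_simps)
    qed
    have inj: "u = 0" if u: "u \<in> carr X" "A u = 0" for u
    proof -
      define p where "p = \<pi> u"
      \<comment> \<open>Subtracting the whole tangent vector, not only \<open>L p\<close>, puts
        \<open>A y\<close> into the range of \<open>J\<close>, so the isomorphic block annihilates
        \<open>y\<close>.\<close>
      define y where "y = u - (L p + S p)"
      have Wp: "L p + S p \<in> carr X" using LX SX X.carr_simps by blast
      have y: "y \<in> ?Xp"
        using u Wp blin_diff[OF \<pi> \<open>nvs X\<close> u(1) Wp] \<pi>W by (simp add: y_def X.carr_simps p_def)
      have "A y = - J (D p)" using blin_diff[OF A \<open>nvs X\<close> u(1) Wp] u(2) AD by (simp add: y_def)
      also have "\<dots> = J (- D p)" using blin_diff[OF J E, of 0 "D p"] J0 by (simp add: euclid_def)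
      finally have Ay: "A y = J (- D p)" .
      have "b 0 = 0" using blin_0[OF b sY] .
      then have "y = 0" using bB[OF y] unfolding Ay cJ by simp
      then have up: "u = L p + S p" by (simp add: y_def)
      then have "J (D p) = 0" using u(2) AD by simp
      then have "D p = 0" using cJ[of "D p"] blin_0[OF c \<open>nvs Y\<close>] by simp
      then have "p = 0" using D'(3)[of p] blin_0[OF D'(1) E] by simp
      then show "u = 0" using up S0 by simp
    qed
    \<comment> \<open>A right inverse of an injective linear map is also a left inverse.\<close>
    have "?g (A u) = u" if u: "u \<in> carr X" for u
    proof -
      have Au: "A u \<in> carr Y" using A u by (simp add: blinD)
      then have gm: "?g (A u) \<in> carr X" using blinD(1)[OF g] by blast
      have "A (?g (A u) - u) = 0" using blin_diff[OF A \<open>nvs X\<close> gm u] Ag[OF Au] by simp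
      then have "?g (A u) - u = 0" using inj X.carr_simps(3)[OF gm u] by blast
      then show ?thesis by simp
    qed
    then show "A \<in> GL X Y" unfolding GL_iff[OF \<open>nvs X\<close> \<open>nvs Y\<close>] using A g Ag by blast
  next
    assume "A \<in> GL X Y"
    then have inj: "inj_on A (carr X)" by (simp add: GL_def bij_betw_def)
    show "D \<in> GL euclid euclid" unfolding linear_GL_iff[OF D]
    proof (intro allI impI)
      \<comment> \<open>A kernel vector of \<open>D\<close> gives a tangent vector in the kernel of
        \<open>A\<close>, and \<open>\<pi>\<close> reads \<open>p\<close> off that vector.\<close>
      fix p assume "D p = 0"
      then have "A (L p + S p) = A 0" using AD J0 blin_0[OF A \<open>nvs X\<close>] by simp
      then have "L p + S p = 0" using inj_onD[OF inj] LX SX X.carr_simps by blast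
      then show "p = 0" using \<pi>W[of p] blin_0[OF \<pi> \<open>nvs X\<close>] by simp
    qed
  qed
qed

section \<open>Representatives of classes of measurable functions\<close>

lemma rep_mfun_measurable [measurable]: "rep_mfun f \<in> borel_measurable borel"
  using Quotient_rep_reflp[OF Quotient_mfun, of f] by (simp add: ae_rel_def)

lemma mfun_eq_iff: "f = g \<longleftrightarrow> (AE t in lborel. rep_mfun f t = rep_mfun g t)"
  using Quotient_rel_rep[OF Quotient_mfun, of f g] by (auto simp: ae_rel_def)

lemma AE_rep_abs:
  assumes "f \<in> borel_measurable borel" shows "AE t in lborel. rep_mfun (abs_mfun f) t = f t"
  using Quotient_rep_abs[OF Quotient_mfun, of f] assms by (auto simp: ae_rel_def)

lemma
  shows AE_rep_0: "AE t in lborel. rep_mfun 0 t = 0"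
    and AE_rep_add: "AE t in lborel. rep_mfun (f + g) t = rep_mfun f t + rep_mfun g t"
    and AE_rep_minus: "AE t in lborel. rep_mfun (- f) t = - rep_mfun f t"
    and AE_rep_mult: "AE t in lborel. rep_mfun (f * g) t = rep_mfun f t * rep_mfun g t"
    and AE_rep_scaleR: "AE t in lborel. rep_mfun (c *\<^sub>R f) t = c * rep_mfun f t"
  by (simp_all add: zero_mfun_def plus_mfun_def uminus_mfun_def times_mfun_def
      scaleR_mfun_def map_fun_def AE_rep_abs)

lemma supp_inD: "supp_in T f \<Longrightarrow> AE t in lborel. t \<notin> {0..T} \<longrightarrow> rep_mfun f t = 0"
  by (simp add: supp_in_def)

lemma supp_in_closed:
  shows "supp_in T 0"
    and "supp_in T f \<Longrightarrow> supp_in T g \<Longrightarrow> supp_in T (f + g)"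
    and "supp_in T f \<Longrightarrow> supp_in T (c *\<^sub>R f)"
    and "supp_in T g \<Longrightarrow> supp_in T (f * g)"
proof -
  show "supp_in T 0" using AE_rep_0 by (auto simp: supp_in_def)
  show "supp_in T (f + g)" if "supp_in T f" "supp_in T g"
    unfolding supp_in_def using supp_inD[OF that(1)] supp_inD[OF that(2)] AE_rep_add[of f g]
    by eventually_elim auto
  show "supp_in T (c *\<^sub>R f)" if "supp_in T f"
    unfolding supp_in_def using supp_inD[OF that] AE_rep_scaleR[of c f] by eventually_elim auto
  show "supp_in T (f * g)" if "supp_in T g"
    unfolding supp_in_def using supp_inD[OF that] AE_rep_mult[of f g] by eventually_elim auto
qed

section \<open>Square integrable classes\<close>

text \<open>Classes are extended by zero, so integrals over the interval can be traded for integrals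
  over the line, which the general integration rules handle directly.\<close>

lemma set_integrable_supp_iff:
  fixes h :: "real \<Rightarrow> real"
  assumes ae: "AE t in lborel. t \<notin> {0..T} \<longrightarrow> h t = 0" and [measurable]: "h \<in> borel_measurable borel"
  shows "set_integrable lborel {0..T} h \<longleftrightarrow> integrable lborel h"
  unfolding set_integrable_def
proof (rule integrable_cong_AE)
  show "AE t in lborel. indicat_real {0..T} t *\<^sub>R h t = h t"
    using ae by eventually_elim (auto simp: indicator_def)
qed measurable

lemma set_lebesgue_integral_supp:
  fixes h :: "real \<Rightarrow> real"
  assumes ae: "AE t in lborel. t \<notin> {0..T} \<longrightarrow> h t = 0" and [measurable]: "h \<in> borel_measurable borel"
  shows "(LINT t:{0..T}|lborel. h t) = (LINT t|lborel. h t)"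
  unfolding set_lebesgue_integral_def
proof (rule integral_cong_AE)
  show "AE t in lborel. indicat_real {0..T} t *\<^sub>R h t = h t"
    using ae by eventually_elim (auto simp: indicator_def)
qed measurable

lemma L2_iff: "f \<in> L2 T \<longleftrightarrow> supp_in T f \<and> integrable lborel (\<lambda>t. (rep_mfun f t)\<^sup>2)"
proof -
  have "supp_in T f \<Longrightarrow>
      set_integrable lborel {0..T} (\<lambda>t. (rep_mfun f t)\<^sup>2) \<longleftrightarrow> integrable lborel (\<lambda>t. (rep_mfun f t)\<^sup>2)"
    by (rule set_integrable_supp_iff) (auto simp: supp_in_def)
  then show ?thesis by (auto simp: L2_def)
qed

lemma L1_iff: "f \<in> L1 T \<longleftrightarrow> supp_in T f \<and> integrable lborel (rep_mfun f)"
proof -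
  have "supp_in T f \<Longrightarrow> set_integrable lborel {0..T} (rep_mfun f) \<longleftrightarrow> integrable lborel (rep_mfun f)"
    by (rule set_integrable_supp_iff) (auto simp: supp_in_def)
  then show ?thesis by (auto simp: L1_def)
qed

lemma ip2_eq: "supp_in T f \<Longrightarrow> ip2 T f g = (LINT t|lborel. rep_mfun f t * rep_mfun g t)"
  unfolding ip2_def by (rule set_lebesgue_integral_supp) (auto simp: supp_in_def)

lemma L2_supp: "f \<in> L2 T \<Longrightarrow> supp_in T f" by (simp add: L2_iff)

lemma L2_mult_integrable:
  assumes "f \<in> L2 T" "g \<in> L2 T" shows "integrable lborel (\<lambda>t. rep_mfun f t * rep_mfun g t)"
proof (rule Bochner_Integration.integrable_bound)
  show "integrable lborel (\<lambda>t. (rep_mfun f t)\<^sup>2 + (rep_mfun g t)\<^sup>2)"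
    using assms by (simp add: L2_iff)
  have "\<bar>x * y\<bar> \<le> x\<^sup>2 + y\<^sup>2" for x y :: real
  proof -
    have "2 * \<bar>x\<bar> * \<bar>y\<bar> \<le> x\<^sup>2 + y\<^sup>2"
      using sum_squares_bound[of "\<bar>x\<bar>" "\<bar>y\<bar>"] by simp
    moreover have "0 \<le> \<bar>x\<bar> * \<bar>y\<bar>" by simp
    ultimately show ?thesis unfolding abs_mult by linarith
  qed
  then show "AE t in lborel. norm (rep_mfun f t * rep_mfun g t)
      \<le> norm ((rep_mfun f t)\<^sup>2 + (rep_mfun g t)\<^sup>2)" by auto
qed simp

lemma subspace_L2: "subspace (L2 T)"
  unfolding subspace_def
proof (intro conjI ballI allI)
  have "integrable lborel (\<lambda>t. (rep_mfun 0 t)\<^sup>2) \<longleftrightarrow> integrable lborel (\<lambda>t::real. 0 :: real)"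
    by (rule integrable_cong_AE) (use AE_rep_0 in auto)
  then show "0 \<in> L2 T" by (simp add: L2_iff supp_in_closed)
next
  fix f g assume fg: "f \<in> L2 T" "g \<in> L2 T"
  have "integrable lborel (\<lambda>t. (rep_mfun (f + g) t)\<^sup>2) \<longleftrightarrow>
      integrable lborel (\<lambda>t. (rep_mfun f t)\<^sup>2 + 2 * (rep_mfun f t * rep_mfun g t) + (rep_mfun g t)\<^sup>2)"
  proof (rule integrable_cong_AE)
    show "AE t in lborel. (rep_mfun (f + g) t)\<^sup>2
        = (rep_mfun f t)\<^sup>2 + 2 * (rep_mfun f t * rep_mfun g t) + (rep_mfun g t)\<^sup>2"
      using AE_rep_add[of f g] by eventually_elim (simp add: power2_sum)
  qed auto
  then show "f + g \<in> L2 T" using fg L2_mult_integrable[OF fg] by (simp add: L2_iff supp_in_closed)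
next
  fix c f assume f: "f \<in> L2 T"
  have "integrable lborel (\<lambda>t. (rep_mfun (c *\<^sub>R f) t)\<^sup>2) \<longleftrightarrow>
      integrable lborel (\<lambda>t. c\<^sup>2 * (rep_mfun f t)\<^sup>2)"
  proof (rule integrable_cong_AE)
    show "AE t in lborel. (rep_mfun (c *\<^sub>R f) t)\<^sup>2 = c\<^sup>2 * (rep_mfun f t)\<^sup>2"
      using AE_rep_scaleR[of c f] by eventually_elim (simp add: power_mult_distrib)
  qed auto
  then show "c *\<^sub>R f \<in> L2 T" using f by (simp add: L2_iff supp_in_closed)
qed

lemma ip2_commute: "ip2 T f g = ip2 T g f"
  by (simp add: ip2_def mult.commute)

lemma ip2_nonneg: "0 \<le> ip2 T f f"
  unfolding ip2_def set_lebesgue_integral_def by (rule Bochner_Integration.integral_nonneg) simp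

text \<open>No membership in \<open>L2 T\<close> is asked for, because \<open>nvs\<close> wants the
  norm to be symmetric on the whole type.\<close>

lemma ip2_minus_minus: "ip2 T (- f) (- f) = ip2 T f f"
  unfolding ip2_def set_lebesgue_integral_def
proof (rule integral_cong_AE)
  show "AE t in lborel. indicat_real {0..T} t *\<^sub>R (rep_mfun (- f) t * rep_mfun (- f) t)
      = indicat_real {0..T} t *\<^sub>R (rep_mfun f t * rep_mfun f t)"
    using AE_rep_minus[of f] by eventually_elim simp
qed auto

lemma ip2_add_left:
  assumes "f \<in> L2 T" "g \<in> L2 T" "h \<in> L2 T"
  shows "ip2 T (f + g) h = ip2 T f h + ip2 T g h"
proof -
  have "ip2 T (f + g) h = (LINT t|lborel. rep_mfun f t * rep_mfun h t + rep_mfun g t * rep_mfun h t)"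
    using assms(1,2)[THEN L2_supp] unfolding ip2_eq[OF supp_in_closed(2)[OF assms(1,2)[THEN L2_supp]]]
    by (intro integral_cong_AE; measurable?) (use AE_rep_add[of f g] in \<open>eventually_elim; simp add: algebra_simps\<close>)
  then show ?thesis
    using assms(1,2)[THEN L2_supp] L2_mult_integrable assms by (simp add: ip2_eq)
qed

lemma ip2_scaleR_left:
  assumes "f \<in> L2 T" shows "ip2 T (c *\<^sub>R f) h = c * ip2 T f h"
proof -
  have "ip2 T (c *\<^sub>R f) h = (LINT t|lborel. c * (rep_mfun f t * rep_mfun h t))"
    unfolding ip2_eq[OF supp_in_closed(3)[OF L2_supp[OF assms]]]
    by (intro integral_cong_AE; measurable?) (use AE_rep_scaleR[of c f] in \<open>eventually_elim; simp\<close>)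
  then show ?thesis using L2_supp[OF assms] by (simp add: ip2_eq)
qed

lemma ip2_eq_0_iff:
  assumes "f \<in> L2 T" shows "ip2 T f f = 0 \<longleftrightarrow> f = 0"
proof -
  have "ip2 T f f = (LINT t|lborel. (rep_mfun f t)\<^sup>2)"
    using L2_supp[OF assms] by (simp add: ip2_eq power2_eq_square)
  also have "\<dots> = 0 \<longleftrightarrow> (AE t in lborel. (rep_mfun f t)\<^sup>2 = 0)"
    by (rule integral_nonneg_eq_0_iff_AE) (use assms in \<open>auto simp: L2_iff\<close>)
  also have "\<dots> \<longleftrightarrow> f = 0"
    unfolding mfun_eq_iff[of f 0]
  proof
    assume "AE t in lborel. (rep_mfun f t)\<^sup>2 = 0"
    then show "AE t in lborel. rep_mfun f t = rep_mfun 0 t" using AE_rep_0 by eventually_elim simp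
  next
    assume "AE t in lborel. rep_mfun f t = rep_mfun 0 t"
    then show "AE t in lborel. (rep_mfun f t)\<^sup>2 = 0" using AE_rep_0 by eventually_elim simp
  qed
  finally show ?thesis .
qed

section \<open>Symmetric positive bilinear forms on a subspace\<close>

text \<open>A common frame for \<open>ip2\<close> and \<open>ipH\<close>. Positivity is required of
  all elements since the resulting norm must be nonnegative on the whole type.\<close>

locale pre_inner =
  fixes S :: "'a::real_vector set" and B :: "'a \<Rightarrow> 'a \<Rightarrow> real"
  assumes subspace_S: "subspace S"
    and commute: "\<And>x y. B x y = B y x"
    and add_left: "\<And>x y z. x \<in> S \<Longrightarrow> y \<in> S \<Longrightarrow> z \<in> S \<Longrightarrow> B (x + y) z = B x z + B y z"
    and scaleR_left: "\<And>c x z. x \<in> S \<Longrightarrow> z \<in> S \<Longrightarrow> B (c *\<^sub>R x) z = c * B x z"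
    and nonneg: "\<And>x. 0 \<le> B x x"
begin

lemma add_right: "x \<in> S \<Longrightarrow> y \<in> S \<Longrightarrow> z \<in> S \<Longrightarrow> B z (x + y) = B z x + B z y"
  using add_left commute by metis

lemma scaleR_right: "x \<in> S \<Longrightarrow> z \<in> S \<Longrightarrow> B z (c *\<^sub>R x) = c * B z x"
  using scaleR_left commute by metis

lemma B_add_self: "x \<in> S \<Longrightarrow> y \<in> S \<Longrightarrow> B (x + y) (x + y) = B x x + 2 * B x y + B y y"
  using subspace_add[OF subspace_S] by (simp add: add_left add_right commute[of y x])

lemma cauchy_schwarz:
  assumes "x \<in> S" "y \<in> S" shows "\<bar>B x y\<bar> \<le> sqrt (B x x) * sqrt (B y y)"
proof -
  have q: "0 \<le> B x x + 2 * (c * B x y) + c * (c * B y y)" for c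
    using nonneg[of "x + c *\<^sub>R y"] assms subspace_scale[OF subspace_S assms(2), of c]
    by (simp add: B_add_self scaleR_left scaleR_right)
  have "(B x y)\<^sup>2 \<le> B x x * B y y"
  proof (cases "B y y = 0")
    case True
    have "B x y = 0"
    proof (rule ccontr)
      assume "B x y \<noteq> 0"
      \<comment> \<open>With \<open>B y y = 0\<close> the expression is affine in \<open>c\<close>;
        at this \<open>c\<close> its value would be -1.\<close>
      then show False using q[of "- (B x x + 1) / (2 * B x y)"] True by (simp add: field_simps)
    qed
    then show ?thesis using True by simp
  next
    case False
    then have y: "B y y > 0" using nonneg[of y] by simp
    \<comment> \<open>The minimiser of the quadratic polynomial in \<open>c\<close>.\<close>
    have "0 \<le> B x x - (B x y)\<^sup>2 / B y y"
      using q[of "- B x y / B y y"] False by (simp add: power2_eq_square)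
    then show ?thesis using y by (simp add: field_simps)
  qed
  then have "sqrt ((B x y)\<^sup>2) \<le> sqrt (B x x * B y y)" by (rule real_sqrt_le_mono)
  then show ?thesis by (simp add: real_sqrt_mult)
qed

lemma triangle:
  assumes "x \<in> S" "y \<in> S" shows "sqrt (B (x + y) (x + y)) \<le> sqrt (B x x) + sqrt (B y y)"
proof (rule real_le_lsqrt)
  have "B (x + y) (x + y) \<le> B x x + 2 * (sqrt (B x x) * sqrt (B y y)) + B y y"
    using cauchy_schwarz[OF assms] B_add_self[OF assms] by linarith
  then show "B (x + y) (x + y) \<le> (sqrt (B x x) + sqrt (B y y))\<^sup>2"
    by (simp add: power2_sum nonneg)
qed (simp add: nonneg)

lemma nvs:
  assumes "\<And>x. x \<in> S \<Longrightarrow> B x x = 0 \<longleftrightarrow> x = 0" "\<And>x. B (- x) (- x) = B x x"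
  shows "nvs \<lparr>carr = S, nrm = (\<lambda>x. sqrt (B x x))\<rparr>"
proof
  show "nrm \<lparr>carr = S, nrm = (\<lambda>x. sqrt (B x x))\<rparr> (c *\<^sub>R x)
      = \<bar>c\<bar> * nrm \<lparr>carr = S, nrm = (\<lambda>x. sqrt (B x x))\<rparr> x"
    if "x \<in> carr \<lparr>carr = S, nrm = (\<lambda>x. sqrt (B x x))\<rparr>" for c x
    using that subspace_scale[OF subspace_S, of x c]
    by (simp add: scaleR_left scaleR_right real_sqrt_mult flip: mult.assoc)
qed (use assms subspace_S triangle in \<open>auto simp: nonneg\<close>)

end

lemma pre_inner_ip2: "pre_inner (L2 T) (ip2 T)"
  by unfold_locales
    (rule subspace_L2 ip2_commute ip2_nonneg | simp only: ip2_add_left ip2_scaleR_left)+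

section \<open>Classes of functions on the interval\<close>

lemma mcls_measurable:
  fixes f :: "real \<Rightarrow> real"
  assumes "continuous_on {0..T} f"
  shows "(\<lambda>t. indicat_real {0..T} t * f t) \<in> borel_measurable borel"
  using borel_measurable_continuous_on_indicator[OF _ assms] by simp

lemma AE_rep_mcls:
  assumes "continuous_on {0..T} f"
  shows "AE t in lborel. rep_mfun (mcls T f) t = indicat_real {0..T} t * f t"
  unfolding mcls_def by (rule AE_rep_abs) (rule mcls_measurable[OF assms])

lemma mcls_cong: "(\<And>t. t \<in> {0..T} \<Longrightarrow> f t = g t) \<Longrightarrow> mcls T f = mcls T g"
  unfolding mcls_def by (rule arg_cong[where f = abs_mfun]) (auto simp: indicator_def)

lemma supp_in_mcls: assumes "continuous_on {0..T} f" shows "supp_in T (mcls T f)"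
  unfolding supp_in_def using AE_rep_mcls[OF assms] by eventually_elim simp

lemma mcls_add:
  assumes "continuous_on {0..T} f" "continuous_on {0..T} g"
  shows "mcls T (\<lambda>t. f t + g t) = mcls T f + mcls T g"
  unfolding mfun_eq_iff
  using AE_rep_mcls[OF continuous_on_add[OF assms]] AE_rep_mcls[OF assms(1)] AE_rep_mcls[OF assms(2)]
    AE_rep_add[of "mcls T f" "mcls T g"]
  by eventually_elim (simp add: algebra_simps)

lemma mcls_scaleR:
  assumes "continuous_on {0..T} f"
  shows "mcls T (\<lambda>t. c * f t) = c *\<^sub>R mcls T f"
  unfolding mfun_eq_iff
  using AE_rep_mcls[OF continuous_on_mult_left[OF assms, of c]] AE_rep_mcls[OF assms]
    AE_rep_scaleR[of c "mcls T f"]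
  by eventually_elim simp

lemma mcls_L2:
  assumes "continuous_on {0..T} f" shows "mcls T f \<in> L2 T"
proof -
  have "set_integrable lborel {0..T} (\<lambda>t. (f t)\<^sup>2)"
    by (rule borel_integrable_atLeastAtMost') (intro continuous_intros assms)
  then have "integrable lborel (\<lambda>t. indicat_real {0..T} t * (f t)\<^sup>2)"
    by (simp add: set_integrable_def)
  moreover have "integrable lborel (\<lambda>t. (rep_mfun (mcls T f) t)\<^sup>2) \<longleftrightarrow>
    integrable lborel (\<lambda>t. (indicat_real {0..T} t * f t)\<^sup>2)"
    using mcls_measurable[OF assms]
    by (intro integrable_cong_AE; measurable?) (use AE_rep_mcls[OF assms] in \<open>eventually_elim; simp\<close>)
  moreover have "(indicat_real {0..T} t * f t)\<^sup>2 = indicat_real {0..T} t * (f t)\<^sup>2" for t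
    by (simp add: indicator_def)
  ultimately show ?thesis using supp_in_mcls[OF assms] by (simp add: L2_iff)
qed

lemma ip2_mcls:
  assumes "continuous_on {0..T} f" "continuous_on {0..T} g"
  shows "ip2 T (mcls T f) (mcls T g) = integral {0..T} (\<lambda>t. f t * g t)"
proof -
  have "ip2 T (mcls T f) (mcls T g) = (LINT t:{0..T}|lborel. f t * g t)"
    unfolding ip2_def set_lebesgue_integral_def
  proof (rule integral_cong_AE)
    show "(\<lambda>t. indicat_real {0..T} t *\<^sub>R (f t * g t)) \<in> borel_measurable lborel"
      using mcls_measurable[OF continuous_on_mult[OF assms]] by simp
    show "AE t in lborel. indicat_real {0..T} t *\<^sub>R (rep_mfun (mcls T f) t * rep_mfun (mcls T g) t)
        = indicat_real {0..T} t *\<^sub>R (f t * g t)"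
      using AE_rep_mcls[OF assms(1)] AE_rep_mcls[OF assms(2)]
      by eventually_elim (simp add: indicator_def)
  qed simp
  also have "\<dots> = integral {0..T} (\<lambda>t. f t * g t)"
    by (intro set_borel_integral_eq_integral borel_integrable_atLeastAtMost' continuous_intros assms)
  finally show ?thesis .
qed

text \<open>The agreement set is closed and contains almost every point of the open interval, hence
  all of it; its closure supplies the end points.\<close>

lemma continuous_AE_eq:
  fixes f g :: "real \<Rightarrow> real"
  assumes "T > 0" "continuous_on {0..T} f" "continuous_on {0..T} g"
    and "AE t in lborel. t \<in> {0..T} \<longrightarrow> f t = g t" and "t \<in> {0..T}"
  shows "f t = g t"
proof -
  let ?C = "{t \<in> {0..T}. f t - g t = 0}"
  have "?C = {0..T} \<inter> (\<lambda>t. f t - g t) -` {0}" by auto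
  moreover have "closed ({0..T} \<inter> (\<lambda>t. f t - g t) -` {0})"
    by (rule continuous_closed_preimage) (intro continuous_intros assms | simp)+
  ultimately have cl: "closed ?C" by simp
  have ae: "AE t\<in>{0<..<T} in lebesgue. t \<in> ?C"
    by (rule AE_completion) (use assms(4) in \<open>eventually_elim; auto\<close>)
  have "{0<..<T} \<subseteq> ?C"
  proof
    fix s assume "s \<in> {0<..<T}"
    then show "s \<in> ?C" by (rule mem_closed_if_AE_lebesgue_open[OF open_greaterThanLessThan cl ae])
  qed
  then have "closure {0<..<T} \<subseteq> ?C" using cl by (rule closure_minimal)
  then show ?thesis using assms(1,5) by auto
qed

lemma mcls_eq_imp:
  assumes "T > 0" "continuous_on {0..T} f" "continuous_on {0..T} g" "mcls T f = mcls T g" "t \<in> {0..T}"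
  shows "f t = g t"
proof (rule continuous_AE_eq[OF assms(1-3) _ assms(5)])
  have "AE t in lborel. rep_mfun (mcls T f) t = rep_mfun (mcls T g) t" using assms(4) by simp
  then show "AE t in lborel. t \<in> {0..T} \<longrightarrow> f t = g t"
    using AE_rep_mcls[OF assms(2)] AE_rep_mcls[OF assms(3)] by eventually_elim auto
qed

text \<open>Continuous representatives agree on the interval, so the choice made by
  \<open>SOME\<close> is harmless.\<close>

lemma pt_mcls:
  assumes "T > 0" "continuous_on {0..T} f" "t \<in> {0..T}" shows "pt T (mcls T f) t = f t"
proof -
  let ?P = "\<lambda>g. continuous_on {0..T} g \<and> mcls T f = mcls T g"
  have "?P (SOME g. ?P g)" by (rule someI[of ?P f]) (simp add: assms)
  then have "f t = (SOME g. ?P g) t" using mcls_eq_imp[OF assms(1,2) _ _ assms(3)] by blast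
  then show ?thesis by (simp add: pt_def)
qed

section \<open>Weak derivatives\<close>

definition prim :: "mfun \<Rightarrow> real \<Rightarrow> real" where
  "prim v t = (LINT s:{0..t}|lborel. rep_mfun v s)"

lemma L1_set_integrable: "v \<in> L1 T \<Longrightarrow> S \<in> sets borel \<Longrightarrow> set_integrable lborel S (rep_mfun v)"
  unfolding set_integrable_def by (rule integrable_mult_indicator) (auto simp: L1_iff)

lemma prim_continuous: assumes "v \<in> L1 T" shows "continuous_on {0..T} (prim v)"
proof -
  have "prim v t = integral {0..t} (rep_mfun v)" for t
    unfolding prim_def by (rule set_borel_integral_eq_integral(2)[OF L1_set_integrable[OF assms]]) simp
  then have "prim v = (\<lambda>t. integral {0..t} (rep_mfun v))" by auto
  moreover have "rep_mfun v integrable_on {0..T}"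
    by (rule set_borel_integral_eq_integral(1)[OF L1_set_integrable[OF assms]]) simp
  ultimately show ?thesis using indefinite_integral_continuous_1 by metis
qed

lemma prim_0: "prim v 0 = 0"
proof -
  have "(LINT s:{0..0}|lborel. rep_mfun v s) = (LINT s::real|lborel. 0)"
    unfolding set_lebesgue_integral_def
    by (intro integral_cong_AE; measurable?) (use AE_lborel_singleton[of 0] in \<open>eventually_elim; simp\<close>)
  then show ?thesis by (simp add: prim_def)
qed

section \<open>Linearity and injectivity of the primitive\<close>

lemma subspace_L1: "subspace (L1 T)"
  unfolding subspace_def
proof (intro conjI ballI allI)
  have "integrable lborel (rep_mfun 0) \<longleftrightarrow> integrable lborel (\<lambda>t::real. 0 :: real)"
    by (rule integrable_cong_AE) (use AE_rep_0 in auto)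
  then show "0 \<in> L1 T" by (simp add: L1_iff supp_in_closed)
next
  fix f g assume fg: "f \<in> L1 T" "g \<in> L1 T"
  have "integrable lborel (rep_mfun (f + g)) \<longleftrightarrow> integrable lborel (\<lambda>t. rep_mfun f t + rep_mfun g t)"
    by (rule integrable_cong_AE) (use AE_rep_add[of f g] in auto)
  then show "f + g \<in> L1 T" using fg by (simp add: L1_iff supp_in_closed)
next
  fix c f assume f: "f \<in> L1 T"
  have "integrable lborel (rep_mfun (c *\<^sub>R f)) \<longleftrightarrow> integrable lborel (\<lambda>t. c * rep_mfun f t)"
    by (rule integrable_cong_AE) (use AE_rep_scaleR[of c f] in auto)
  then show "c *\<^sub>R f \<in> L1 T" using f by (simp add: L1_iff supp_in_closed)
qed

lemma prim_add:
  assumes "v \<in> L1 T" "w \<in> L1 T" shows "prim (v + w) t = prim v t + prim w t"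
proof -
  have "prim (v + w) t = (LINT s:{0..t}|lborel. rep_mfun v s + rep_mfun w s)"
    unfolding prim_def set_lebesgue_integral_def
    by (intro integral_cong_AE; measurable?) (use AE_rep_add[of v w] in \<open>eventually_elim; simp\<close>)
  also have "\<dots> = prim v t + prim w t"
    unfolding prim_def by (intro set_integral_add L1_set_integrable[of _ T] assms) auto
  finally show ?thesis .
qed

lemma prim_scaleR: "prim (c *\<^sub>R v) t = c * prim v t"
proof -
  have "prim (c *\<^sub>R v) t = (LINT s:{0..t}|lborel. c * rep_mfun v s)"
    unfolding prim_def set_lebesgue_integral_def
    by (intro integral_cong_AE; measurable?) (use AE_rep_scaleR[of c v] in \<open>eventually_elim; simp\<close>)
  then show ?thesis by (simp add: prim_def)
qed

text \<open>Half-lines are an intersection-stable generator of the Borel sets, so vanishing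
  integrals spread by Dynkin induction to every Borel set, and a density with this property is zero
  almost everywhere.\<close>

lemma prim_eq_0_imp:
  assumes v: "v \<in> L1 T" and z: "\<And>t. t \<in> {0..T} \<Longrightarrow> prim v t = 0"
  shows "v = 0"
proof -
  let ?h = "rep_mfun v"
  have int: "integrable lborel ?h" and s: "AE t in lborel. t \<notin> {0..T} \<longrightarrow> ?h t = 0"
    using v by (auto simp: L1_iff supp_in_def)
  have si: "set_integrable lborel A ?h" if "A \<in> sets borel" for A
    using L1_set_integrable[OF v that] .
  \<comment> \<open>The representative vanishes almost everywhere outside the interval, so an end
    point beyond \<open>T\<close> may be cut back to \<open>T\<close>; in the remaining case the
    integrand is zero almost everywhere.\<close>
  have atMost: "(LINT s:{..t}|lborel. ?h s) = 0" for t
  proof (cases "t \<ge> 0 \<and> T \<ge> 0")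
    case True
    have "(LINT s:{..t}|lborel. ?h s) = prim v (min t T)"
      unfolding set_lebesgue_integral_def prim_def
      by (intro integral_cong_AE; measurable?) (use s in \<open>eventually_elim; auto simp: indicator_def\<close>)
    then show ?thesis using z[of "min t T"] True by simp
  next
    case False
    then have "(LINT s:{..t}|lborel. ?h s) = (LINT s::real|lborel. 0)"
      unfolding set_lebesgue_integral_def
      by (intro integral_cong_AE; measurable?) (use s in \<open>eventually_elim; auto simp: indicator_def\<close>)
    then show ?thesis by simp
  qed
  \<comment> \<open>The total mass is needed for complements in the induction below.\<close>
  have tot: "(LINT s|lborel. ?h s) = 0"
  proof (cases "T \<ge> 0")
    case True
    have "(LINT s|lborel. ?h s) = (LINT s:{..T}|lborel. ?h s)"
      unfolding set_lebesgue_integral_def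
      by (intro integral_cong_AE; measurable?) (use s in \<open>eventually_elim; auto simp: indicator_def\<close>)
    then show ?thesis using atMost by simp
  next
    case False
    then have "(LINT s|lborel. ?h s) = (LINT s:{..0}|lborel. ?h s)"
      unfolding set_lebesgue_integral_def
      by (intro integral_cong_AE; measurable?) (use s in \<open>eventually_elim; auto simp: indicator_def\<close>)
    then show ?thesis using atMost by simp
  qed
  have "(LINT s:A|lborel. ?h s) = 0" if "A \<in> sets lborel" for A
  proof -
    let ?G = "range (\<lambda>a::real. {..a})"
    have "Int_stable ?G" by (auto simp: Int_stable_def)
    moreover have "?G \<subseteq> Pow UNIV" by simp
    moreover have "A \<in> sigma_sets UNIV ?G"
      using that unfolding sets_lborel borel_eq_atMost by simp
    ultimately show ?thesis
    proof (induction rule: sigma_sets_induct_disjoint)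
      case (compl A)
      then have A: "A \<in> sets borel" unfolding borel_eq_atMost by simp
      have "(LINT s:UNIV|lborel. ?h s) = (LINT s:A|lborel. ?h s) + (LINT s:UNIV - A|lborel. ?h s)"
        using set_integral_Un[of A "UNIV - A" lborel ?h] si A by simp
      then show ?case using compl tot by (simp add: set_lebesgue_integral_def)
    next
      case (union A)
      then have A: "A i \<in> sets borel" for i unfolding borel_eq_atMost by auto
      have "(LINT s:(\<Union>i. A i)|lborel. ?h s) = (\<Sum>i. LINT s:A i|lborel. ?h s)"
        using union(1) A si by (intro lebesgue_integral_countable_add) (auto simp: disjoint_family_on_def)
      then show ?case using union by simp
    qed (use atMost in \<open>auto simp: set_lebesgue_integral_def\<close>)
  qed
  then have "AE t in lborel. ?h t = 0"
    by (intro density_unique_real int) (auto simp: set_lebesgue_integral_def)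
  then show ?thesis unfolding mfun_eq_iff using AE_rep_0 by eventually_elim simp
qed

lemma has_weak_deriv_alt:
  "has_weak_deriv T u v \<longleftrightarrow> v \<in> L1 T \<and> (\<exists>c. u = mcls T (\<lambda>t. c + prim v t))"
  by (simp add: has_weak_deriv_def prim_def)

lemma has_weak_deriv_unique:
  assumes T: "T > 0" and "has_weak_deriv T u v" "has_weak_deriv T u w" shows "v = w"
proof -
  obtain c where v: "v \<in> L1 T" "u = mcls T (\<lambda>t. c + prim v t)"
    using assms(2) by (auto simp: has_weak_deriv_alt)
  obtain d where w: "w \<in> L1 T" "u = mcls T (\<lambda>t. d + prim w t)"
    using assms(3) by (auto simp: has_weak_deriv_alt)
  have eq: "c + prim v t = d + prim w t" if "t \<in> {0..T}" for t
    by (rule mcls_eq_imp[OF T _ _ _ that])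
      (use v w in \<open>auto intro!: continuous_intros prim_continuous\<close>)
  \<comment> \<open>Both primitives vanish at 0, so evaluation there isolates the constants.\<close>
  then have "c = d" using eq[of 0] T by (simp add: prim_0)
  have w': "- 1 *\<^sub>R w \<in> L1 T" by (rule subspace_scale[OF subspace_L1 w(1)])
  have "prim (v + (-1) *\<^sub>R w) t = 0" if "t \<in> {0..T}" for t
    unfolding prim_add[OF v(1) w'] prim_scaleR using eq[OF that] \<open>c = d\<close> by simp
  then have "v + (-1) *\<^sub>R w = 0"
    using prim_eq_0_imp subspace_add[OF subspace_L1 v(1) w'] by blast
  then show ?thesis by simp
qed

lemma wderiv_eq: "T > 0 \<Longrightarrow> has_weak_deriv T u v \<Longrightarrow> wderiv T u = v"
  unfolding wderiv_def by (rule the_equality) (auto dest: has_weak_deriv_unique)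

section \<open>Linearity of weak derivatives and of point values\<close>

lemma has_weak_deriv_add:
  assumes "has_weak_deriv T u v" "has_weak_deriv T u' v'" shows "has_weak_deriv T (u + u') (v + v')"
proof -
  obtain c d where v: "v \<in> L1 T" "u = mcls T (\<lambda>t. c + prim v t)"
    and w: "v' \<in> L1 T" "u' = mcls T (\<lambda>t. d + prim v' t)"
    using assms unfolding has_weak_deriv_alt by blast
  have "u + u' = mcls T (\<lambda>t. (c + prim v t) + (d + prim v' t))"
    unfolding v(2) w(2) by (rule mcls_add[symmetric]) (intro continuous_intros prim_continuous v w)+
  also have "\<dots> = mcls T (\<lambda>t. (c + d) + prim (v + v') t)"
    by (rule mcls_cong) (simp add: prim_add[OF v(1) w(1)])
  finally show ?thesis unfolding has_weak_deriv_alt using subspace_add[OF subspace_L1 v(1) w(1)] by blast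
qed

lemma has_weak_deriv_scaleR:
  assumes "has_weak_deriv T u v" shows "has_weak_deriv T (r *\<^sub>R u) (r *\<^sub>R v)"
proof -
  obtain c where v: "v \<in> L1 T" "u = mcls T (\<lambda>t. c + prim v t)"
    using assms by (auto simp: has_weak_deriv_alt)
  have "r *\<^sub>R u = mcls T (\<lambda>t. r * (c + prim v t))"
    unfolding v(2) by (rule mcls_scaleR[symmetric]) (intro continuous_intros prim_continuous v)
  also have "\<dots> = mcls T (\<lambda>t. r * c + prim (r *\<^sub>R v) t)"
    by (rule mcls_cong) (simp add: prim_scaleR distrib_left)
  finally show ?thesis unfolding has_weak_deriv_alt using subspace_scale[OF subspace_L1 v(1)] by blast
qed

lemma has_weak_deriv_continuous:
  assumes "has_weak_deriv T u v" obtains f where "continuous_on {0..T} f" "u = mcls T f"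
proof -
  obtain c where v: "v \<in> L1 T" "u = mcls T (\<lambda>t. c + prim v t)"
    using assms by (auto simp: has_weak_deriv_alt)
  have "continuous_on {0..T} (\<lambda>t. c + prim v t)" by (intro continuous_intros prim_continuous v)
  then show ?thesis using that v(2) by blast
qed

lemma pt_add:
  assumes "T > 0" "has_weak_deriv T u v" "has_weak_deriv T u' v'" "t \<in> {0..T}"
  shows "pt T (u + u') t = pt T u t + pt T u' t"
proof -
  obtain f where f: "continuous_on {0..T} f" "u = mcls T f" using has_weak_deriv_continuous assms(2) .
  obtain g where g: "continuous_on {0..T} g" "u' = mcls T g" using has_weak_deriv_continuous assms(3) .
  show ?thesis
    unfolding f(2) g(2) mcls_add[OF f(1) g(1), symmetric]
    using assms(1,4) f(1) g(1) by (simp add: pt_mcls continuous_on_add)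
qed

lemma pt_scaleR:
  assumes "T > 0" "has_weak_deriv T u v" "t \<in> {0..T}" shows "pt T (c *\<^sub>R u) t = c * pt T u t"
proof -
  obtain f where f: "continuous_on {0..T} f" "u = mcls T f" using has_weak_deriv_continuous assms(2) .
  show ?thesis
    unfolding f(2) mcls_scaleR[OF f(1), symmetric]
    using assms(1,3) f(1) by (simp add: pt_mcls continuous_on_mult_left)
qed

text \<open>The fundamental theorem of calculus. Differentiability on the whole line avoids
  one-sided derivatives at the end points.\<close>

lemma has_weak_deriv_mcls:
  assumes f: "\<And>t. (f has_real_derivative f' t) (at t)" and c: "continuous_on UNIV f'"
  shows "has_weak_deriv T (mcls T f) (mcls T f')"
proof -
  have cf: "continuous_on A f'" for A using c continuous_on_subset by blast
  have "mcls T f' \<in> L1 T"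
  proof -
    have "integrable lborel (\<lambda>t. indicat_real {0..T} t * f' t)"
      using borel_integrable_atLeastAtMost'[OF cf] by (simp add: set_integrable_def)
    moreover have "integrable lborel (rep_mfun (mcls T f')) \<longleftrightarrow>
        integrable lborel (\<lambda>t. indicat_real {0..T} t * f' t)"
      by (rule integrable_cong_AE) (use AE_rep_mcls[OF cf] mcls_measurable[OF cf] in auto)
    ultimately show ?thesis using supp_in_mcls[OF cf] by (simp add: L1_iff)
  qed
  moreover have "mcls T f = mcls T (\<lambda>t. f 0 + prim (mcls T f') t)"
  proof (rule mcls_cong)
    fix t assume t: "t \<in> {0..T}"
    have "prim (mcls T f') t = (LINT s:{0..t}|lborel. f' s)"
      unfolding prim_def set_lebesgue_integral_def
    proof (rule integral_cong_AE)
      show "(\<lambda>s. indicat_real {0..t} s *\<^sub>R f' s) \<in> borel_measurable lborel"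
        using mcls_measurable[OF cf] by simp
      show "AE s in lborel. indicat_real {0..t} s *\<^sub>R rep_mfun (mcls T f') s
          = indicat_real {0..t} s *\<^sub>R f' s"
        using AE_rep_mcls[OF cf, of T] by eventually_elim (use t in \<open>auto simp: indicator_def\<close>)
    qed simp
    also have "\<dots> = f t - f 0"
      unfolding set_lebesgue_integral_def
      by (rule integral_FTC_Icc)
        (use t cf in \<open>auto intro: has_vector_derivative_at_within f[unfolded has_real_derivative_iff_has_vector_derivative]\<close>)
    finally show "f t = f 0 + prim (mcls T f') t" by simp
  qed
  ultimately show ?thesis unfolding has_weak_deriv_alt by blast
qed

section \<open>Periodic Sobolev spaces\<close>

lemma Hper_weak_deriv:
  "u \<in> Hper s T \<Longrightarrow> \<alpha> < s \<Longrightarrow> has_weak_deriv T ((wderiv T ^^ \<alpha>) u) ((wderiv T ^^ Suc \<alpha>) u)"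
  by (simp add: Hper_def)

lemma Hper_L2: "u \<in> Hper s T \<Longrightarrow> \<alpha> \<le> s \<Longrightarrow> (wderiv T ^^ \<alpha>) u \<in> L2 T"
  by (simp add: Hper_def)

lemma wderiv_pow_add:
  assumes "T > 0" "u \<in> Hper s T" "v \<in> Hper s T" "\<alpha> \<le> s"
  shows "(wderiv T ^^ \<alpha>) (u + v) = (wderiv T ^^ \<alpha>) u + (wderiv T ^^ \<alpha>) v"
  using assms(4)
proof (induction \<alpha>)
  case (Suc \<alpha>)
  then have "\<alpha> < s" by simp
  from wderiv_eq[OF assms(1) has_weak_deriv_add[OF Hper_weak_deriv Hper_weak_deriv, OF assms(2) this assms(3) this]]
  show ?case using Suc by simp
qed simp

lemma wderiv_pow_scaleR:
  assumes "T > 0" "u \<in> Hper s T" "\<alpha> \<le> s"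
  shows "(wderiv T ^^ \<alpha>) (c *\<^sub>R u) = c *\<^sub>R (wderiv T ^^ \<alpha>) u"
  using assms(3)
proof (induction \<alpha>)
  case (Suc \<alpha>)
  then have "\<alpha> < s" by simp
  from wderiv_eq[OF assms(1) has_weak_deriv_scaleR[OF Hper_weak_deriv[OF assms(2) this]]]
  show ?case using Suc by simp
qed simp

text \<open>For elements without a weak derivative, \<^const>\<open>wderiv\<close> is the same junk value for \<open>u\<close> and \<open>- u\<close>.\<close>

lemma wderiv_pow_minus:
  assumes "T > 0"
  shows "(wderiv T ^^ \<alpha>) (- u) = (wderiv T ^^ \<alpha>) u \<or> (wderiv T ^^ \<alpha>) (- u) = - (wderiv T ^^ \<alpha>) u"
proof (induction \<alpha>)
  case (Suc \<alpha>)
  have m: "has_weak_deriv T (- u) (- v)" if "has_weak_deriv T u v" for u v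
    using has_weak_deriv_scaleR[OF that, of "-1"] by simp
  have "wderiv T (- w) = wderiv T w \<or> wderiv T (- w) = - wderiv T w" for w
  proof (cases "\<exists>v. has_weak_deriv T w v")
    case True
    then obtain v where "has_weak_deriv T w v" ..
    then show ?thesis using wderiv_eq[OF assms] m by metis
  next
    case False
    then have "\<not> has_weak_deriv T (- w) v" for v using m[of "- w" v] by auto
    then have "has_weak_deriv T (- w) = has_weak_deriv T w" using False by auto
    then show ?thesis by (simp add: wderiv_def)
  qed
  from this[of "(wderiv T ^^ \<alpha>) u"] show ?case using Suc by auto
qed simp

lemma subspace_Hper:
  assumes T: "T > 0" shows "subspace (Hper s T)"
  unfolding subspace_def
proof (intro conjI ballI allI)
  have w0: "has_weak_deriv T 0 0"
    using has_weak_deriv_mcls[of "\<lambda>_. 0" "\<lambda>_. 0" T] mcls_scaleR[of T "\<lambda>_. 0" 0] by simp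
  have p: "(wderiv T ^^ \<alpha>) 0 = 0" for \<alpha>
    by (induction \<alpha>) (use wderiv_eq[OF T w0] in auto)
  have "pt T 0 t = 0" if "t \<in> {0..T}" for t using pt_scaleR[OF T w0 that, of 0] by simp
  then show "0 \<in> Hper s T"
    using w0 T subspace_0[OF subspace_L2] p[of "Suc _"] by (auto simp: Hper_def p)
next
  fix u v assume u: "u \<in> Hper s T" and v: "v \<in> Hper s T"
  note add = wderiv_pow_add[OF T u v]
  have p: "pt T ((wderiv T ^^ \<alpha>) u + (wderiv T ^^ \<alpha>) v) t =
      pt T ((wderiv T ^^ \<alpha>) u) t + pt T ((wderiv T ^^ \<alpha>) v) t" if "\<alpha> < s" "t \<in> {0..T}" for \<alpha> t
    using pt_add[OF T Hper_weak_deriv[OF u that(1)] Hper_weak_deriv[OF v that(1)] that(2)] .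
  show "u + v \<in> Hper s T"
    unfolding Hper_def mem_Collect_eq
  proof (intro conjI allI impI)
    fix \<alpha> assume "\<alpha> \<le> s"
    then show "(wderiv T ^^ \<alpha>) (u + v) \<in> L2 T"
      unfolding add[OF \<open>\<alpha> \<le> s\<close>] using Hper_L2[OF u] Hper_L2[OF v] subspace_add[OF subspace_L2] by blast
  next
    fix \<alpha> assume a: "\<alpha> < s"
    show "has_weak_deriv T ((wderiv T ^^ \<alpha>) (u + v)) ((wderiv T ^^ Suc \<alpha>) (u + v))"
      unfolding add[OF less_imp_le[OF a]] add[OF Suc_leI[OF a]]
      by (rule has_weak_deriv_add Hper_weak_deriv u v a)+
    show "pt T ((wderiv T ^^ \<alpha>) (u + v)) 0 = pt T ((wderiv T ^^ \<alpha>) (u + v)) T"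
      unfolding add[OF less_imp_le[OF a]] using p[OF a] u v a T by (simp add: Hper_def)
  qed
next
  fix c u assume u: "u \<in> Hper s T"
  note scaleR = wderiv_pow_scaleR[OF T u]
  show "c *\<^sub>R u \<in> Hper s T"
    unfolding Hper_def mem_Collect_eq
  proof (intro conjI allI impI)
    fix \<alpha> assume "\<alpha> \<le> s"
    then show "(wderiv T ^^ \<alpha>) (c *\<^sub>R u) \<in> L2 T"
      unfolding scaleR[OF \<open>\<alpha> \<le> s\<close>] using Hper_L2[OF u] subspace_scale[OF subspace_L2] by blast
  next
    fix \<alpha> assume a: "\<alpha> < s"
    show "has_weak_deriv T ((wderiv T ^^ \<alpha>) (c *\<^sub>R u)) ((wderiv T ^^ Suc \<alpha>) (c *\<^sub>R u))"
      unfolding scaleR[OF less_imp_le[OF a]] scaleR[OF Suc_leI[OF a]]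
      by (rule has_weak_deriv_scaleR Hper_weak_deriv u a)+
    show "pt T ((wderiv T ^^ \<alpha>) (c *\<^sub>R u)) 0 = pt T ((wderiv T ^^ \<alpha>) (c *\<^sub>R u)) T"
      unfolding scaleR[OF less_imp_le[OF a]]
      using pt_scaleR[OF T Hper_weak_deriv[OF u a]] u a T by (simp add: Hper_def)
  qed
qed

text \<open>Either alternative of \<open>wderiv_pow_minus\<close> leaves each summand unchanged, so
  the identity also covers elements without weak derivatives.\<close>

lemma ipH_minus_minus:
  assumes "T > 0" shows "ipH s T (- u) (- u) = ipH s T u u"
  unfolding ipH_def
proof (rule sum.cong)
  fix \<alpha>
  show "ip2 T ((wderiv T ^^ \<alpha>) (- u)) ((wderiv T ^^ \<alpha>) (- u)) =
      ip2 T ((wderiv T ^^ \<alpha>) u) ((wderiv T ^^ \<alpha>) u)"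
    using wderiv_pow_minus[OF assms, of \<alpha> u] ip2_minus_minus[of T "(wderiv T ^^ \<alpha>) u"] by auto
qed simp

lemma pre_inner_ipH:
  assumes T: "T > 0" shows "pre_inner (Hper s T) (ipH s T)"
proof
  show "ipH s T u v = ipH s T v u" for u v by (simp add: ipH_def ip2_commute)
  show "0 \<le> ipH s T u u" for u unfolding ipH_def by (intro sum_nonneg ip2_nonneg)
  show "ipH s T (u + v) w = ipH s T u w + ipH s T v w"
    if "u \<in> Hper s T" "v \<in> Hper s T" "w \<in> Hper s T" for u v w
    unfolding ipH_def sum.distrib[symmetric]
    by (intro sum.cong) (use that in \<open>simp_all add: wderiv_pow_add[OF T] ip2_add_left Hper_L2\<close>)
  show "ipH s T (c *\<^sub>R u) w = c * ipH s T u w" if "u \<in> Hper s T" for c u w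
    unfolding ipH_def sum_distrib_left
    by (intro sum.cong) (use that in \<open>simp_all add: wderiv_pow_scaleR[OF T] ip2_scaleR_left Hper_L2\<close>)
qed (rule subspace_Hper[OF T])

lemma ip2_wderiv_le: "\<alpha> \<le> s \<Longrightarrow> ip2 T ((wderiv T ^^ \<alpha>) u) ((wderiv T ^^ \<alpha>) u) \<le> ipH s T u u"
  unfolding ipH_def
  by (rule member_le_sum[where f = "\<lambda>\<alpha>. ip2 T ((wderiv T ^^ \<alpha>) u) ((wderiv T ^^ \<alpha>) u)"])
    (auto simp: ip2_nonneg)

text \<open>Definiteness comes from the summand of order zero, the squared \<open>L2\<close>
  norm.\<close>

lemma nvs_Hsp:
  assumes T: "T > 0" shows "nvs (Hsp s T)"
  unfolding Hsp_def
proof (rule pre_inner.nvs[OF pre_inner_ipH[OF T]])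
  show "ipH s T (- u) (- u) = ipH s T u u" for u by (rule ipH_minus_minus[OF T])
  fix u assume u: "u \<in> Hper s T"
  have "u = 0" if "ipH s T u u = 0"
    using ip2_wderiv_le[of 0 s T u] ip2_nonneg[of T u] ip2_eq_0_iff[of u T] Hper_L2[OF u, of 0] that by simp
  moreover have "ipH s T 0 0 = 0"
    using pre_inner.scaleR_left[OF pre_inner_ipH[OF T] u, of 0 0 ] subspace_0[OF subspace_Hper[OF T]]
      pre_inner.scaleR_left[OF pre_inner_ipH[OF T], of 0 s 0 0]
    by simp
  ultimately show "ipH s T u u = 0 \<longleftrightarrow> u = 0" by auto
qed

lemma Hper_0: "Hper 0 T = L2 T" by (auto simp: Hper_def)

lemma Hsp_simps:
  "carr (Hsp s T) = Hper s T" "nrm (Hsp s T) u = sqrt (ipH s T u u)" "ipH 0 T u v = ip2 T u v"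
  by (simp_all add: Hsp_def ipH_def)

text \<open>The case \<alpha> = 0 is the embedding into the square integrable classes and is used as
  such.\<close>

lemma blin_wderiv_pow:
  assumes "T > 0" "\<alpha> \<le> s" shows "blin (Hsp s T) (Hsp 0 T) (wderiv T ^^ \<alpha>)"
  by (rule blinI[where K = 1])
    (use assms ip2_wderiv_le[OF assms(2)] in
      \<open>simp_all add: Hsp_simps Hper_0 Hper_L2 wderiv_pow_add wderiv_pow_scaleR\<close>)

section \<open>The supremum norm\<close>

text \<open>The Sobolev embedding in dimension one. In \<open>u = c + prim v\<close> the primitive
  and the constant each cost \<open>sqrt T\<close> times the norm of \<open>v\<close>, whence the
  factor 2; the norm of \<open>u\<close> enters through the constant alone.\<close>

lemma AE_bound_sobolev:
  assumes T: "T > 0" and uv: "has_weak_deriv T u v" and u: "u \<in> L2 T" and v: "v \<in> L2 T"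
  shows "AE t in lborel. \<bar>rep_mfun u t\<bar> \<le> sqrt (ip2 T u u) / sqrt T + 2 * sqrt T * sqrt (ip2 T v v)"
proof -
  obtain c where v1: "v \<in> L1 T" and uc: "u = mcls T (\<lambda>t. c + prim v t)"
    using uv by (auto simp: has_weak_deriv_alt)
  let ?n = "sqrt (ip2 T v v)"
  have prim: "\<bar>prim v t\<bar> \<le> sqrt T * ?n" if t: "t \<in> {0..T}" for t
  proof -
    \<comment> \<open>Pairing \<open>v\<close> with the indicator class of \<open>{0..t}\<close>
      turns the primitive into an inner product, and Cauchy-Schwarz yields the factor
      \<open>sqrt t\<close>.\<close>
    define w where "w = abs_mfun (indicat_real {0..t})"
    have w: "AE s in lborel. rep_mfun w s = indicat_real {0..t} s"
      unfolding w_def by (rule AE_rep_abs) simp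
    have sw: "supp_in T w" unfolding supp_in_def using w
      by eventually_elim (use t in \<open>auto simp: indicator_def\<close>)
    have "integrable lborel (\<lambda>s. (rep_mfun w s)\<^sup>2) \<longleftrightarrow> integrable lborel (indicat_real {0..t})"
      by (intro integrable_cong_AE; measurable?) (use w in \<open>eventually_elim; simp add: indicator_def\<close>)
    moreover have "integrable lborel (indicat_real {0..t})" by (rule integrable_real_indicator) (use t in auto)
    ultimately have wL: "w \<in> L2 T" using sw by (simp add: L2_iff)
    have "ip2 T w w = (LINT s|lborel. indicat_real {0..t} s)"
      unfolding ip2_eq[OF sw]
      by (intro integral_cong_AE; measurable?) (use w in \<open>eventually_elim; simp add: indicator_def\<close>)
    then have ww: "ip2 T w w = t" using t by simp
    have "ip2 T w v = prim v t"
      unfolding ip2_eq[OF sw] prim_def set_lebesgue_integral_def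
      by (intro integral_cong_AE; measurable?) (use w in \<open>eventually_elim; simp\<close>)
    then have "\<bar>prim v t\<bar> \<le> sqrt t * ?n"
      using pre_inner.cauchy_schwarz[OF pre_inner_ip2 wL v] by (simp add: ww)
    also have "\<dots> \<le> sqrt T * ?n" using t by (intro mult_right_mono) (auto simp: ip2_nonneg)
    finally show ?thesis .
  qed
  note cp = prim_continuous[OF v1]
  have cc: "continuous_on {0..T} (\<lambda>t. c)" by simp
  \<comment> \<open>The constant function is \<open>u + p\<close>. Its norm is
    \<open>sqrt T * \<bar>c\<bar>\<close>, so the triangle inequality bounds
    \<open>c\<close>.\<close>
  define p where "p = mcls T (\<lambda>t. (-1) * prim v t)"
  have cmp: "continuous_on {0..T} (\<lambda>t. (-1) * prim v t)" by (intro continuous_intros cp)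
  have p: "p \<in> L2 T" unfolding p_def by (rule mcls_L2[OF cmp])
  have "ip2 T p p = integral {0..T} (\<lambda>t. (prim v t)\<^sup>2)"
    unfolding p_def ip2_mcls[OF cmp cmp] by (simp add: power2_eq_square)
  also have "\<dots> \<le> integral {0..T} (\<lambda>t. (sqrt T * ?n)\<^sup>2)"
  proof (rule integral_le)
    show "(\<lambda>t. (prim v t)\<^sup>2) integrable_on {0..T}"
      by (intro integrable_continuous_real continuous_intros cp)
    show "(prim v t)\<^sup>2 \<le> (sqrt T * ?n)\<^sup>2" if "t \<in> {0..T}" for t
      using power_mono[OF prim[OF that], of 2] by simp
  qed (rule integrable_const_ivl)
  also have "\<dots> = (T * ?n)\<^sup>2" using T by (simp add: power_mult_distrib power2_eq_square)
  finally have "sqrt (ip2 T p p) \<le> T * ?n"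
    using T by (intro real_le_lsqrt) (auto simp: ip2_nonneg)
  moreover have "mcls T (\<lambda>t. c) = u + p"
    unfolding uc p_def by (subst mcls_add[symmetric]) (use cmp cp in \<open>auto intro!: continuous_intros\<close>)
  moreover have "ip2 T (mcls T (\<lambda>t. c)) (mcls T (\<lambda>t. c)) = T * c\<^sup>2"
    unfolding ip2_mcls[OF cc cc] using T by (simp add: power2_eq_square)
  ultimately have "sqrt T * \<bar>c\<bar> \<le> sqrt (ip2 T u u) + T * ?n"
    using pre_inner.triangle[OF pre_inner_ip2 u p] by (simp add: real_sqrt_mult)
  then have "\<bar>c\<bar> \<le> (sqrt (ip2 T u u) + T * ?n) / sqrt T" using T by (simp add: field_simps)
  also have "\<dots> = sqrt (ip2 T u u) / sqrt T + (T / sqrt T) * ?n" by (simp add: add_divide_distrib)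
  also have "T / sqrt T = sqrt T" using T real_div_sqrt by simp
  finally have c: "\<bar>c\<bar> \<le> sqrt (ip2 T u u) / sqrt T + sqrt T * ?n" .
  have b: "\<bar>indicat_real {0..T} t * (c + prim v t)\<bar> \<le> sqrt (ip2 T u u) / sqrt T + 2 * sqrt T * ?n" for t
  proof (cases "t \<in> {0..T}")
    case True
    then show ?thesis using c prim[OF True] by simp
  next
    case False
    then show ?thesis using T ip2_nonneg[of T] by simp
  qed
  have "continuous_on {0..T} (\<lambda>t. c + prim v t)" by (intro continuous_intros cp)
  from AE_rep_mcls[OF this] show ?thesis unfolding uc[symmetric]
    by eventually_elim (simp only: b)
qed

text \<open>Any nonnegative essential bound, in place of the essential supremum: such bounds simply
  add and multiply.\<close>

definition AE_bound :: "real \<Rightarrow> mfun \<Rightarrow> bool" where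
  "AE_bound C f \<longleftrightarrow> 0 \<le> C \<and> (AE t in lborel. \<bar>rep_mfun f t\<bar> \<le> C)"

lemma AE_bound_add:
  assumes "AE_bound C f" "AE_bound D g" shows "AE_bound (C + D) (f + g)"
proof -
  have f: "AE t in lborel. \<bar>rep_mfun f t\<bar> \<le> C" and g: "AE t in lborel. \<bar>rep_mfun g t\<bar> \<le> D"
    using assms by (auto simp: AE_bound_def)
  have "AE t in lborel. \<bar>rep_mfun (f + g) t\<bar> \<le> C + D"
    using f g AE_rep_add[of f g] by eventually_elim linarith
  then show ?thesis using assms by (simp add: AE_bound_def)
qed

lemma AE_bound_mult:
  assumes "AE_bound C f" "AE_bound D g" shows "AE_bound (C * D) (f * g)"
proof -
  have f: "AE t in lborel. \<bar>rep_mfun f t\<bar> \<le> C" and g: "AE t in lborel. \<bar>rep_mfun g t\<bar> \<le> D"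
    and "0 \<le> C" "0 \<le> D"
    using assms by (auto simp: AE_bound_def)
  have "AE t in lborel. \<bar>rep_mfun (f * g) t\<bar> \<le> C * D"
    using f g AE_rep_mult[of f g]
  proof eventually_elim
    case (elim t)
    then show ?case using \<open>0 \<le> C\<close> by (simp add: abs_mult mult_mono)
  qed
  then show ?thesis using \<open>0 \<le> C\<close> \<open>0 \<le> D\<close> by (simp add: AE_bound_def)
qed

text \<open>Holder's inequality for a bounded and a square integrable factor. In the cubic term all
  factors but one are treated as bounded.\<close>

lemma
  assumes f: "AE_bound C f" and g: "g \<in> L2 T"
  shows L2_bounded_mult: "f * g \<in> L2 T"
    and ip2_bounded_mult: "sqrt (ip2 T (f * g) (f * g)) \<le> C * sqrt (ip2 T g g)"
proof -
  have C: "0 \<le> C" using f by (simp add: AE_bound_def)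
  have s: "supp_in T (f * g)" using supp_in_closed(4)[OF L2_supp[OF g]] .
  have ae: "AE t in lborel. (rep_mfun (f * g) t)\<^sup>2 \<le> C\<^sup>2 * (rep_mfun g t)\<^sup>2"
  proof -
    have "AE t in lborel. \<bar>rep_mfun f t\<bar> \<le> C" using f by (simp add: AE_bound_def)
    then show ?thesis using AE_rep_mult[of f g]
    proof eventually_elim
      case (elim t)
      have "(rep_mfun f t)\<^sup>2 \<le> C\<^sup>2" using power_mono[OF elim(1), of 2] by simp
      then show ?case by (simp add: elim(2) power_mult_distrib mult_right_mono)
    qed
  qed
  have ig: "integrable lborel (\<lambda>t. C\<^sup>2 * (rep_mfun g t)\<^sup>2)" using g by (simp add: L2_iff)
  have i: "integrable lborel (\<lambda>t. (rep_mfun (f * g) t)\<^sup>2)"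
    by (rule Bochner_Integration.integrable_bound[OF ig])
      (simp, use ae in \<open>eventually_elim; simp\<close>)
  then show fg: "f * g \<in> L2 T" using s by (simp add: L2_iff)
  have "ip2 T (f * g) (f * g) \<le> C\<^sup>2 * ip2 T g g"
    using integral_mono_AE[OF i ig ae] s L2_supp[OF g] by (simp add: ip2_eq power2_eq_square)
  then have "sqrt (ip2 T (f * g) (f * g)) \<le> sqrt (C\<^sup>2 * ip2 T g g)" by (rule real_sqrt_le_mono)
  then show "sqrt (ip2 T (f * g) (f * g)) \<le> C * sqrt (ip2 T g g)"
    using C by (simp add: real_sqrt_mult)
qed

lemma AE_bound_Hper:
  assumes T: "T > 0"
  obtains K where "K > 0" "\<And>u. u \<in> Hper 2 T \<Longrightarrow> AE_bound (K * nrm (Hsp 2 T) u) u"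
proof -
  let ?K = "1 / sqrt T + 2 * sqrt T"
  have "AE_bound (?K * nrm (Hsp 2 T) u) u" if u: "u \<in> Hper 2 T" for u
  proof -
    have uv: "has_weak_deriv T u (wderiv T u)" and m: "u \<in> L2 T" "wderiv T u \<in> L2 T"
      using Hper_weak_deriv[OF u, of 0] Hper_L2[OF u, of 0] Hper_L2[OF u, of 1] by simp_all
    have n: "sqrt (ip2 T u u) \<le> nrm (Hsp 2 T) u" "sqrt (ip2 T (wderiv T u) (wderiv T u)) \<le> nrm (Hsp 2 T) u"
      using ip2_wderiv_le[of 0 2 T u] ip2_wderiv_le[of 1 2 T u] by (simp_all add: Hsp_simps)
    have le: "sqrt (ip2 T u u) / sqrt T + 2 * sqrt T * sqrt (ip2 T (wderiv T u) (wderiv T u))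
        \<le> ?K * nrm (Hsp 2 T) u"
    proof -
      have "sqrt (ip2 T u u) / sqrt T \<le> nrm (Hsp 2 T) u / sqrt T"
        using n(1) T by (intro divide_right_mono) auto
      moreover have "2 * sqrt T * sqrt (ip2 T (wderiv T u) (wderiv T u)) \<le> 2 * sqrt T * nrm (Hsp 2 T) u"
        using n(2) T by (intro mult_left_mono) auto
      ultimately show ?thesis by (simp add: distrib_right)
    qed
    have "AE t in lborel. \<bar>rep_mfun u t\<bar> \<le> ?K * nrm (Hsp 2 T) u"
      using AE_bound_sobolev[OF T uv m] by eventually_elim (use le in linarith)
    then show ?thesis using T nvs.nrm_nonneg[OF nvs_Hsp[OF T], of 2 u] by (simp add: AE_bound_def)
  qed
  moreover have "?K > 0" using T by (simp add: add_pos_pos)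
  ultimately show ?thesis using that by blast
qed

lemma AE_bound_Linf: assumes "a \<in> Linf T" obtains C where "AE_bound C a"
proof -
  obtain C where s: "AE t in lborel. t \<notin> {0..T} \<longrightarrow> rep_mfun a t = 0"
    and C: "AE t in lborel. t \<in> {0..T} \<longrightarrow> \<bar>rep_mfun a t\<bar> \<le> C"
    using assms by (auto simp: Linf_def supp_in_def)
  have "AE t in lborel. \<bar>rep_mfun a t\<bar> \<le> \<bar>C\<bar>" using s C by eventually_elim fastforce
  then show ?thesis using that[of "\<bar>C\<bar>"] by (simp add: AE_bound_def)
qed

section \<open>The derivative of the nonlinear operator\<close>

text \<open>\<open>u * (u + u + u)\<close> is three times the square of \<open>u\<close>, written
  with the two operations that have rules for \<open>AE_bound\<close>.\<close>

definition dFF :: "real \<Rightarrow> mfun \<Rightarrow> real \<Rightarrow> mfun \<Rightarrow> mfun \<Rightarrow> mfun" where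
  "dFF T a lam u h = (wderiv T ^^ 2) h + lam *\<^sub>R h + (a * u * (u + u + u)) * h"

lemma blin_bounded_mult:
  assumes "T > 0" "AE_bound C f" shows "blin (Hsp 2 T) (Hsp 0 T) (\<lambda>h. f * h)"
proof (rule blinI[where K = C])
  fix h assume h: "h \<in> carr (Hsp 2 T)"
  then have hL: "h \<in> L2 T" using Hper_L2[of h 2 T 0] by (simp add: Hsp_simps)
  then show "f * h \<in> carr (Hsp 0 T)"
    using L2_bounded_mult[OF assms(2)] by (simp add: Hsp_simps Hper_0)
  have "sqrt (ip2 T (f * h) (f * h)) \<le> C * sqrt (ip2 T h h)" by (rule ip2_bounded_mult[OF assms(2) hL])
  also have "\<dots> \<le> C * sqrt (ipH 2 T h h)"
    using ip2_wderiv_le[of 0 2 T h] assms(2) by (intro mult_left_mono) (auto simp: AE_bound_def)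
  finally show "nrm (Hsp 0 T) (f * h) \<le> C * nrm (Hsp 2 T) h" by (simp add: Hsp_simps)
qed (simp_all add: distrib_left)

lemma blin_dFF:
  assumes T: "T > 0" and a: "a \<in> Linf T" and u: "u \<in> Hper 2 T"
  shows "blin (Hsp 2 T) (Hsp 0 T) (dFF T a lam u)"
proof -
  obtain K where K: "K > 0" "\<And>u. u \<in> Hper 2 T \<Longrightarrow> AE_bound (K * nrm (Hsp 2 T) u) u"
    using AE_bound_Hper[OF T] by blast
  obtain C where C: "AE_bound C a" using AE_bound_Linf[OF a] .
  note N = nvs_Hsp[OF T]
  have i: "blin (Hsp 2 T) (Hsp 0 T) (\<lambda>h. h)" using blin_wderiv_pow[OF T, of 0 2] by (simp add: id_def)
  have b: "blin (Hsp 2 T) (Hsp 0 T) (\<lambda>h. (a * u * (u + u + u)) * h)"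
    by (rule blin_bounded_mult[OF T]) (rule AE_bound_mult AE_bound_add C K(2)[OF u])+
  have "blin (Hsp 2 T) (Hsp 0 T) (\<lambda>h. (wderiv T ^^ 2) h + lam *\<^sub>R h + (a * u * (u + u + u)) * h)"
    by (rule blin_add[OF blin_add[OF blin_wderiv_pow[OF T order_refl] blin_scaleR[OF i N N] N N] b N N])
  then show ?thesis by (simp add: dFF_def[abs_def])
qed

lemma FF_in_L2:
  assumes T: "T > 0" and a: "a \<in> Linf T" and u: "u \<in> Hper 2 T"
  shows "FF T a lam u \<in> Hper 0 T"
proof -
  obtain K where K: "K > 0" "\<And>u. u \<in> Hper 2 T \<Longrightarrow> AE_bound (K * nrm (Hsp 2 T) u) u"
    using AE_bound_Hper[OF T] by blast
  obtain C where C: "AE_bound C a" using AE_bound_Linf[OF a] .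
  have uL: "u \<in> L2 T" "(wderiv T ^^ 2) u \<in> L2 T"
    using Hper_L2[OF u, of 0] Hper_L2[OF u, of 2] by auto
  have "(a * u * u) * u \<in> L2 T"
    by (rule L2_bounded_mult[OF _ uL(1)]) (rule AE_bound_mult C K(2)[OF u])+
  moreover have "a * u ^ 3 = (a * u * u) * u" by (simp add: power3_eq_cube mult.assoc)
  ultimately show ?thesis
    unfolding FF_def Hper_0 using uL subspace_L2 by (simp add: subspace_add subspace_scale)
qed

text \<open>The expansion of a cube is exact, so the remainder is explicit. One factor
  \<open>h\<close> is kept apart to be measured in \<open>L2\<close>; the other belongs to the
  bounded factor.\<close>

lemma FF_taylor:
  assumes T: "T > 0" and u: "u \<in> Hper 2 T" and h: "h \<in> Hper 2 T"
  shows "FF T a lam (u + h) - FF T a lam u - dFF T a lam u h = (a * (u + u + u + h) * h) * h"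
  unfolding FF_def dFF_def wderiv_pow_add[OF T u h order_refl]
  by (simp add: power3_eq_cube algebra_simps)

lemma has_fderiv_FF:
  assumes T: "T > 0" and a: "a \<in> Linf T" and u: "u \<in> Hper 2 T"
  shows "has_fderiv (Hsp 2 T) (Hsp 0 T) (FF T a lam) (dFF T a lam u) u"
  unfolding has_fderiv_def
proof (intro conjI allI impI)
  show "blin (Hsp 2 T) (Hsp 0 T) (dFF T a lam u)" by (rule blin_dFF[OF assms])
  obtain K where K: "K > 0" "\<And>u. u \<in> Hper 2 T \<Longrightarrow> AE_bound (K * nrm (Hsp 2 T) u) u"
    using AE_bound_Hper[OF T] by blast
  obtain C where C: "AE_bound C a" using AE_bound_Linf[OF a] .
  interpret nvs "Hsp 2 T" by (rule nvs_Hsp[OF T])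
  let ?n = "nrm (Hsp 2 T)"
  have C0: "0 \<le> C" using C by (simp add: AE_bound_def)
  \<comment> \<open>What is left of the bound \<open>?b\<close> below once one factor
    \<open>?n h\<close> is split off and the other is estimated by 1.\<close>
  define M where "M = C * (3 * (K * ?n u) + K) * K"
  have M: "0 \<le> M" using C0 K(1) nrm_nonneg[of u] by (simp add: M_def)
  fix e :: real assume e: "e > 0"
  show "\<exists>d>0. \<forall>y\<in>carr (Hsp 2 T). ?n (y - u) < d \<longrightarrow> FF T a lam y \<in> carr (Hsp 0 T) \<and>
      nrm (Hsp 0 T) (FF T a lam y - FF T a lam u - dFF T a lam u (y - u)) \<le> e * ?n (y - u)"
  \<comment> \<open>The 1 controls the copy of \<open>h\<close> inside the sum; \<open>M + 1\<close>
    stands in for \<open>M\<close>, which may be zero.\<close>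
  proof (intro exI[of _ "min 1 (e / (M + 1))"] conjI ballI impI)
    show "0 < min 1 (e / (M + 1))" using e M by simp
    fix y assume y: "y \<in> carr (Hsp 2 T)" and d: "?n (y - u) < min 1 (e / (M + 1))"
    then show "FF T a lam y \<in> carr (Hsp 0 T)" using FF_in_L2[OF T a] by (simp add: Hsp_simps)
    define h where "h = y - u"
    have h: "h \<in> Hper 2 T" using carr_simps(3)[OF y] u by (simp add: h_def Hsp_simps)
    have hL: "h \<in> L2 T" using Hper_L2[OF h, of 0] by simp
    have nh: "0 \<le> ?n h" "?n h \<le> 1" "(M + 1) * ?n h \<le> e"
      using nrm_nonneg d M by (auto simp: h_def field_simps)
    let ?b = "C * (K * ?n u + K * ?n u + K * ?n u + K * ?n h) * (K * ?n h)"
    have "AE_bound ?b (a * (u + u + u + h) * h)"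
      by (intro AE_bound_mult AE_bound_add C K(2) u h)
    from ip2_bounded_mult[OF this hL]
    have "nrm (Hsp 0 T) (FF T a lam y - FF T a lam u - dFF T a lam u h) \<le> ?b * sqrt (ip2 T h h)"
      using FF_taylor[OF T u h, of a lam] by (simp add: Hsp_simps h_def)
    also have "\<dots> \<le> ?b * ?n h"
      using ip2_wderiv_le[of 0 2 T h] C0 K(1) nrm_nonneg[of u] nh(1)
      by (intro mult_left_mono) (auto simp: Hsp_simps)
    also have "?b \<le> C * (3 * (K * ?n u) + K) * (K * ?n h)"
      using C0 K(1) nh by (intro mult_right_mono mult_left_mono) auto
    also have "\<dots> = M * ?n h" by (simp add: M_def)
    also have "M * ?n h \<le> e" using nh by (simp add: distrib_right)
    finally show "nrm (Hsp 0 T) (FF T a lam y - FF T a lam u - dFF T a lam u (y - u)) \<le> e * ?n (y - u)"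
      using nh(1) by (simp add: h_def mult_right_mono)
  qed
qed

section \<open>The kernel and the projections\<close>

text \<open>Cauchy-Schwarz bounds both components. The factor \<open>r\<close> lets one statement
  serve unit vectors and vectors that still need normalising.\<close>

lemma blin_inner_pair:
  assumes "pre_inner S B" "a \<in> S" "b \<in> S"
  shows "blin \<lparr>carr = S, nrm = (\<lambda>u. sqrt (B u u))\<rparr> euclid (\<lambda>u. (r * B u a, r * B u b))"
proof (rule blinI[where K = "\<bar>r\<bar> * (sqrt (B a a) + sqrt (B b b))"])
  interpret pre_inner S B by fact
  show "nrm euclid (r * B u a, r * B u b) \<le> \<bar>r\<bar> * (sqrt (B a a) + sqrt (B b b))
      * nrm \<lparr>carr = S, nrm = (\<lambda>u. sqrt (B u u))\<rparr> u"
    if "u \<in> carr \<lparr>carr = S, nrm = (\<lambda>u. sqrt (B u u))\<rparr>" for u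
  proof -
    have u: "u \<in> S" using that by simp
    have "norm (r * B u a, r * B u b) \<le> \<bar>r\<bar> * (\<bar>B u a\<bar> + \<bar>B u b\<bar>)"
      using norm_Pair_le[of "r * B u a" "r * B u b"] by (simp add: abs_mult distrib_left)
    also have "\<dots> \<le> \<bar>r\<bar> * (sqrt (B u u) * sqrt (B a a) + sqrt (B u u) * sqrt (B b b))"
      using cauchy_schwarz[OF u assms(2)] cauchy_schwarz[OF u assms(3)]
      by (intro mult_left_mono add_mono) auto
    finally show ?thesis by (simp add: euclid_def algebra_simps)
  qed
qed (use assms in \<open>auto simp: euclid_def pre_inner.add_left pre_inner.scaleR_left algebra_simps\<close>)

section \<open>The trigonometric basis of the kernel\<close>

lemma LL_linear: "LL T k (p + q) = LL T k p + LL T k q" "LL T k (c *\<^sub>R p) = c *\<^sub>R LL T k p"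
  by (auto simp: LL_def scaleR_add_left scaleR_add_right split: prod.splits)

lemma LL_basis: "LL T k (1, 0) = phi_cos T k" "LL T k (0, 1) = phi_sin T k"
  by (auto simp: LL_def)

text \<open>The square of this angular frequency is \<open>sig T k\<close>.\<close>

definition freq :: "real \<Rightarrow> nat \<Rightarrow> real" where
  "freq T k = 2 * pi * real k / T"

lemma LL_mcls:
  "LL T k (x, y) = mcls T (\<lambda>t. x * (sqrt (2 / T) * cos (freq T k * t)) + y * (sqrt (2 / T) * sin (freq T k * t)))"
proof -
  have c: "continuous_on {0..T} (\<lambda>t. sqrt (2 / T) * cos (freq T k * t))"
    "continuous_on {0..T} (\<lambda>t. sqrt (2 / T) * sin (freq T k * t))"
    by (intro continuous_intros)+
  have "phi_cos T k = mcls T (\<lambda>t. sqrt (2 / T) * cos (freq T k * t))"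
    "phi_sin T k = mcls T (\<lambda>t. sqrt (2 / T) * sin (freq T k * t))"
    by (simp_all add: phi_cos_def phi_sin_def freq_def)
  then show ?thesis
    using mcls_add[OF continuous_on_mult_left[OF c(1), of x] continuous_on_mult_left[OF c(2), of y]]
    by (simp only: LL_def prod.case mcls_scaleR[OF c(1)] mcls_scaleR[OF c(2)])
qed

text \<open>The matrix of differentiation on \<open>NN T k\<close> in the trigonometric basis: a
  quarter turn scaled by the frequency.\<close>

definition rot :: "real \<Rightarrow> nat \<Rightarrow> real \<times> real \<Rightarrow> real \<times> real" where
  "rot T k p = (freq T k * snd p, - freq T k * fst p)"

lemma has_weak_deriv_LL: "has_weak_deriv T (LL T k p) (LL T k (rot T k p))"
proof (cases p)
  case (Pair x y)
  let ?w = "freq T k"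
  have "((\<lambda>t. x * (sqrt (2 / T) * cos (?w * t)) + y * (sqrt (2 / T) * sin (?w * t))) has_real_derivative
      (?w * y) * (sqrt (2 / T) * cos (?w * t)) + (- ?w * x) * (sqrt (2 / T) * sin (?w * t))) (at t)" for t
    by (auto intro!: derivative_eq_intros simp: algebra_simps)
  moreover have "continuous_on UNIV
      (\<lambda>t. (?w * y) * (sqrt (2 / T) * cos (?w * t)) + (- ?w * x) * (sqrt (2 / T) * sin (?w * t)))"
    by (intro continuous_intros)
  ultimately have "has_weak_deriv T (LL T k (x, y)) (LL T k (?w * y, - ?w * x))"
    unfolding LL_mcls by (rule has_weak_deriv_mcls)
  then show ?thesis by (simp add: Pair rot_def)
qed

lemma sin_cos_freq:
  assumes "T > 0" shows "sin (freq T k * T) = 0" "cos (freq T k * T) = 1"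
proof -
  have "freq T k * T = 2 * real k * pi" using assms by (simp add: freq_def)
  then show "sin (freq T k * T) = 0" "cos (freq T k * T) = 1" by simp_all
qed

lemma LL_L2: "LL T k p \<in> L2 T"
proof -
  obtain f where "continuous_on {0..T} f" "LL T k p = mcls T f"
    using has_weak_deriv_continuous has_weak_deriv_LL .
  then show ?thesis by (simp add: mcls_L2)
qed

lemma pt_LL: assumes "T > 0" shows "pt T (LL T k p) 0 = pt T (LL T k p) T"
proof (cases p)
  case (Pair x y)
  have c: "continuous_on {0..T} (\<lambda>t. x * (sqrt (2 / T) * cos (freq T k * t))
     + y * (sqrt (2 / T) * sin (freq T k * t)))"
    by (intro continuous_intros)
  show ?thesis
    unfolding Pair LL_mcls using assms by (simp add: pt_mcls[OF assms c] sin_cos_freq)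
qed

lemma wderiv_pow_LL: "T > 0 \<Longrightarrow> (wderiv T ^^ \<alpha>) (LL T k p) = LL T k ((rot T k ^^ \<alpha>) p)"
  by (induction \<alpha>) (auto simp: wderiv_eq[OF _ has_weak_deriv_LL])

lemma LL_Hper:
  assumes "T > 0" shows "LL T k p \<in> Hper s T"
  unfolding Hper_def mem_Collect_eq wderiv_pow_LL[OF assms]
  by (auto simp: LL_L2 has_weak_deriv_LL pt_LL[OF assms])

text \<open>Orthonormality of the basis. With \<open>k \<ge> 1\<close> the frequency is nonzero, and
  over a whole number of periods only the mean value of the product survives.\<close>

lemma ip2_LL:
  assumes T: "T > 0" and k: "k \<ge> 1" shows "ip2 T (LL T k p) (LL T k q) = p \<bullet> q"
proof -
  obtain x y where p: "p = (x, y)" by (cases p)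
  obtain x' y' where q: "q = (x', y')" by (cases q)
  let ?w = "freq T k"
  have w: "?w > 0" using T k by (simp add: freq_def)
  let ?f = "\<lambda>t. x * (sqrt (2 / T) * cos (?w * t)) + y * (sqrt (2 / T) * sin (?w * t))"
  let ?g = "\<lambda>t. x' * (sqrt (2 / T) * cos (?w * t)) + y' * (sqrt (2 / T) * sin (?w * t))"
  \<comment> \<open>By the double angle formulas the product is \<open>1 / T\<close> times a
    constant plus multiples of the cosine and sine of the doubled angle; these terms are integrated
    one by one.\<close>
  let ?G = "\<lambda>t. (x * x' + y * y') / T * t
      + (x * x' - y * y') / (T * ?w) * (sin (?w * t) * cos (?w * t))
      + (x * y' + y * x') / (T * ?w) * (sin (?w * t))\<^sup>2"
  have deriv: "(?G has_real_derivative ?f t * ?g t) (at t)" for t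
  proof -
    have "(x * (r * c) + y * (r * s)) * (x' * (r * c) + y' * (r * s))
        = r\<^sup>2 * ((x * c + y * s) * (x' * c + y' * s))" for r c s
      by (simp add: power2_eq_square algebra_simps)
    note this[of "sqrt (2 / T)" "cos (?w * t)" "sin (?w * t)"]
    also have "(sqrt (2 / T))\<^sup>2 = 2 / T" using T by simp
    also have "2 / T * ((x * c + y * s) * (x' * c + y' * s)) = (x * x' + y * y') / T * (s\<^sup>2 + c\<^sup>2)
        + (x * x' - y * y') / (T * ?w) * (?w * (c\<^sup>2 - s\<^sup>2))
        + (x * y' + y * x') / (T * ?w) * (2 * ?w * (s * c))" for c s
      using T w by (simp add: field_simps power2_eq_square)
    finally have e: "?f t * ?g t = (x * x' + y * y') / T
      + (x * x' - y * y') / (T * ?w) * (?w * ((cos (?w * t))\<^sup>2 - (sin (?w * t))\<^sup>2))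
      + (x * y' + y * x') / (T * ?w) * (2 * ?w * (sin (?w * t) * cos (?w * t)))" by simp
    have "((\<lambda>t. A * t + B * (sin (?w * t) * cos (?w * t)) + C * (sin (?w * t))\<^sup>2) has_real_derivative
        A + B * (?w * ((cos (?w * t))\<^sup>2 - (sin (?w * t))\<^sup>2)) + C * (2 * ?w * (sin (?w * t) * cos (?w * t)))) (at t)"
      for A B C
      by (auto intro!: derivative_eq_intros simp: power2_eq_square algebra_simps)
    then show ?thesis unfolding e .
  qed
  have int: "((\<lambda>t. ?f t * ?g t) has_integral ?G T - ?G 0) {0..T}"
  proof (rule fundamental_theorem_of_calculus)
    show "(?G has_vector_derivative ?f t * ?g t) (at t within {0..T})" for t
      by (rule has_vector_derivative_at_within[OF deriv[unfolded has_real_derivative_iff_has_vector_derivative]])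
  qed (use T in simp)
  have "sin (?w * T) = 0" using sin_cos_freq(1)[OF T] .
  then have "?G T - ?G 0 = x * x' + y * y'" using T by simp
  from integral_unique[OF int, unfolded this]
  have "integral {0..T} (\<lambda>t. ?f t * ?g t) = x * x' + y * y'" .
  moreover have "ip2 T (LL T k p) (LL T k q) = integral {0..T} (\<lambda>t. ?f t * ?g t)"
    unfolding p q LL_mcls by (rule ip2_mcls) (intro continuous_intros)+
  ultimately show ?thesis by (simp add: p q)
qed

text \<open>For positive \<open>T\<close> and \<open>k\<close> this is the squared Sobolev norm of
  either basis function: every derivative contributes another factor
  \<open>(freq T k)\<^sup>2\<close>.\<close>

definition Hweight :: "real \<Rightarrow> nat \<Rightarrow> nat \<Rightarrow> real" where
  "Hweight T k s = (\<Sum>\<alpha>\<le>s. (freq T k)\<^sup>2 ^ \<alpha>)"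

lemma Hweight_pos: "Hweight T k s > 0"
proof -
  have "(freq T k)\<^sup>2 ^ 0 \<le> Hweight T k s" unfolding Hweight_def by (rule member_le_sum) auto
  then show ?thesis by simp
qed

text \<open>\<open>rot\<close> multiplies inner products by the squared frequency, so up to scale
  the Sobolev product on the kernel is the Euclidean one.\<close>

lemma ipH_LL:
  assumes "T > 0" "k \<ge> 1" shows "ipH s T (LL T k p) (LL T k q) = Hweight T k s * (p \<bullet> q)"
proof -
  have "(rot T k ^^ \<alpha>) p \<bullet> (rot T k ^^ \<alpha>) q = (freq T k)\<^sup>2 ^ \<alpha> * (p \<bullet> q)" for \<alpha>
  proof (induction \<alpha>)
    case (Suc \<alpha>)
    have "rot T k p \<bullet> rot T k q = (freq T k)\<^sup>2 * (p \<bullet> q)" for p q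
      by (cases p; cases q) (simp add: rot_def algebra_simps power2_eq_square)
    then show ?case using Suc by simp
  qed simp
  then show ?thesis
    by (simp add: ipH_def wderiv_pow_LL[OF assms(1)] ip2_LL[OF assms] Hweight_def sum_distrib_right)
qed

lemma blin_LL:
  assumes "T > 0" "k \<ge> 1" shows "blin euclid (Hsp s T) (LL T k)"
  by (rule blinI[where K = "sqrt (Hweight T k s)"])
    (simp_all add: Hsp_simps LL_Hper assms LL_linear euclid_def ipH_LL[OF assms] real_sqrt_mult norm_eq_sqrt_inner del: inner_prod_def)

text \<open>The basis is orthonormal in \<open>L2\<close> but only orthogonal here, hence the
  division by its squared length.\<close>

definition coordH :: "real \<Rightarrow> nat \<Rightarrow> mfun \<Rightarrow> real \<times> real" where
  "coordH T k u = (1 / Hweight T k 2 * ipH 2 T u (phi_cos T k), 1 / Hweight T k 2 * ipH 2 T u (phi_sin T k))"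

definition coord2 :: "real \<Rightarrow> nat \<Rightarrow> mfun \<Rightarrow> real \<times> real" where
  "coord2 T k v = (ip2 T v (phi_cos T k), ip2 T v (phi_sin T k))"

lemma blin_coordH: "T > 0 \<Longrightarrow> blin (Hsp 2 T) euclid (coordH T k)"
  unfolding coordH_def[abs_def] Hsp_def
  by (rule blin_inner_pair[OF pre_inner_ipH]) (simp_all add: LL_Hper flip: LL_basis)

lemma blin_coord2: "T > 0 \<Longrightarrow> blin (Hsp 0 T) euclid (coord2 T k)"
  using blin_inner_pair[OF pre_inner_ipH[of T 0], of "phi_cos T k" "phi_sin T k" 1]
  by (simp add: coord2_def[abs_def] Hsp_def Hsp_simps(3) LL_Hper flip: LL_basis)

lemma coord_LL:
  assumes "T > 0" "k \<ge> 1" shows "coordH T k (LL T k p) = p" "coord2 T k (LL T k p) = p"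
  using Hweight_pos[of T k 2]
  by (cases p; simp add: coordH_def coord2_def ipH_LL[OF assms] ip2_LL[OF assms] flip: LL_basis)+

lemma QQ_eq: "QQ T k v = LL T k (coord2 T k v)"
  by (simp add: QQ_def LL_def coord2_def)

text \<open>Projecting onto the kernel does not alter the \<open>L2\<close> coordinates, so the
  projection drops out and \<open>HH\<close> becomes a composition fit for the chain rule.\<close>

lemma HH_eq:
  assumes "T > 0" "k \<ge> 1"
  shows "HH T a k \<psi> lam p = coord2 T k (FF T a lam (LL T k p + \<psi> (lam, LL T k p)))"
  using coord_LL(2)[OF assms] by (simp add: HH_def QQ_eq flip: coord2_def)

lemma GG_eq: "GG T a k lam x y = FF T a lam (x + y) - LL T k (coord2 T k (FF T a lam (x + y)))"
  by (simp add: GG_def QQ_eq)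

section \<open>Kernel, complement, range and projection in coordinates\<close>

lemma NN_eq: "NN T k = range (LL T k)"
proof
  show "NN T k \<subseteq> range (LL T k)"
    unfolding NN_def
  proof (rule span_minimal)
    show "{phi_cos T k, phi_sin T k} \<subseteq> range (LL T k)" using LL_basis[of T k] by (metis empty_subsetI insert_subset rangeI)
    show "subspace (range (LL T k))"
      unfolding subspace_def
    proof (intro conjI ballI allI)
      show "0 \<in> range (LL T k)" using LL_linear(2)[of T k 0 0] by (metis rangeI scale_zero_left)
    qed (auto simp flip: LL_linear)
  qed
  show "range (LL T k) \<subseteq> NN T k"
    unfolding LL_def NN_def
    by (auto split: prod.splits intro!: span_add[OF span_scale[OF span_base] span_scale[OF span_base]])
qed

text \<open>Brings the complement into the form of a kernel of coordinates, as
  \<open>schur_GL_iff\<close> expects it.\<close>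

lemma NNperp_eq:
  assumes T: "T > 0" shows "NNperp T k = {u \<in> carr (Hsp 2 T). coordH T k u = 0}"
proof -
  interpret pre_inner "Hper 2 T" "ipH 2 T" by (rule pre_inner_ipH[OF T])
  have b: "phi_cos T k \<in> Hper 2 T" "phi_sin T k \<in> Hper 2 T"
    using LL_Hper[OF T] by (simp_all flip: LL_basis)
  have "(\<forall>x\<in>NN T k. ipH 2 T x u = 0) \<longleftrightarrow> coordH T k u = 0" if u: "u \<in> Hper 2 T" for u
  proof
    assume "\<forall>x\<in>NN T k. ipH 2 T x u = 0"
    then have "ipH 2 T (phi_cos T k) u = 0" "ipH 2 T (phi_sin T k) u = 0"
      by (simp_all add: NN_def span_base)
    then show "coordH T k u = 0" by (simp add: coordH_def commute[of u] zero_prod_def)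
  next
    assume "coordH T k u = 0"
    then have z: "ipH 2 T (phi_cos T k) u = 0" "ipH 2 T (phi_sin T k) u = 0"
      using Hweight_pos[of T k 2] by (auto simp: coordH_def commute[of u] zero_prod_def)
    have "ipH 2 T (LL T k p) u = 0" for p
      using b u z by (cases p) (simp add: LL_def add_left scaleR_left subspace_scale[OF subspace_S])
    then show "\<forall>x\<in>NN T k. ipH 2 T x u = 0" by (auto simp: NN_eq)
  qed
  then show ?thesis by (auto simp: NNperp_def Hsp_simps)
qed

lemma subspace_NNperp:
  assumes T: "T > 0" shows "subspace (NNperp T k)"
  using nvs.carr_simps[OF nvs_Hsp[OF T, of 2]] blinD(2,3)[OF blin_coordH[OF T, of k]]
    blin_0[OF blin_coordH[OF T, of k] nvs_Hsp[OF T]]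
  by (simp add: NNperp_eq[OF T] subspace_def)

lemma RR_eq: "RR T k = {v \<in> carr (Hsp 0 T). coord2 T k v = 0}"
  by (auto simp: RR_def coord2_def Hsp_simps zero_prod_def)

text \<open>A difference \<open>u - LL T k p\<close> lies in the complement for exactly one
  \<open>p\<close>, which settles existence and uniqueness for the description in
  \<open>PP\<close>.\<close>

lemma PP_eq:
  assumes T: "T > 0" "k \<ge> 1" and u: "u \<in> Hper 2 T"
  shows "PP T k u = LL T k (coordH T k u)" "u - LL T k (coordH T k u) \<in> NNperp T k"
proof -
  note N = nvs_Hsp[OF T(1), of 2]
  have *: "u - LL T k p \<in> NNperp T k \<longleftrightarrow> p = coordH T k u" for p
  proof -
    have "coordH T k (u - LL T k p) = coordH T k u - p"
      using blin_diff[OF blin_coordH[OF T(1)] N] u LL_Hper[OF T(1)] coord_LL(1)[OF T]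
      by (simp add: Hsp_simps)
    moreover have "u - LL T k p \<in> carr (Hsp 2 T)"
      using nvs.carr_simps(3)[OF N] u LL_Hper[OF T(1)] by (simp add: Hsp_simps)
    ultimately show ?thesis by (auto simp: NNperp_eq[OF T(1)])
  qed
  then show "u - LL T k (coordH T k u) \<in> NNperp T k" by blast
  then show "PP T k u = LL T k (coordH T k u)"
    unfolding PP_def by (intro the_equality) (auto simp: NN_eq *)
qed

lemma inv_LL: "T > 0 \<Longrightarrow> k \<ge> 1 \<Longrightarrow> inv (LL T k) (LL T k p) = p"
  by (rule inv_f_f) (metis coord_LL(1) injI)

section \<open>The reduction\<close>

lemma nvs_NN:
  assumes T: "T > 0" shows "nvs (nsub (Hsp 2 T) (NN T k))"
proof (rule nvs.nvs_nsub[OF nvs_Hsp[OF T]])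
  show "subspace (NN T k)" by (simp add: NN_def)
qed (auto simp: NN_eq Hsp_simps LL_Hper[OF T])

text \<open>The derivative is taken jointly in both variables: freezing the first gives the
  derivative of the slice, while the joint version gives the continuity of
  \<open>Psi\<close>.\<close>

lemma has_fderiv_Psi:
  fixes I :: "real set"
  assumes T: "T > 0" "k \<ge> 1"
    and sm: "smooth_on (nprod euclid (nsub (Hsp 2 T) (NN T k))) (nsub (Hsp 2 T) (NNperp T k)) (I \<times> Nk) \<psi>"
    and z: "lam \<in> I" "LL T k p \<in> Nk"
  obtains S where "has_fderiv euclid (Hsp 2 T) (\<lambda>z. LL T k (snd z) + \<psi> (fst z, LL T k (snd z)))
      (\<lambda>h. LL T k (snd h) + S h) (lam, p)"
    "blin euclid (Hsp 2 T) S" "\<And>h. coordH T k (S h) = 0"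
proof -
  let ?N = "nsub (Hsp 2 T) (NN T k)" and ?Np = "nsub (Hsp 2 T) (NNperp T k)"
  let ?P = "nprod (euclid :: real nspace) ?N"
  note H = nvs_Hsp[OF T(1), of 2] and E = nvs_euclid
  have N: "nvs ?N" by (rule nvs_NN[OF T(1)])
  have sp: "NNperp T k \<subseteq> carr (Hsp 2 T)" by (auto simp: NNperp_eq[OF T(1)])
  have Np: "nvs ?Np"
    by (rule nvs.nvs_nsub[OF H subspace_NNperp[OF T(1)] sp])
  have P: "nvs ?P" by (rule nvs_nprod[OF E N])
  have bl: "blin euclid ?P (\<lambda>(l, h). (l, LL T k h))"
  \<comment> \<open>\<open>LL\<close> stretches lengths by the root of the weight; the scalar
    component accounts for the 1.\<close>
  proof (rule blinI[where K = "1 + sqrt (Hweight T k 2)"])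
    fix z :: "real \<times> real \<times> real"
    obtain l h where lh: "z = (l, h)" by (cases z)
    have "nrm ?P (l, LL T k h) \<le> \<bar>l\<bar> + sqrt (Hweight T k 2) * norm h"
      using sqrt_sum_squares_le_sum_abs[of l "sqrt (Hweight T k 2) * norm h"] Hweight_pos[of T k 2]
      by (simp add: nprod_def euclid_def nsub_def Hsp_simps ipH_LL[OF T] real_sqrt_mult norm_eq_sqrt_inner[of h] power_mult_distrib)
    also have "\<dots> \<le> (1 + sqrt (Hweight T k 2)) * norm z"
      using norm_fst_le[of l h] mult_left_mono[OF norm_snd_le[of h l], of "sqrt (Hweight T k 2)"]
        less_imp_le[OF Hweight_pos[of T k 2]]
      unfolding lh distrib_right by (simp add: add_mono)
    finally show "nrm ?P (case z of (l, h) \<Rightarrow> (l, LL T k h)) \<le> (1 + sqrt (Hweight T k 2)) * nrm euclid z"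
      by (simp add: lh euclid_def)
  qed (simp_all add: nprod_def euclid_def nsub_def LL_linear NN_eq case_prod_beta)
  have "\<exists>A. has_fderiv ?P ?Np \<psi> A (lam, LL T k p)"
    using sm[unfolded smooth_on_def, rule_format, of "Suc 0"] z by auto
  then obtain A where A: "has_fderiv ?P ?Np \<psi> A (lam, LL T k p)" ..
  have U: "(lam, p) \<in> carr euclid" by (simp add: euclid_def)
  have "has_fderiv euclid ?P (\<lambda>(l, h). (l, LL T k h)) (\<lambda>(l, h). (l, LL T k h)) (lam, p)"
    by (rule has_fderiv_linear[OF bl E P U])
  then have "has_fderiv euclid ?Np (\<lambda>z. \<psi> (case z of (l, h) \<Rightarrow> (l, LL T k h)))
      (\<lambda>z. A (case z of (l, h) \<Rightarrow> (l, LL T k h))) (lam, p)"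
    by (rule has_fderiv_compose[OF _ _ E P Np U]) (simp add: A)
  note 1 = this
  \<comment> \<open>Composition with the inclusion forgets that the values lie in the complement.
    The sharper codomain in \<open>1\<close> is what later shows that \<open>S\<close> has no
    coordinates along the kernel.\<close>
  have i: "has_fderiv ?Np (Hsp 2 T) (\<lambda>x. x) (\<lambda>x. x) (\<psi> (lam, LL T k p))"
    using has_fderiv_value[OF 1 E U] by (intro has_fderiv_linear blin_id sp H Np) simp
  define S where "S = (\<lambda>z. A (case z of (l, h) \<Rightarrow> (l, LL T k h)))"
  have 2: "has_fderiv euclid (Hsp 2 T) (\<lambda>z. \<psi> (case z of (l, h) \<Rightarrow> (l, LL T k h))) S (lam, p)"
    unfolding S_def using has_fderiv_compose[OF 1 _ E Np H U] i by simp
  have bsnd: "blin euclid euclid (snd :: real \<times> real \<times> real \<Rightarrow> _)"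
    by (simp add: blin_euclid_iff bounded_linear_snd)
  have "blin euclid (Hsp 2 T) (\<lambda>z :: real \<times> real \<times> real. LL T k (snd z))"
    by (rule blin_compose[OF bsnd blin_LL[OF T] E E])
  from has_fderiv_add[OF has_fderiv_linear[OF this E H U] 2 E H U]
  have "has_fderiv euclid (Hsp 2 T) (\<lambda>z. LL T k (snd z) + \<psi> (fst z, LL T k (snd z)))
      (\<lambda>h. LL T k (snd h) + S h) (lam, p)" by (simp add: case_prod_beta)
  moreover have "coordH T k (S h) = 0" for h
    using blinD(1)[OF has_fderiv_blin[OF 1], of h]
    by (simp add: S_def euclid_def nsub_def NNperp_eq[OF T(1)])
  ultimately show ?thesis using that has_fderiv_blin[OF 2] by blast
qed

text \<open>An instance of \<open>schur_GL_iff\<close> with \<open>LL\<close> as parametrisation on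
  both sides, \<open>coordH\<close> as coordinates in the domain and \<open>coord2\<close> in the
  target.\<close>

lemma GL_reduction:
  fixes I :: "real set"
  assumes T: "T > 0" and k: "k \<ge> 1" and a: "a \<in> Linf T"
    and Nk: "openin (ntop (nsub (Hsp 2 T) (NN T k))) Nk"
    and \<psi>: "\<psi> \<in> I \<times> Nk \<rightarrow> NNperp T k"
    and sm: "smooth_on (nprod euclid (nsub (Hsp 2 T) (NN T k))) (nsub (Hsp 2 T) (NNperp T k)) (I \<times> Nk) \<psi>"
    and lam: "lam \<in> I" and p: "LL T k p \<in> Nk"
    and G: "\<And>x. x \<in> Nk \<Longrightarrow> GG T a k lam x (\<psi> (lam, x)) = 0"
    and iso: "fderiv (nsub (Hsp 2 T) (NNperp T k)) (nsub (Hsp 0 T) (RR T k))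
        (\<lambda>y. GG T a k lam (LL T k p) y) (\<psi> (lam, LL T k p))
      \<in> GL (nsub (Hsp 2 T) (NNperp T k)) (nsub (Hsp 0 T) (RR T k))"
  shows "frechet_derivative (HH T a k \<psi> lam) (at p) \<in> GL euclid euclid \<longleftrightarrow>
    fderiv (Hsp 2 T) (Hsp 0 T) (FF T a lam) (LL T k p + \<psi> (lam, LL T k p)) \<in> GL (Hsp 2 T) (Hsp 0 T)"
proof -
  let ?N = "nsub (Hsp 2 T) (NN T k)" and ?Np = "nsub (Hsp 2 T) (NNperp T k)"
    and ?R = "nsub (Hsp 0 T) (RR T k)"
  note H2 = nvs_Hsp[OF T, of 2] and H0 = nvs_Hsp[OF T, of 0] and E = nvs_euclid
  note L2 = blin_LL[OF T k, of 2] and L0 = blin_LL[OF T k, of 0]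
    and c2 = blin_coordH[OF T, of k] and c0 = blin_coord2[OF T, of k] and c = coord_LL[OF T k]
  have N: "nvs ?N" by (rule nvs_NN[OF T])
  have sp: "NNperp T k \<subseteq> carr (Hsp 2 T)" by (auto simp: NNperp_eq[OF T])
  have Np: "nvs ?Np" by (rule nvs.nvs_nsub[OF H2 subspace_NNperp[OF T] sp])
  have sR: "subspace (RR T k)"
    using nvs.carr_simps[OF H0] blinD(2,3)[OF c0] blin_0[OF c0 H0] by (simp add: RR_eq subspace_def)
  have R: "nvs ?R" by (rule nvs.nvs_nsub[OF H0 sR]) (auto simp: RR_eq)

  define u where "u = LL T k p + \<psi> (lam, LL T k p)"
  obtain S where S: "has_fderiv euclid (Hsp 2 T) (\<lambda>z. LL T k (snd z) + \<psi> (fst z, LL T k (snd z)))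
      (\<lambda>h. LL T k (snd h) + S h) (lam, p)"
    and bS: "blin euclid (Hsp 2 T) S" and cS: "\<And>h. coordH T k (S h) = 0"
    using has_fderiv_Psi[OF T k sm lam p] by blast
  \<comment> \<open>Directions with the first parameter held fixed.\<close>
  let ?S = "\<lambda>h. S (0, h)"
  have pe: "p \<in> carr euclid" for p :: "real \<times> real" by (simp add: euclid_def)
  have b0: "blin euclid euclid (\<lambda>h :: real \<times> real. (0 :: real, h))"
    by (simp add: blin_euclid_iff bounded_linear_Pair bounded_linear_zero bounded_linear_ident)
  have "has_fderiv euclid euclid (\<lambda>q. (lam, 0) + (0, q)) (\<lambda>h. (0 :: real, h)) p"
    by (rule has_fderiv_affine[OF b0 E E]) (simp_all add: euclid_def)
  then have "has_fderiv euclid euclid (\<lambda>q. (lam, q)) (\<lambda>h. (0 :: real, h)) p" by simp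
  from has_fderiv_compose[OF this S E E H2 pe]
  have U: "has_fderiv euclid (Hsp 2 T) (\<lambda>q. LL T k q + \<psi> (lam, LL T k q)) (\<lambda>h. LL T k h + ?S h) p"
    by simp
  have u: "u \<in> Hper 2 T" using has_fderiv_value[OF U E pe] by (simp add: Hsp_simps u_def)
  have uc: "u \<in> carr (Hsp 2 T)" using u by (simp add: Hsp_simps)
  define A where "A = dFF T a lam u"
  note F = has_fderiv_FF[OF T a u, of lam, folded A_def]
  have A: "blin (Hsp 2 T) (Hsp 0 T) A" using F by (rule has_fderiv_blin)
  define D where "D h = coord2 T k (A (LL T k h + ?S h))" for h
  have FU: "has_fderiv euclid (Hsp 0 T) (\<lambda>q. FF T a lam (LL T k q + \<psi> (lam, LL T k q)))
      (\<lambda>h. A (LL T k h + ?S h)) p"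
    by (rule has_fderiv_compose[OF U _ E H2 H0 pe]) (use F in \<open>simp add: u_def\<close>)
  note fu0 = has_fderiv_value[OF FU E pe]
  have "has_fderiv euclid euclid (\<lambda>q. coord2 T k (FF T a lam (LL T k q + \<psi> (lam, LL T k q))))
      (\<lambda>h. coord2 T k (A (LL T k h + ?S h))) p"
    by (rule has_fderiv_compose[OF FU has_fderiv_linear[OF c0 H0 E fu0] E H0 E pe])
  then have "has_fderiv euclid euclid (HH T a k \<psi> lam) D p"
    by (simp add: HH_eq[OF T k, abs_def] D_def[abs_def])
  then have HD: "(HH T a k \<psi> lam has_derivative D) (at p)" by (rule has_fderiv_euclid_imp)
  then have fr: "frechet_derivative (HH T a k \<psi> lam) (at p) = D"
    using frechet_derivative_at by metis
  have D: "linear D" using HD has_derivative_linear by blast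

  have bQ: "blin (Hsp 0 T) (Hsp 0 T) (\<lambda>v. v - LL T k (coord2 T k v))"
    using blin_minus[OF _ blin_compose[OF c0 L0 H0 E] H0 H0, of "\<lambda>v. v"] blin_wderiv_pow[OF T, of 0 0]
    by (simp add: id_def)
  have bR: "blin (Hsp 0 T) ?R (\<lambda>v. v - LL T k (coord2 T k v))"
  proof (rule blin_into_nsub[OF bQ])
    fix v assume v: "v \<in> carr (Hsp 0 T)"
    have "LL T k q \<in> carr (Hsp 0 T)" for q using LL_Hper[OF T] by (simp add: Hsp_simps)
    then show "v - LL T k (coord2 T k v) \<in> RR T k"
      using blinD(1)[OF bQ v] blin_diff[OF c0 H0 v] c(2) by (simp add: RR_eq)
  qed

  text \<open>Differentiating \<open>G(\<lambda>, x, \<psi>(\<lambda>, x)) = 0\<close> in \<open>x\<close> shows that \<open>A\<close> maps the graph of the derivative of \<open>\<psi>\<close> into \<open>N\<close>.\<close>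
  have AD: "A (LL T k h + ?S h) = LL T k (D h)" for h
  proof -
    obtain r where r: "r > 0" "\<And>y. y \<in> carr ?N \<Longrightarrow> nrm ?N (y - LL T k p) < r \<Longrightarrow> y \<in> Nk"
      using openin_ntopD[OF N Nk p] by blast
    \<comment> \<open>Since \<open>LL\<close> multiplies Euclidean lengths by this root, the ball of
      radius \<open>d\<close> about \<open>p\<close> is mapped into \<open>Nk\<close>.\<close>
    define d where "d = r / sqrt (Hweight T k 2)"
    have w: "sqrt (Hweight T k 2) > 0" using Hweight_pos by simp
    have z: "FF T a lam (LL T k q + \<psi> (lam, LL T k q))
        - LL T k (coord2 T k (FF T a lam (LL T k q + \<psi> (lam, LL T k q)))) = 0"
      if "nrm euclid (q - p) < d" for q
    proof -
      have "nrm ?N (LL T k q - LL T k p) = nrm ?N (LL T k (q - p))"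
        using LL_linear(1)[of T k "q - p" p] by simp
      also have "\<dots> = sqrt (Hweight T k 2) * norm (q - p)"
        by (simp add: nsub_def Hsp_simps ipH_LL[OF T k] real_sqrt_mult norm_eq_sqrt_inner del: inner_diff_left inner_diff_right)
      also have "\<dots> < r" using that w by (simp add: d_def euclid_def field_simps)
      finally have "LL T k q \<in> Nk" using r(2) by (simp add: nsub_def NN_eq)
      then show ?thesis using G by (simp add: GG_eq)
    qed
    have 1: "has_fderiv euclid (Hsp 0 T) (\<lambda>q. FF T a lam (LL T k q + \<psi> (lam, LL T k q))
        - LL T k (coord2 T k (FF T a lam (LL T k q + \<psi> (lam, LL T k q)))))
      (\<lambda>h. A (LL T k h + ?S h) - LL T k (coord2 T k (A (LL T k h + ?S h)))) p"
      by (rule has_fderiv_compose[OF FU has_fderiv_linear[OF bQ H0 H0 fu0] E H0 H0 pe])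
    have d: "d > 0" using r w by (simp add: d_def)
    \<comment> \<open>The map in \<open>1\<close> is zero near \<open>p\<close>, so its derivative
      is also one of the zero map; uniqueness then makes it vanish.\<close>
    have 2: "has_fderiv euclid (Hsp 0 T) (\<lambda>q. 0)
      (\<lambda>h. A (LL T k h + ?S h) - LL T k (coord2 T k (A (LL T k h + ?S h)))) p"
      by (rule has_fderiv_transform[OF 1 E pe d]) (rule z)
    have "blin (euclid :: (real \<times> real) nspace) (Hsp 0 T) (\<lambda>q. 0)"
      using nvs.carr_simps(1)[OF H0] nvs.nrm_0[OF H0]
      by (intro blinI[where K = 0]) simp_all
    then have 3: "has_fderiv euclid (Hsp 0 T) (\<lambda>q. 0) (\<lambda>h. 0) p"
      by (rule has_fderiv_linear[OF _ E H0 pe])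
    show ?thesis using has_fderiv_unique[OF 2 3 E H0 pe pe, of h] by (simp add: D_def)
  qed

  have yp: "\<psi> (lam, LL T k p) \<in> carr ?Np" using \<psi> lam p by (auto simp: nsub_def)
  have LH: "LL T k p \<in> carr (Hsp 2 T)" by (simp add: Hsp_simps LL_Hper[OF T])
  have "has_fderiv ?Np (Hsp 2 T) (\<lambda>y. LL T k p + y) (\<lambda>y. y) (\<psi> (lam, LL T k p))"
    by (rule has_fderiv_affine[OF blin_id[OF H2 sp] Np H2 LH yp])
  then have FY: "has_fderiv ?Np (Hsp 0 T) (\<lambda>y. FF T a lam (LL T k p + y)) A (\<psi> (lam, LL T k p))"
    by (rule has_fderiv_compose[OF _ _ Np H2 H0 yp]) (use F in \<open>simp add: u_def\<close>)
  have "has_fderiv ?Np ?R (\<lambda>y. FF T a lam (LL T k p + y) - LL T k (coord2 T k (FF T a lam (LL T k p + y))))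
      (\<lambda>y. A y - LL T k (coord2 T k (A y))) (\<psi> (lam, LL T k p))"
    by (rule has_fderiv_compose[OF FY has_fderiv_linear[OF bR H0 R] Np H0 R yp]) (rule fu0)
  then have GY: "has_fderiv ?Np ?R (\<lambda>y. GG T a k lam (LL T k p) y)
      (\<lambda>y. A y - LL T k (coord2 T k (A y))) (\<psi> (lam, LL T k p))"
    by (simp add: GG_eq)
  \<comment> \<open>The hypothesis \<open>iso\<close> concerns a derivative selected by
    \<open>SOME\<close>; uniqueness on the carrier replaces it by the explicit block of
    \<open>A\<close>.\<close>
  have B: "(\<lambda>y. A y - LL T k (coord2 T k (A y))) \<in> GL ?Np ?R"
    by (rule iffD1[OF GL_cong[OF Np R] iso]) (rule fderiv_eq[OF GY Np R yp])
  have "D \<in> GL euclid euclid \<longleftrightarrow> A \<in> GL (Hsp 2 T) (Hsp 0 T)"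
  proof (rule schur_GL_iff[OF H2 H0 A L2 c2 c(1) _ _ L0 c0 c(2) D AD B[unfolded NNperp_eq[OF T] RR_eq]])
    show "blin euclid (Hsp 2 T) ?S" by (rule blin_compose[OF b0 bS E E])
  qed (rule cS)
  moreover have "fderiv (Hsp 2 T) (Hsp 0 T) (FF T a lam) u \<in> GL (Hsp 2 T) (Hsp 0 T)
      \<longleftrightarrow> A \<in> GL (Hsp 2 T) (Hsp 0 T)"
    by (rule GL_cong[OF H2 H0]) (rule fderiv_eq[OF F H2 H0 uc])
  ultimately show ?thesis by (simp add: fr u_def)
qed

text \<open>Continuity of the second component is read off differentiability, through the local
  Lipschitz bound at each point of \<open>Z\<close>.\<close>

lemma continuous_map_Psi:
  fixes I :: "real set" and Nk :: "mfun set"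
  assumes T: "T > 0" and k: "k \<ge> 1"
    and sm: "smooth_on (nprod euclid (nsub (Hsp 2 T) (NN T k))) (nsub (Hsp 2 T) (NNperp T k)) (I \<times> Nk) \<psi>"
    and Z: "\<And>lam p. (lam, p) \<in> Z \<Longrightarrow> lam \<in> I \<and> LL T k p \<in> Nk"
  shows "continuous_map (top_of_set Z) (prod_topology euclideanreal (ntop (Hsp 2 T))) (Psi T k \<psi>)"
  unfolding continuous_map_pairwise
proof
  have "fst \<circ> Psi T k \<psi> = fst" by (auto simp: Psi_def)
  then show "continuous_map (top_of_set Z) euclideanreal (fst \<circ> Psi T k \<psi>)"
    by (simp add: continuous_on_fst)
  note H = nvs_Hsp[OF T, of 2]
  let ?U = "\<lambda>z. LL T k (snd z) + \<psi> (fst z, LL T k (snd z))"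
  have sn: "snd \<circ> Psi T k \<psi> = ?U" by (auto simp: Psi_def)
  have ze: "z \<in> carr euclid" for z :: "real \<times> real \<times> real" by (simp add: euclid_def)
  have U: "\<exists>W. has_fderiv euclid (Hsp 2 T) ?U W z" if z: "z \<in> Z" for z
  proof -
    obtain lam p where zp: "z = (lam, p)" by (cases z)
    show ?thesis using has_fderiv_Psi[OF T k sm, of lam p] Z[of lam p] z unfolding zp by metis
  qed
  show "continuous_map (top_of_set Z) (ntop (Hsp 2 T)) (snd \<circ> Psi T k \<psi>)"
    unfolding sn
  proof (rule continuous_map_into_ntop[OF H])
    show "?U \<in> Z \<rightarrow> carr (Hsp 2 T)" using U has_fderiv_value[OF _ nvs_euclid ze] by blast
    fix z and e :: real assume z: "z \<in> Z" and e: "e > 0"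
    obtain W where W: "has_fderiv euclid (Hsp 2 T) ?U W z" using U z by blast
    obtain d K where d: "d > 0" and K: "K > 0"
      and l: "\<And>y. y \<in> carr euclid \<Longrightarrow> nrm euclid (y - z) < d \<Longrightarrow>
        nrm (Hsp 2 T) (?U y - ?U z) \<le> K * nrm euclid (y - z)"
      using has_fderiv_lipschitz[OF W nvs_euclid H ze] by metis
    show "\<exists>d>0. \<forall>y\<in>Z. dist y z < d \<longrightarrow> nrm (Hsp 2 T) (?U y - ?U z) < e"
    proof (intro exI[of _ "min d (e / K)"] conjI ballI impI)
      show "0 < min d (e / K)" using d K e by simp
      fix y assume y: "dist y z < min d (e / K)"
      then have "nrm (Hsp 2 T) (?U y - ?U z) \<le> K * dist y z"
        using l[OF ze, of y] by (simp add: euclid_def dist_norm)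
      also have "\<dots> < e" using y K by (simp add: field_simps)
      finally show "nrm (Hsp 2 T) (?U y - ?U z) < e" .
    qed
  qed
qed

text \<open>On \<open>W\<close> the projection followed by the inverse of \<open>LL\<close> is
  \<open>coordH\<close>, a bounded linear map; the inclusion of \<open>W\<close> in the Sobolev
  space is what makes this formula for \<open>PP\<close> available.\<close>

lemma continuous_map_Psi_inv:
  assumes T: "T > 0" and k: "k \<ge> 1" and W: "W \<subseteq> UNIV \<times> Hper 2 T"
  shows "continuous_map (subtopology (prod_topology euclideanreal (ntop (Hsp 2 T))) W) euclidean (Psi_inv T k)"
proof -
  let ?X = "subtopology (prod_topology euclideanreal (ntop (Hsp 2 T))) W"
  have "continuous_map (prod_topology euclideanreal (ntop (Hsp 2 T))) euclidean (\<lambda>w. coordH T k (snd w))"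
    using continuous_map_compose[OF continuous_map_snd continuous_map_blin[OF nvs_Hsp[OF T] blin_coordH[OF T]]]
    by (simp add: o_def)
  then have "continuous_map ?X (prod_topology euclidean euclidean) (\<lambda>w. (fst w, coordH T k (snd w)))"
    unfolding continuous_map_pairwise
    by (simp add: o_def continuous_map_from_subtopology continuous_map_fst)
  then have "continuous_map ?X euclidean (\<lambda>w. (fst w, coordH T k (snd w)))" by simp
  then show ?thesis
  proof (rule continuous_map_eq)
    fix w assume "w \<in> topspace ?X"
    then show "(fst w, coordH T k (snd w)) = Psi_inv T k w"
      using W by (cases w) (auto simp: Psi_inv_def PP_eq(1)[OF T k] inv_LL[OF T k] subset_iff)
  qed
qed

lemma Psi_bijection:
  assumes T: "T > 0" and k: "k \<ge> 1" and \<psi>: "\<psi> \<in> I \<times> Nk \<rightarrow> NNperp T k"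
    and imp: "\<And>lam x y. x \<in> NN T k \<Longrightarrow> y \<in> NNperp T k \<Longrightarrow>
      (lam, x + y) \<in> Ok \<and> GG T a k lam x y = 0 \<longleftrightarrow> (lam, x) \<in> I \<times> Nk \<and> y = \<psi> (lam, x)"
  shows "Psi T k \<psi> \<in> HH_zeros T a k \<psi> I Nk \<rightarrow> FF_zeros T a \<inter> Ok"
    and "Psi_inv T k \<in> FF_zeros T a \<inter> Ok \<rightarrow> HH_zeros T a k \<psi> I Nk"
    and "z \<in> HH_zeros T a k \<psi> I Nk \<Longrightarrow> Psi_inv T k (Psi T k \<psi> z) = z"
    and "w \<in> FF_zeros T a \<inter> Ok \<Longrightarrow> Psi T k \<psi> (Psi_inv T k w) = w"
proof -
  note H = nvs_Hsp[OF T, of 2]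
  have L0: "LL T k 0 = 0" using LL_linear(2)[of T k 0 0] by simp
  have LN: "LL T k p \<in> NN T k" and LH: "LL T k p \<in> carr (Hsp 2 T)" for p
    by (auto simp: NN_eq Hsp_simps LL_Hper[OF T])
  have "Psi T k \<psi> (lam, p) \<in> FF_zeros T a \<inter> Ok \<and> Psi_inv T k (Psi T k \<psi> (lam, p)) = (lam, p)"
    if "(lam, p) \<in> HH_zeros T a k \<psi> I Nk" for lam p
  proof -
    let ?y = "\<psi> (lam, LL T k p)"
    let ?u = "LL T k p + ?y"
    have z: "lam \<in> I" "LL T k p \<in> Nk" "HH T a k \<psi> lam p = 0"
      using that by (auto simp: HH_zeros_def)
    then have y: "?y \<in> NNperp T k" using \<psi> by auto
    then have yc: "?y \<in> carr (Hsp 2 T)" "coordH T k ?y = 0" by (simp_all add: NNperp_eq[OF T])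
    have u: "?u \<in> Hper 2 T" using nvs.carr_simps(2)[OF H LH yc(1)] by (simp add: Hsp_simps)
    have 1: "(lam, ?u) \<in> Ok \<and> GG T a k lam (LL T k p) ?y = 0" using imp[OF LN y] z by simp
    \<comment> \<open>\<open>GG = 0\<close> says that the value of \<open>FF\<close> is
      \<open>LL\<close> of its own coordinates, and these coordinates are the value of
      \<open>HH\<close>.\<close>
    then have "FF T a lam ?u = 0" using z(3) by (simp add: GG_eq HH_eq[OF T k] L0)
    then have "Psi T k \<psi> (lam, p) \<in> FF_zeros T a \<inter> Ok" using 1 u by (simp add: Psi_def FF_zeros_def)
    moreover have "coordH T k ?u = p"
      using blinD(2)[OF blin_coordH[OF T] LH yc(1)] yc(2) coord_LL(1)[OF T k] by simp
    then have "Psi_inv T k (Psi T k \<psi> (lam, p)) = (lam, p)"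
      using PP_eq(1)[OF T k u] inv_LL[OF T k] by (simp add: Psi_def Psi_inv_def)
    ultimately show ?thesis by blast
  qed
  then have *: "Psi T k \<psi> z \<in> FF_zeros T a \<inter> Ok \<and> Psi_inv T k (Psi T k \<psi> z) = z"
    if "z \<in> HH_zeros T a k \<psi> I Nk" for z
    using that by (cases z) blast
  show "Psi T k \<psi> \<in> HH_zeros T a k \<psi> I Nk \<rightarrow> FF_zeros T a \<inter> Ok" using * by blast
  show "z \<in> HH_zeros T a k \<psi> I Nk \<Longrightarrow> Psi_inv T k (Psi T k \<psi> z) = z" using * by blast
  have "Psi_inv T k (lam, u) \<in> HH_zeros T a k \<psi> I Nk \<and> Psi T k \<psi> (Psi_inv T k (lam, u)) = (lam, u)"
    if "(lam, u) \<in> FF_zeros T a \<inter> Ok" for lam u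
  proof -
    have u: "u \<in> Hper 2 T" "FF T a lam u = 0" "(lam, u) \<in> Ok" using that by (auto simp: FF_zeros_def)
    define p where "p = coordH T k u"
    define y where "y = u - LL T k p"
    have y: "y \<in> NNperp T k" using PP_eq(2)[OF T k u(1)] by (simp add: y_def p_def)
    have uy: "LL T k p + y = u" by (simp add: y_def)
    have c0: "coord2 T k 0 = 0" using blin_0[OF blin_coord2[OF T] nvs_Hsp[OF T]] .
    have "GG T a k lam (LL T k p) y = 0" by (simp add: GG_eq uy u(2) c0 L0)
    \<comment> \<open>One application of \<open>imp\<close> gives both that the parameter lies in
      the domain and that \<open>y\<close> lies on the graph of \<open>\<psi>\<close>.\<close>
    then have 1: "(lam, LL T k p) \<in> I \<times> Nk \<and> y = \<psi> (lam, LL T k p)"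
      using imp[OF LN y, of lam p] u(3) by (simp add: uy)
    have Pi: "Psi_inv T k (lam, u) = (lam, p)"
      using PP_eq(1)[OF T k u(1)] inv_LL[OF T k] by (simp add: Psi_inv_def p_def)
    have "LL T k p + \<psi> (lam, LL T k p) = u" using 1 uy by simp
    then show ?thesis unfolding Pi using 1
      by (simp add: HH_zeros_def Psi_def HH_eq[OF T k] u(2) c0)
  qed
  then have *: "Psi_inv T k w \<in> HH_zeros T a k \<psi> I Nk \<and> Psi T k \<psi> (Psi_inv T k w) = w"
    if "w \<in> FF_zeros T a \<inter> Ok" for w
    using that by (cases w) blast
  show "Psi_inv T k \<in> FF_zeros T a \<inter> Ok \<rightarrow> HH_zeros T a k \<psi> I Nk" using * by blast
  show "w \<in> FF_zeros T a \<inter> Ok \<Longrightarrow> Psi T k \<psi> (Psi_inv T k w) = w" using * by blast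
qed

theorem theorem3p12:
  fixes T :: real and a :: mfun and k :: nat
    and I :: "real set" and Nk :: "mfun set" and Ok :: "(real \<times> mfun) set"
    and \<psi> :: "real \<times> mfun \<Rightarrow> mfun"
  assumes "T > 0" and "a \<in> Linf T" and "AE t in lborel. t \<in> {0..T} \<longrightarrow> rep_mfun a t \<ge> 0" and "a \<noteq> 0"
    and "k \<ge> 1"
    and "open I" and "sig T k \<in> I"
    and "openin (ntop (nsub (Hsp 2 T) (NN T k))) Nk" and "0 \<in> Nk"
    and "openin (prod_topology euclideanreal (ntop (Hsp 2 T))) Ok" and "(sig T k, 0) \<in> Ok"
    and "\<psi> \<in> I \<times> Nk \<rightarrow> NNperp T k"
    and "smooth_on (nprod euclid (nsub (Hsp 2 T) (NN T k))) (nsub (Hsp 2 T) (NNperp T k)) (I \<times> Nk) \<psi>"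
    and "\<psi> (sig T k, 0) = 0"
    and "\<And>lam x y. x \<in> NN T k \<Longrightarrow> y \<in> NNperp T k \<Longrightarrow>
           (lam, x + y) \<in> Ok \<and> GG T a k lam x y = 0 \<longleftrightarrow> (lam, x) \<in> I \<times> Nk \<and> y = \<psi> (lam, x)"
    and "\<And>lam x. (lam, x) \<in> I \<times> Nk \<Longrightarrow>
           fderiv (nsub (Hsp 2 T) (NNperp T k)) (nsub (Hsp 0 T) (RR T k)) (\<lambda>y. GG T a k lam x y) (\<psi> (lam, x))
             \<in> GL (nsub (Hsp 2 T) (NNperp T k)) (nsub (Hsp 0 T) (RR T k))"
  shows "(Psi T k \<psi> \<in> HH_zeros T a k \<psi> I Nk \<rightarrow> FF_zeros T a \<inter> Ok \<and>
          Psi_inv T k \<in> FF_zeros T a \<inter> Ok \<rightarrow> HH_zeros T a k \<psi> I Nk \<and>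
          (\<forall>z \<in> HH_zeros T a k \<psi> I Nk. Psi_inv T k (Psi T k \<psi> z) = z) \<and>
          (\<forall>w \<in> FF_zeros T a \<inter> Ok. Psi T k \<psi> (Psi_inv T k w) = w)) \<and>
         homeomorphic_map
           (top_of_set (HH_zeros T a k \<psi> I Nk))
           (subtopology (prod_topology euclideanreal (ntop (Hsp 2 T))) (FF_zeros T a \<inter> Ok))
           (Psi T k \<psi>) \<and>
         (\<forall>(lam, p) \<in> HH_zeros T a k \<psi> I Nk.
            frechet_derivative (HH T a k \<psi> lam) (at p) \<in> GL euclid euclid \<longleftrightarrow>
            fderiv (Hsp 2 T) (Hsp 0 T) (FF T a lam) (snd (Psi T k \<psi> (lam, p))) \<in> GL (Hsp 2 T) (Hsp 0 T))"
proof (intro conjI)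
  note T = assms(1) and k = assms(5) and \<psi> = assms(12) and sm = assms(13)
  note bij = Psi_bijection[OF T k \<psi> assms(15)]
  let ?Z = "HH_zeros T a k \<psi> I Nk" and ?W = "FF_zeros T a \<inter> Ok"
  let ?X = "prod_topology euclideanreal (ntop (Hsp 2 T))"
  show "Psi T k \<psi> \<in> ?Z \<rightarrow> ?W" by (rule bij(1))
  show "Psi_inv T k \<in> ?W \<rightarrow> ?Z" by (rule bij(2))
  show "\<forall>z\<in>?Z. Psi_inv T k (Psi T k \<psi> z) = z" using bij(3) by blast
  show "\<forall>w\<in>?W. Psi T k \<psi> (Psi_inv T k w) = w" using bij(4) by blast
  have WH: "?W \<subseteq> UNIV \<times> Hper 2 T" by (auto simp: FF_zeros_def)
  have "homeomorphic_maps (top_of_set ?Z) (subtopology ?X ?W) (Psi T k \<psi>) (Psi_inv T k)"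
    unfolding homeomorphic_maps_def continuous_map_in_subtopology
  proof (intro conjI)
    show "continuous_map (top_of_set ?Z) ?X (Psi T k \<psi>)"
      by (rule continuous_map_Psi[OF T k sm]) (simp add: HH_zeros_def)
    show "continuous_map (subtopology ?X ?W) euclidean (Psi_inv T k)"
      by (rule continuous_map_Psi_inv[OF T k WH])
  qed (use bij in \<open>simp_all add: Pi_iff\<close>)
  then show "homeomorphic_map (top_of_set ?Z) (subtopology ?X ?W) (Psi T k \<psi>)"
    by (simp add: homeomorphic_maps_map)
  show "\<forall>(lam, p) \<in> ?Z.
      frechet_derivative (HH T a k \<psi> lam) (at p) \<in> GL euclid euclid \<longleftrightarrow>
      fderiv (Hsp 2 T) (Hsp 0 T) (FF T a lam) (snd (Psi T k \<psi> (lam, p))) \<in> GL (Hsp 2 T) (Hsp 0 T)"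
  proof clarify
    fix lam p assume "(lam, p) \<in> ?Z"
    then have z: "lam \<in> I" "LL T k p \<in> Nk" by (auto simp: HH_zeros_def)
    \<comment> \<open>An open set lies inside its space. The graph property of \<open>\<psi>\<close>
      speaks only of points of the kernel, so this inclusion must come before its use on
      \<open>Nk\<close>.\<close>
    have sub: "Nk \<subseteq> NN T k"
    proof
      fix x assume "x \<in> Nk"
      then show "x \<in> NN T k"
        using openin_subset[OF assms(8)] topspace_ntop[OF nvs_NN[OF T]] by (auto simp: nsub_def)
    qed
    have "GG T a k lam x (\<psi> (lam, x)) = 0" if "x \<in> Nk" for x
      using assms(15)[of x "\<psi> (lam, x)" lam] \<psi> sub z(1) that by auto
    then show "frechet_derivative (HH T a k \<psi> lam) (at p) \<in> GL euclid euclid \<longleftrightarrow>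
        fderiv (Hsp 2 T) (Hsp 0 T) (FF T a lam) (snd (Psi T k \<psi> (lam, p))) \<in> GL (Hsp 2 T) (Hsp 0 T)"
      using GL_reduction[OF T k assms(2,8) \<psi> sm z] assms(16) z by (simp add: Psi_def)
  qed
qed

end
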